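(* Let $(\mathscr E,t)=\{t_k\}_{k\in\mathbb Z}$ be an $\mathcal A$-Hilbert complex. (i) The complex $(\mathscr E,t)$ has weak Hodge decomposition if and only if, for every $k$, the differential map $t_k$ is polar decomposable. (ii) If $(\mathscr E,t)$ has finite length, then $(\mathscr E,t)$ has weak Hodge decomposition if and only if the even Dirac operator $\mathcal D^+_t$ is polar decomposable.
   Context: $\mathcal A$ is a fixed complex C*-algebra. Hilbert $\mathcal A$-modules are right Hilbert C*-modules over $\mathcal A$; $\oplus$ is the orthogonal direct sum; $\mathcal L_{\mathcal A}(\mathscr E,\mathscr F)$ is the space of adjointable operators. A densely defined $\mathcal A$-linear operator $t\colon \mathrm{dom}(t)\subset \mathscr E\to\mathscr F$ is semi-regular if its adjoint $t^*$ is densely defined; a semi-regular $t$ is regular if it is closed and $1+t^*t$ has dense range. $\mathcal R_{\mathcal A}(\mathscr E,\mathscr F)$ denotes the set of regular operators. An $\mathcal A$-Hilbert complex $(\mathscr E,t)$ is a sequence of regular operators $t_k\in\mathcal R_{\mathcal A}(\mathscr E_k,\mathscr E_{k+1})$, $k\in\mathbb Z$ (its differential maps), between Hilbert $\mathcal A$-modules, with $\mathrm{ran}(t_k)\subset\ker(t_{k+1})$ for all $k$. It has finite length if $\mathscr E_k=0$ for $|k|$ large; it is then indexed so that $\mathscr E_k=0$ unless $0\le k\le N+1$, written $\{t_k\}_{k=0}^N$, and $t_k=0$ (everywhere defined) for $k<0$ or $k>N$. The complex has weak Hodge decomposition if for all $k\in\mathbb Z$, $\mathscr E_k=(\ker t_k\cap\ker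 t_{k-1}^* )\oplus\overline{\mathrm{ran}(t_k^* )}\oplus\overline{\mathrm{ran}(t_{k-1})}$. An adjointable $T\in\mathcal L_{\mathcal A}(\mathscr E,\mathscr F)$ is polar decomposable if $T=V|T|$ for a partial isometry $V\in\mathcal L_{\mathcal A}(\mathscr E,\mathscr F)$ with $\ker V=\ker T$, $\ker V^*=\ker T^*$, $\mathrm{ran}(V)=\overline{\mathrm{ran}(T)}$, $\mathrm{ran}(V^* )=\overline{\mathrm{ran}(|T|)}$. A regular operator $t$ is polar decomposable if its bounded transform $F_t=t(1+t^*t)^{-1/2}\in\mathcal L_{\mathcal A}(\mathscr E,\mathscr F)$ is. For a finite-length complex put $\mathscr E_{\mathrm{ev}}=\bigoplus_k\mathscr E_{2k}$, $\mathscr E_{\mathrm{odd}}=\bigoplus_k\mathscr E_{2k+1}$. The even Dirac operator $\mathcal D^+_t\colon\mathrm{dom}(\mathcal D^+_t)\subset\mathscr E_{\mathrm{ev}}\to\mathscr E_{\mathrm{odd}}$ has domain $\bigoplus_k \mathrm{dom}(t_{2k})\cap\mathrm{dom}(t_{2k-1}^* )$ and is given by $\mathcal D^+_t(x_{2k})_k=(t_{2k}x_{2k}+t_{2k+1}^*x_{2k+2})_k$; it is a regular operator. *)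

theory Defs
  imports "HOL-Analysis.Analysis" "HOL-Library.Function_Algebras"
begin

section \<open>Complex C*-algebras, not necessarily unital\<close>

class complex_vector = ab_group_add +
  fixes scaleC :: "complex \<Rightarrow> 'a \<Rightarrow> 'a"  (infixr \<open>*\<^sub>C\<close> 75)
  assumes scaleC_add_right: "c *\<^sub>C (x + y) = c *\<^sub>C x + c *\<^sub>C y"
    and scaleC_add_left: "(c + d) *\<^sub>C x = c *\<^sub>C x + d *\<^sub>C x"
    and scaleC_scaleC: "c *\<^sub>C d *\<^sub>C x = (c * d) *\<^sub>C x"
    and scaleC_one: "1 *\<^sub>C x = x"

class cstar_algebra = real_normed_algebra + complete_space + complex_vector +
  fixes cstar :: "'a \<Rightarrow> 'a"
  assumes scaleC_of_real: "complex_of_real r *\<^sub>C x = r *\<^sub>R x"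
    and norm_scaleC: "norm (c *\<^sub>C x) = cmod c * norm x"
    and scaleC_mult_left: "(c *\<^sub>C x) * y = c *\<^sub>C (x * y)"
    and scaleC_mult_right: "x * (c *\<^sub>C y) = c *\<^sub>C (x * y)"
    and cstar_cstar: "cstar (cstar x) = x"
    and cstar_add: "cstar (x + y) = cstar x + cstar y"
    and cstar_scaleC: "cstar (c *\<^sub>C x) = cnj c *\<^sub>C cstar x"
    and cstar_mult: "cstar (x * y) = cstar y * cstar x"
    and norm_cstar_mult: "norm (cstar x * x) = (norm x)\<^sup>2"

instantiation complex :: cstar_algebra
begin
definition scaleC_complex :: "complex \<Rightarrow> complex \<Rightarrow> complex" where
  "scaleC_complex c x = c * x"
definition cstar_complex :: "complex \<Rightarrow> complex" where
  "cstar_complex x = cnj x"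
instance
  by standard
    (simp_all add: scaleC_complex_def cstar_complex_def algebra_simps scaleR_conv_of_real
      norm_mult power2_eq_square)
end

instantiation "fun" :: (type, complex_vector) complex_vector
begin
definition scaleC_fun :: "complex \<Rightarrow> ('a \<Rightarrow> 'b) \<Rightarrow> 'a \<Rightarrow> 'b" where
  "scaleC_fun c f = (\<lambda>i. c *\<^sub>C f i)"
instance
  by standard
    (simp_all add: scaleC_fun_def fun_eq_iff scaleC_add_right scaleC_add_left
      scaleC_scaleC scaleC_one)
end


section \<open>Right Hilbert C*-modules\<close>

text \<open>
  To allow sequences of different modules, a module is given by a carrier, which is a linear
  subspace of a complex vector space type, together with its own action and inner product.
  Sharing the ambient vector space costs no generality: a sequence of modules embeds into its
  algebraic product.
  The inner product is conjugate-linear in the first and linear in the second argument.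
\<close>

record ('a, 'e) hilbert_mod =
  hm_carrier :: "'e set"
  hm_act :: "'e \<Rightarrow> 'a \<Rightarrow> 'e"
  hm_ip :: "'e \<Rightarrow> 'e \<Rightarrow> 'a"

definition hm_norm :: "('a::cstar_algebra, 'e) hilbert_mod \<Rightarrow> 'e \<Rightarrow> real" where
  "hm_norm E x = sqrt (norm (hm_ip E x x))"

definition cstar_positive :: "'a::cstar_algebra \<Rightarrow> bool" where
  "cstar_positive a \<longleftrightarrow> (\<exists>b. a = cstar b * b)"

locale hilbert_module =
  fixes E :: "('a::cstar_algebra, 'e::complex_vector) hilbert_mod"
  assumes zero_closed: "0 \<in> hm_carrier E"
    and add_closed: "x \<in> hm_carrier E \<Longrightarrow> y \<in> hm_carrier E \<Longrightarrow> x + y \<in> hm_carrier E"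
    and scaleC_closed: "x \<in> hm_carrier E \<Longrightarrow> c *\<^sub>C x \<in> hm_carrier E"
    and act_closed: "x \<in> hm_carrier E \<Longrightarrow> hm_act E x a \<in> hm_carrier E"
    and act_add_left: "x \<in> hm_carrier E \<Longrightarrow> y \<in> hm_carrier E \<Longrightarrow>
      hm_act E (x + y) a = hm_act E x a + hm_act E y a"
    and act_add_right: "x \<in> hm_carrier E \<Longrightarrow> hm_act E x (a + b) = hm_act E x a + hm_act E x b"
    and act_mult: "x \<in> hm_carrier E \<Longrightarrow> hm_act E x (a * b) = hm_act E (hm_act E x a) b"
    and act_scaleC_left: "x \<in> hm_carrier E \<Longrightarrow> hm_act E (c *\<^sub>C x) a = c *\<^sub>C hm_act E x a"
    and act_scaleC_right: "x \<in> hm_carrier E \<Longrightarrow> hm_act E x (c *\<^sub>C a) = c *\<^sub>C hm_act E x a"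
    and ip_add_right: "x \<in> hm_carrier E \<Longrightarrow> y \<in> hm_carrier E \<Longrightarrow> z \<in> hm_carrier E \<Longrightarrow>
      hm_ip E x (y + z) = hm_ip E x y + hm_ip E x z"
    and ip_scaleC_right: "x \<in> hm_carrier E \<Longrightarrow> y \<in> hm_carrier E \<Longrightarrow>
      hm_ip E x (c *\<^sub>C y) = c *\<^sub>C hm_ip E x y"
    and ip_act_right: "x \<in> hm_carrier E \<Longrightarrow> y \<in> hm_carrier E \<Longrightarrow>
      hm_ip E x (hm_act E y a) = hm_ip E x y * a"
    and ip_cstar: "x \<in> hm_carrier E \<Longrightarrow> y \<in> hm_carrier E \<Longrightarrow> cstar (hm_ip E x y) = hm_ip E y x"
    and ip_positive: "x \<in> hm_carrier E \<Longrightarrow> cstar_positive (hm_ip E x x)"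
    and ip_definite: "x \<in> hm_carrier E \<Longrightarrow> hm_ip E x x = 0 \<Longrightarrow> x = 0"
    and complete: "(\<And>n. s n \<in> hm_carrier E) \<Longrightarrow>
      (\<And>e. e > 0 \<Longrightarrow> \<exists>N. \<forall>m\<ge>N. \<forall>n\<ge>N. hm_norm E (s m - s n) < e) \<Longrightarrow>
      \<exists>l\<in>hm_carrier E. (\<lambda>n. hm_norm E (s n - l)) \<longlonglongrightarrow> 0"

definition hm_closure :: "('a::cstar_algebra, 'e::complex_vector) hilbert_mod \<Rightarrow> 'e set \<Rightarrow> 'e set" where
  "hm_closure E S = {x \<in> hm_carrier E. \<forall>e>0. \<exists>y\<in>S. hm_norm E (x - y) < e}"

definition hm_dense :: "('a::cstar_algebra, 'e::complex_vector) hilbert_mod \<Rightarrow> 'e set \<Rightarrow> bool" where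
  "hm_dense E S \<longleftrightarrow> hm_closure E S = hm_carrier E"

definition orthogonal_sets :: "('a::cstar_algebra, 'e) hilbert_mod \<Rightarrow> 'e set \<Rightarrow> 'e set \<Rightarrow> bool" where
  "orthogonal_sets E M N \<longleftrightarrow> (\<forall>x\<in>M. \<forall>y\<in>N. hm_ip E x y = 0)"

text \<open>\<open>E\<close> is the internal orthogonal direct sum of \<open>M\<close>, \<open>N\<close> and \<open>P\<close>.\<close>

definition orthogonal_sum3 ::
  "('a::cstar_algebra, 'e::complex_vector) hilbert_mod \<Rightarrow> 'e set \<Rightarrow> 'e set \<Rightarrow> 'e set \<Rightarrow> bool" where
  "orthogonal_sum3 E M N P \<longleftrightarrow>
     orthogonal_sets E M N \<and> orthogonal_sets E M P \<and> orthogonal_sets E N P \<and>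
     hm_carrier E = {x + y + z |x y z. x \<in> M \<and> y \<in> N \<and> z \<in> P}"

text \<open>
  The external direct sum consists of the finitely supported families. It is used only when
  all but finitely many summands vanish, so no completion is needed.
\<close>

definition hm_direct_sum ::
  "('i \<Rightarrow> ('a::cstar_algebra, 'e::complex_vector) hilbert_mod) \<Rightarrow> ('a, 'i \<Rightarrow> 'e) hilbert_mod" where
  "hm_direct_sum E =
    \<lparr>hm_carrier = {x. (\<forall>k. x k \<in> hm_carrier (E k)) \<and> finite {k. x k \<noteq> 0}},
     hm_act = (\<lambda>x a k. hm_act (E k) (x k) a),
     hm_ip = (\<lambda>x y. \<Sum>k | x k \<noteq> 0 \<and> y k \<noteq> 0. hm_ip (E k) (x k) (y k))\<rparr>"


section \<open>Operators, identified with their graphs\<close>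

text \<open>
  \<open>Domain t\<close> and \<open>Range t\<close> are the domain and the range of \<open>t\<close>. Relational composition runs
  from left to right, so the operator product \<open>s t\<close> is \<open>t O s\<close>.
\<close>

abbreviation (input) op_mult :: "('f \<times> 'g) set \<Rightarrow> ('e \<times> 'f) set \<Rightarrow> ('e \<times> 'g) set"
    (infixl \<open>\<odot>\<close> 70) where
  "s \<odot> t \<equiv> t O s"

definition op_app :: "('e \<times> 'f) set \<Rightarrow> 'e \<Rightarrow> 'f" where
  "op_app t x = (THE y. (x, y) \<in> t)"

definition op_ker :: "('e \<times> 'f::zero) set \<Rightarrow> 'e set" where
  "op_ker t = {x. (x, 0) \<in> t}"

definition module_operator ::
  "('a::cstar_algebra, 'e::complex_vector) hilbert_mod \<Rightarrow> ('a, 'f::complex_vector) hilbert_mod \<Rightarrow>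
    ('e \<times> 'f) set \<Rightarrow> bool" where
  "module_operator E F t \<longleftrightarrow>
     t \<subseteq> hm_carrier E \<times> hm_carrier F \<and> single_valued t \<and> (0, 0) \<in> t \<and>
     (\<forall>x y x' y'. (x, y) \<in> t \<longrightarrow> (x', y') \<in> t \<longrightarrow> (x + x', y + y') \<in> t) \<and>
     (\<forall>c x y. (x, y) \<in> t \<longrightarrow> (c *\<^sub>C x, c *\<^sub>C y) \<in> t) \<and>
     (\<forall>x y a. (x, y) \<in> t \<longrightarrow> (hm_act E x a, hm_act F y a) \<in> t)"

text \<open>For densely defined \<open>t\<close> the following relation is single-valued.\<close>

definition op_adjoint ::
  "('a, 'e) hilbert_mod \<Rightarrow> ('a, 'f) hilbert_mod \<Rightarrow> ('e \<times> 'f) set \<Rightarrow> ('f \<times> 'e) set" where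
  "op_adjoint E F t =
    {(y, z). y \<in> hm_carrier F \<and> z \<in> hm_carrier E \<and> (\<forall>(x, w)\<in>t. hm_ip F w y = hm_ip E x z)}"

definition op_closed ::
  "('a::cstar_algebra, 'e::complex_vector) hilbert_mod \<Rightarrow> ('a, 'f::complex_vector) hilbert_mod \<Rightarrow>
    ('e \<times> 'f) set \<Rightarrow> bool" where
  "op_closed E F t \<longleftrightarrow>
    (\<forall>x\<in>hm_carrier E. \<forall>y\<in>hm_carrier F.
       (\<forall>e>0. \<exists>(u, v)\<in>t. hm_norm E (x - u) < e \<and> hm_norm F (y - v) < e) \<longrightarrow> (x, y) \<in> t)"

definition semiregular ::
  "('a::cstar_algebra, 'e::complex_vector) hilbert_mod \<Rightarrow> ('a, 'f::complex_vector) hilbert_mod \<Rightarrow>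
    ('e \<times> 'f) set \<Rightarrow> bool" where
  "semiregular E F t \<longleftrightarrow>
     module_operator E F t \<and> hm_dense E (Domain t) \<and> hm_dense F (Domain (op_adjoint E F t))"

definition one_plus_adjoint_self ::
  "('a, 'e::complex_vector) hilbert_mod \<Rightarrow> ('a, 'f) hilbert_mod \<Rightarrow> ('e \<times> 'f) set \<Rightarrow> ('e \<times> 'e) set" where
  "one_plus_adjoint_self E F t = {(x, x + z) |x z. (x, z) \<in> op_adjoint E F t \<odot> t}"

definition regular_operator ::
  "('a::cstar_algebra, 'e::complex_vector) hilbert_mod \<Rightarrow> ('a, 'f::complex_vector) hilbert_mod \<Rightarrow>
    ('e \<times> 'f) set \<Rightarrow> bool" where
  "regular_operator E F t \<longleftrightarrow>
     semiregular E F t \<and> op_closed E F t \<and> hm_dense E (Range (one_plus_adjoint_self E F t))"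

definition adjointable ::
  "('a::cstar_algebra, 'e::complex_vector) hilbert_mod \<Rightarrow> ('a, 'f::complex_vector) hilbert_mod \<Rightarrow>
    ('e \<times> 'f) set \<Rightarrow> bool" where
  "adjointable E F T \<longleftrightarrow>
     module_operator E F T \<and> Domain T = hm_carrier E \<and> Domain (op_adjoint E F T) = hm_carrier F"

text \<open>Positivity in the C*-algebra of adjointable operators on \<open>E\<close>.\<close>

definition positive_operator ::
  "('a::cstar_algebra, 'e::complex_vector) hilbert_mod \<Rightarrow> ('e \<times> 'e) set \<Rightarrow> bool" where
  "positive_operator E P \<longleftrightarrow> (\<exists>S. adjointable E E S \<and> P = op_adjoint E E S \<odot> S)"

definition op_sqrt ::
  "('a::cstar_algebra, 'e::complex_vector) hilbert_mod \<Rightarrow> ('e \<times> 'e) set \<Rightarrow> ('e \<times> 'e) set" where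
  "op_sqrt E P = (THE S. positive_operator E S \<and> S \<odot> S = P)"

definition op_modulus ::
  "('a::cstar_algebra, 'e::complex_vector) hilbert_mod \<Rightarrow> ('a, 'f::complex_vector) hilbert_mod \<Rightarrow>
    ('e \<times> 'f) set \<Rightarrow> ('e \<times> 'e) set" where
  "op_modulus E F T = op_sqrt E (op_adjoint E F T \<odot> T)"

text \<open>The power \<open>-1/2\<close> of \<open>1 + t* t\<close> is the positive square root of its inverse (the converse graph).\<close>

definition bounded_transform ::
  "('a::cstar_algebra, 'e::complex_vector) hilbert_mod \<Rightarrow> ('a, 'f::complex_vector) hilbert_mod \<Rightarrow>
    ('e \<times> 'f) set \<Rightarrow> ('e \<times> 'f) set" where
  "bounded_transform E F t = t \<odot> op_sqrt E ((one_plus_adjoint_self E F t)\<inverse>)"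

definition op_projection ::
  "('a::cstar_algebra, 'e::complex_vector) hilbert_mod \<Rightarrow> ('e \<times> 'e) set \<Rightarrow> bool" where
  "op_projection E P \<longleftrightarrow> adjointable E E P \<and> op_adjoint E E P = P \<and> P \<odot> P = P"

definition partial_isometry ::
  "('a::cstar_algebra, 'e::complex_vector) hilbert_mod \<Rightarrow> ('a, 'f::complex_vector) hilbert_mod \<Rightarrow>
    ('e \<times> 'f) set \<Rightarrow> bool" where
  "partial_isometry E F V \<longleftrightarrow> adjointable E F V \<and> op_projection E (op_adjoint E F V \<odot> V)"

definition adjointable_polar_decomposable ::
  "('a::cstar_algebra, 'e::complex_vector) hilbert_mod \<Rightarrow> ('a, 'f::complex_vector) hilbert_mod \<Rightarrow>
    ('e \<times> 'f) set \<Rightarrow> bool" where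
  "adjointable_polar_decomposable E F T \<longleftrightarrow>
     adjointable E F T \<and>
     (\<exists>V. partial_isometry E F V \<and> T = V \<odot> op_modulus E F T \<and>
          op_ker V = op_ker T \<and>
          op_ker (op_adjoint E F V) = op_ker (op_adjoint E F T) \<and>
          Range V = hm_closure F (Range T) \<and>
          Range (op_adjoint E F V) = hm_closure E (Range (op_modulus E F T)))"

definition polar_decomposable ::
  "('a::cstar_algebra, 'e::complex_vector) hilbert_mod \<Rightarrow> ('a, 'f::complex_vector) hilbert_mod \<Rightarrow>
    ('e \<times> 'f) set \<Rightarrow> bool" where
  "polar_decomposable E F t \<longleftrightarrow>
     regular_operator E F t \<and> adjointable_polar_decomposable E F (bounded_transform E F t)"


section \<open>Hilbert complexes\<close>

definition hilbert_complex ::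
  "(int \<Rightarrow> ('a::cstar_algebra, 'e::complex_vector) hilbert_mod) \<Rightarrow> (int \<Rightarrow> ('e \<times> 'e) set) \<Rightarrow> bool" where
  "hilbert_complex E t \<longleftrightarrow>
     (\<forall>k. hilbert_module (E k)) \<and>
     (\<forall>k. regular_operator (E k) (E (k + 1)) (t k)) \<and>
     (\<forall>k. Range (t k) \<subseteq> op_ker (t (k + 1)))"

text \<open>
  No normalisation of the indices is imposed. A regular operator from or to the zero module is
  automatically zero and everywhere defined.
\<close>

definition finite_length :: "(int \<Rightarrow> ('a, 'e::zero) hilbert_mod) \<Rightarrow> bool" where
  "finite_length E \<longleftrightarrow> (\<exists>M. \<forall>k. \<bar>k\<bar> > M \<longrightarrow> hm_carrier (E k) = {0})"

definition weak_Hodge_decomposition ::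
  "(int \<Rightarrow> ('a::cstar_algebra, 'e::complex_vector) hilbert_mod) \<Rightarrow> (int \<Rightarrow> ('e \<times> 'e) set) \<Rightarrow> bool" where
  "weak_Hodge_decomposition E t \<longleftrightarrow>
     (\<forall>k. orthogonal_sum3 (E k)
            (op_ker (t k) \<inter> op_ker (op_adjoint (E (k - 1)) (E k) (t (k - 1))))
            (hm_closure (E k) (Range (op_adjoint (E k) (E (k + 1)) (t k))))
            (hm_closure (E k) (Range (t (k - 1)))))"

definition even_module ::
  "(int \<Rightarrow> ('a::cstar_algebra, 'e::complex_vector) hilbert_mod) \<Rightarrow> ('a, int \<Rightarrow> 'e) hilbert_mod" where
  "even_module E = hm_direct_sum (\<lambda>k. E (2 * k))"

definition odd_module ::
  "(int \<Rightarrow> ('a::cstar_algebra, 'e::complex_vector) hilbert_mod) \<Rightarrow> ('a, int \<Rightarrow> 'e) hilbert_mod" where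
  "odd_module E = hm_direct_sum (\<lambda>k. E (2 * k + 1))"

text \<open>The entry \<open>x k\<close> of an element of \<open>even_module E\<close> is its component of degree \<open>2 * k\<close>.\<close>

definition even_Dirac ::
  "(int \<Rightarrow> ('a::cstar_algebra, 'e::complex_vector) hilbert_mod) \<Rightarrow> (int \<Rightarrow> ('e \<times> 'e) set) \<Rightarrow>
    ((int \<Rightarrow> 'e) \<times> (int \<Rightarrow> 'e)) set" where
  "even_Dirac E t =
    {(x, \<lambda>k. op_app (t (2 * k)) (x k) +
             op_app (op_adjoint (E (2 * k + 1)) (E (2 * k + 2)) (t (2 * k + 1))) (x (k + 1))) |x.
      x \<in> hm_carrier (even_module E) \<and>
      (\<forall>k. x k \<in> Domain (t (2 * k)) \<inter>
             Domain (op_adjoint (E (2 * k - 1)) (E (2 * k)) (t (2 * k - 1))))}"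

end

theory Submission
  imports Defs "HOL-Library.Groups_Big_Fun"
begin

text \<open>
  A regular operator \<open>t\<close> between Hilbert modules \<open>E\<close> and \<open>F\<close> is polar decomposable if and only if both
  modules split orthogonally, \<open>E\<close> into the kernel of \<open>t\<close> and the closed range of \<open>t\<^sup>*\<close>, and \<open>F\<close> into the
  kernel of \<open>t\<^sup>*\<close> and the closed range of \<open>t\<close> (lemma \<open>graph_pair.polar_decomposable_iff\<close>). Granted this,
  both parts of the theorem compare orthogonal decompositions. For a complex, the kernel of \<open>t\<^sub>k\<close>
  contains the closed range of \<open>t\<^sub>k\<^sub>-\<^sub>1\<close> and the kernel of \<open>t\<^sub>k\<^sub>-\<^sub>1\<^sup>*\<close> contains the closed range of \<open>t\<^sub>k\<^sup>*\<close>, so the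
  Hodge decomposition in degree \<open>k\<close> amounts to the two splittings of \<open>E\<^sub>k\<close> given by \<open>t\<^sub>k\<close> and by
  \<open>t\<^sub>k\<^sub>-\<^sub>1\<close>. The even Dirac operator has the harmonic elements of even degree as its kernel; a value of it
  is a sum of an exact and a coexact element, which are orthogonal and so can be approximated
  separately. Hence the splittings for the Dirac operator and its adjoint are the Hodge decompositions
  in the even and in the odd degrees.

  The criterion for \<open>t\<close> is first proved for bounded operators, in the locale \<open>modulus\<close>, where the partial
  isometry is the closure of \<open>\<bar>T\<bar> x \<mapsto> T x\<close> extended by zero. The transfer to \<open>t\<close> needs the bounded
  transform, with its kernel, closed range and adjoint. All this is read off the resolvent
  \<open>(1 + t\<^sup>* t)\<^sup>-\<^sup>1\<close> and its square root. The locale \<open>graph_pair\<close> describes a regular operator together with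
  its adjoint in a form that is symmetric in the two: a pair of formally adjoint, densely defined linear
  relations \<open>t\<close> and \<open>s\<close> such that \<open>1 + s t\<close> and \<open>1 + t s\<close> are onto. Such relations are automatically
  closed, regular and adjoint to each other. This settles the regularity of the Dirac operator and
  identifies its adjoint at the same time, because its square is diagonal and
  \<open>1 + t\<^sub>k\<^sup>* t\<^sub>k + t\<^sub>k\<^sub>-\<^sub>1 t\<^sub>k\<^sub>-\<^sub>1\<^sup>*\<close> is a product of two operators that are onto.

  Square roots are constructed by iterating \<open>z \<mapsto> (y + z\<^sup>2) / 2\<close> for a self-adjoint contraction \<open>y\<close>, which
  converges to \<open>1 - sqrt (1 - y)\<close>. Being limits of polynomials in \<open>y\<close>, they inherit commutation relations
  and invariant subspaces. The order of a C*-algebra is developed from these roots alone, without spectra,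
  up to the positivity of \<open>b\<^sup>* b\<close> in sums and the Cauchy-Schwarz inequality for Hilbert modules.
\<close>


section \<open>Preliminaries on complex vector spaces and C*-algebras\<close>

global_interpretation cv: vector_space "scaleC :: complex \<Rightarrow> 'a \<Rightarrow> 'a::complex_vector"
  by unfold_locales (simp_all add: scaleC_add_right scaleC_add_left scaleC_scaleC scaleC_one)

lemma cstar_0 [simp]: "cstar (0::'a::cstar_algebra) = 0"
  using cstar_add[of "0::'a" 0] by simp

lemma cstar_scaleR: "cstar (r *\<^sub>R x) = r *\<^sub>R cstar (x::'a::cstar_algebra)"
  using cstar_scaleC[of "complex_of_real r" x] by (simp add: scaleC_of_real)

lemma norm_cstar [simp]: "norm (cstar x) = norm (x::'a::cstar_algebra)"
proof -
  have le: "norm (x::'a) \<le> norm (cstar x)" for x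
  proof (cases "norm x = 0")
    case False
    have "norm x * norm x \<le> norm (cstar x) * norm x"
      using norm_mult_ineq[of "cstar x" x] norm_cstar_mult[of x] by (simp add: power2_eq_square)
    with False show ?thesis by (simp add: mult_le_cancel_right)
  qed simp
  from le[of x] le[of "cstar x"] show ?thesis by (simp add: cstar_cstar)
qed


section \<open>Modules satisfying the Cauchy-Schwarz inequality\<close>

locale pre_module =
  fixes E :: "('a::cstar_algebra, 'e::complex_vector) hilbert_mod"
  assumes zero_closed [simp]: "0 \<in> hm_carrier E"
    and add_closed [simp]: "x \<in> hm_carrier E \<Longrightarrow> y \<in> hm_carrier E \<Longrightarrow> x + y \<in> hm_carrier E"
    and scaleC_closed [simp]: "x \<in> hm_carrier E \<Longrightarrow> c *\<^sub>C x \<in> hm_carrier E"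
    and act_closed [simp]: "x \<in> hm_carrier E \<Longrightarrow> hm_act E x a \<in> hm_carrier E"
    and ip_add_right: "x \<in> hm_carrier E \<Longrightarrow> y \<in> hm_carrier E \<Longrightarrow> z \<in> hm_carrier E \<Longrightarrow>
      hm_ip E x (y + z) = hm_ip E x y + hm_ip E x z"
    and ip_scaleC_right: "x \<in> hm_carrier E \<Longrightarrow> y \<in> hm_carrier E \<Longrightarrow>
      hm_ip E x (c *\<^sub>C y) = c *\<^sub>C hm_ip E x y"
    and ip_act_right: "x \<in> hm_carrier E \<Longrightarrow> y \<in> hm_carrier E \<Longrightarrow>
      hm_ip E x (hm_act E y a) = hm_ip E x y * a"
    and ip_cstar: "x \<in> hm_carrier E \<Longrightarrow> y \<in> hm_carrier E \<Longrightarrow> cstar (hm_ip E x y) = hm_ip E y x"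
    and ip_definite: "x \<in> hm_carrier E \<Longrightarrow> hm_ip E x x = 0 \<Longrightarrow> x = 0"
    and complete: "(\<And>n. s n \<in> hm_carrier E) \<Longrightarrow>
      (\<And>e. e > 0 \<Longrightarrow> \<exists>N. \<forall>m\<ge>N. \<forall>n\<ge>N. hm_norm E (s m - s n) < e) \<Longrightarrow>
      \<exists>l\<in>hm_carrier E. (\<lambda>n. hm_norm E (s n - l)) \<longlonglongrightarrow> 0"
begin

lemma uminus_closed [simp]: "x \<in> hm_carrier E \<Longrightarrow> - x \<in> hm_carrier E"
  using scaleC_closed[of x "-1"] by simp

lemma diff_closed [simp]: "x \<in> hm_carrier E \<Longrightarrow> y \<in> hm_carrier E \<Longrightarrow> x - y \<in> hm_carrier E"
  using add_closed[of x "- y"] by simp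

lemma ip_add_left:
  "x \<in> hm_carrier E \<Longrightarrow> y \<in> hm_carrier E \<Longrightarrow> z \<in> hm_carrier E \<Longrightarrow>
    hm_ip E (y + z) x = hm_ip E y x + hm_ip E z x"
  using arg_cong[OF ip_add_right[of x y z], of cstar] by (simp add: ip_cstar cstar_add)

lemma ip_scaleC_left:
  "x \<in> hm_carrier E \<Longrightarrow> y \<in> hm_carrier E \<Longrightarrow> hm_ip E (c *\<^sub>C x) y = cnj c *\<^sub>C hm_ip E x y"
  using arg_cong[OF ip_scaleC_right[of y x c], of cstar] by (simp add: ip_cstar cstar_scaleC)

lemma ip_act_left:
  "x \<in> hm_carrier E \<Longrightarrow> y \<in> hm_carrier E \<Longrightarrow> hm_ip E (hm_act E x a) y = cstar a * hm_ip E x y"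
  using arg_cong[OF ip_act_right[of y x a], of cstar] by (simp add: ip_cstar cstar_mult)

lemma ip_minus_right:
  "x \<in> hm_carrier E \<Longrightarrow> y \<in> hm_carrier E \<Longrightarrow> hm_ip E x (- y) = - hm_ip E x y"
  using ip_scaleC_right[of x y "-1"] by simp

lemma ip_minus_left:
  "x \<in> hm_carrier E \<Longrightarrow> y \<in> hm_carrier E \<Longrightarrow> hm_ip E (- x) y = - hm_ip E x y"
  using ip_scaleC_left[of x y "-1"] by simp

lemma ip_diff_right:
  "x \<in> hm_carrier E \<Longrightarrow> y \<in> hm_carrier E \<Longrightarrow> z \<in> hm_carrier E \<Longrightarrow>
    hm_ip E x (y - z) = hm_ip E x y - hm_ip E x z"
  using ip_add_right[of x y "- z"] by (simp add: ip_minus_right)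

lemma ip_diff_left:
  "x \<in> hm_carrier E \<Longrightarrow> y \<in> hm_carrier E \<Longrightarrow> z \<in> hm_carrier E \<Longrightarrow>
    hm_ip E (y - z) x = hm_ip E y x - hm_ip E z x"
  using ip_add_left[of x y "- z"] by (simp add: ip_minus_left)

lemma ip_0_right [simp]: "x \<in> hm_carrier E \<Longrightarrow> hm_ip E x 0 = 0"
  using ip_scaleC_right[of x 0 0] by simp

lemma ip_0_left [simp]: "x \<in> hm_carrier E \<Longrightarrow> hm_ip E 0 x = 0"
  using ip_scaleC_left[of 0 x 0] by simp

lemmas ip_simps = ip_add_left ip_add_right ip_diff_left ip_diff_right ip_minus_left ip_minus_right
  ip_scaleC_left ip_scaleC_right

lemma ip_eqI:
  assumes "x \<in> hm_carrier E" "y \<in> hm_carrier E"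
    and "\<And>z. z \<in> hm_carrier E \<Longrightarrow> hm_ip E z x = hm_ip E z y"
  shows "x = y"
  using ip_definite[of "x - y"] assms by (simp add: ip_diff_right)

lemma norm_nonneg [simp]: "hm_norm E x \<ge> 0"
  by (simp add: hm_norm_def)

lemma norm_sq: "(hm_norm E x)\<^sup>2 = norm (hm_ip E x x)"
  by (simp add: hm_norm_def)

lemma norm_0 [simp]: "hm_norm E 0 = 0"
  by (simp add: hm_norm_def)

lemma norm_eq_0: "x \<in> hm_carrier E \<Longrightarrow> hm_norm E x = 0 \<longleftrightarrow> x = 0"
  using ip_definite[of x] by (auto simp: hm_norm_def)

lemma norm_scaleC: "x \<in> hm_carrier E \<Longrightarrow> hm_norm E (c *\<^sub>C x) = cmod c * hm_norm E x"
  by (simp add: hm_norm_def ip_simps Defs.norm_scaleC scaleC_scaleC norm_mult real_sqrt_mult)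

lemma norm_minus [simp]: "x \<in> hm_carrier E \<Longrightarrow> hm_norm E (- x) = hm_norm E x"
  using norm_scaleC[of x "-1"] by simp

lemma norm_minus_commute:
  "x \<in> hm_carrier E \<Longrightarrow> y \<in> hm_carrier E \<Longrightarrow> hm_norm E (x - y) = hm_norm E (y - x)"
  using norm_minus[of "x - y"] by simp

end

text \<open>
  Positivity of the inner squares enters all of the analysis through the Cauchy-Schwarz inequality,
  whose proof for a general module needs square roots of operators on the algebra itself. The
  algebra, as a module over itself, satisfies the inequality because its norm is submultiplicative.
  Keeping the inequality as an axiom therefore lets one construction of square roots serve both the
  proof of the inequality and its later use.
\<close>

locale cs_module = pre_module +
  assumes Cauchy_Schwarz: "x \<in> hm_carrier E \<Longrightarrow> y \<in> hm_carrier E \<Longrightarrow>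
    norm (hm_ip E x y) \<le> hm_norm E x * hm_norm E y"
begin

lemma norm_triangle:
  assumes x: "x \<in> hm_carrier E" and y: "y \<in> hm_carrier E"
  shows "hm_norm E (x + y) \<le> hm_norm E x + hm_norm E y"
proof (rule power2_le_imp_le)
  have "(hm_norm E (x + y))\<^sup>2 = norm (hm_ip E x x + hm_ip E x y + (hm_ip E y x + hm_ip E y y))"
    using x y by (simp add: norm_sq ip_simps algebra_simps)
  also have "\<dots> \<le> norm (hm_ip E x x) + norm (hm_ip E x y) + (norm (hm_ip E y x) + norm (hm_ip E y y))"
    by (intro norm_triangle_le add_mono norm_triangle_ineq) 
  also have "\<dots> \<le> (hm_norm E x + hm_norm E y)\<^sup>2"
    using Cauchy_Schwarz[OF x y] Cauchy_Schwarz[OF y x]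
    by (simp add: norm_sq[symmetric] power2_eq_square algebra_simps)
  finally show "(hm_norm E (x + y))\<^sup>2 \<le> (hm_norm E x + hm_norm E y)\<^sup>2" .
qed simp

lemma norm_triangle_diff:
  assumes "x \<in> hm_carrier E" "y \<in> hm_carrier E" "z \<in> hm_carrier E"
  shows "hm_norm E (x - z) \<le> hm_norm E (x - y) + hm_norm E (y - z)"
  using norm_triangle[of "x - y" "y - z"] assms by simp

end

definition hm_lim :: "('a::cstar_algebra, 'e::complex_vector) hilbert_mod \<Rightarrow> (nat \<Rightarrow> 'e) \<Rightarrow> 'e \<Rightarrow> bool"
  where "hm_lim E s l \<longleftrightarrow> (\<forall>n. s n \<in> hm_carrier E) \<and> l \<in> hm_carrier E \<and>
    (\<lambda>n. hm_norm E (s n - l)) \<longlonglongrightarrow> 0"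

context cs_module
begin

lemma hm_limD: "hm_lim E s l \<Longrightarrow> s n \<in> hm_carrier E" "hm_lim E s l \<Longrightarrow> l \<in> hm_carrier E"
  by (auto simp: hm_lim_def)

lemma hm_lim_approx:
  assumes "hm_lim E s l" "e > 0"
  obtains n where "hm_norm E (s n - l) < e"
proof -
  have "\<forall>\<^sub>F n in sequentially. hm_norm E (s n - l) < e"
    using assms by (intro order_tendstoD(2)[of _ 0]) (auto simp: hm_lim_def)
  then show ?thesis using that by (auto simp: eventually_sequentially)
qed

lemma hm_lim_const: "x \<in> hm_carrier E \<Longrightarrow> hm_lim E (\<lambda>_. x) x"
  by (simp add: hm_lim_def)

lemma hm_lim_squeeze:
  assumes "\<And>n. s n \<in> hm_carrier E" "l \<in> hm_carrier E"
    and "\<And>n. hm_norm E (s n - l) \<le> e n" "e \<longlonglongrightarrow> 0"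
  shows "hm_lim E s l"
  unfolding hm_lim_def using assms
  by (auto intro!: tendsto_sandwich[OF _ _ tendsto_const assms(4)])

lemma hm_lim_add:
  assumes s: "hm_lim E s l" and r: "hm_lim E r m"
  shows "hm_lim E (\<lambda>n. s n + r n) (l + m)"
proof (rule hm_lim_squeeze)
  show "(\<lambda>n. hm_norm E (s n - l) + hm_norm E (r n - m)) \<longlonglongrightarrow> 0"
    using s r tendsto_add[of _ 0 _ _ 0] by (auto simp: hm_lim_def)
  show "hm_norm E (s n + r n - (l + m)) \<le> hm_norm E (s n - l) + hm_norm E (r n - m)" for n
    using norm_triangle[of "s n - l" "r n - m"] s r by (simp add: hm_lim_def algebra_simps)
qed (use s r in \<open>auto simp: hm_lim_def\<close>)

lemma hm_lim_scaleC:
  assumes s: "hm_lim E s l"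
  shows "hm_lim E (\<lambda>n. c *\<^sub>C s n) (c *\<^sub>C l)"
proof (rule hm_lim_squeeze)
  show "(\<lambda>n. cmod c * hm_norm E (s n - l)) \<longlonglongrightarrow> 0"
    using s tendsto_mult_right_zero by (auto simp: hm_lim_def)
  show "hm_norm E (c *\<^sub>C s n - c *\<^sub>C l) \<le> cmod c * hm_norm E (s n - l)" for n
    using s by (simp add: hm_lim_def norm_scaleC flip: cv.scale_right_diff_distrib)
qed (use s in \<open>auto simp: hm_lim_def\<close>)

lemma hm_lim_minus: "hm_lim E s l \<Longrightarrow> hm_lim E (\<lambda>n. - s n) (- l)"
  using hm_lim_scaleC[of s l "-1"] by simp

lemma hm_lim_diff: "hm_lim E s l \<Longrightarrow> hm_lim E r m \<Longrightarrow> hm_lim E (\<lambda>n. s n - r n) (l - m)"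
  using hm_lim_add[OF _ hm_lim_minus] by simp

lemma hm_lim_unique:
  assumes s: "hm_lim E s l" and r: "hm_lim E s m"
  shows "l = m"
proof -
  have "hm_lim E (\<lambda>n. 0) (l - m)"
    using hm_lim_diff[OF s r] by simp
  then have "hm_norm E (l - m) = 0"
    using norm_minus[of "l - m"] by (simp add: hm_lim_def LIMSEQ_const_iff)
  then show ?thesis using s r by (simp add: norm_eq_0 hm_lim_def)
qed

lemma hm_lim_ip_left:
  assumes s: "hm_lim E s l" and y: "y \<in> hm_carrier E"
  shows "(\<lambda>n. hm_ip E (s n) y) \<longlonglongrightarrow> hm_ip E l y"
proof -
  have lim: "(\<lambda>n. hm_norm E (s n - l) * hm_norm E y) \<longlonglongrightarrow> 0"
    using s by (auto simp: hm_lim_def intro: tendsto_mult_left_zero)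
  have le: "norm (hm_ip E (s n) y - hm_ip E l y) \<le> hm_norm E (s n - l) * hm_norm E y" for n
    using Cauchy_Schwarz[of "s n - l" y] hm_limD[OF s] y by (simp add: ip_diff_left)
  have "(\<lambda>n. hm_ip E (s n) y - hm_ip E l y) \<longlonglongrightarrow> 0"
    by (rule Lim_null_comparison[OF always_eventually lim]) (use le in blast)
  then show ?thesis by (rule LIM_zero_cancel)
qed

lemma hm_lim_ip_right:
  assumes s: "hm_lim E s l" and y: "y \<in> hm_carrier E"
  shows "(\<lambda>n. hm_ip E y (s n)) \<longlonglongrightarrow> hm_ip E y l"
proof -
  have lim: "(\<lambda>n. hm_norm E y * hm_norm E (s n - l)) \<longlonglongrightarrow> 0"
    using s by (auto simp: hm_lim_def intro: tendsto_mult_right_zero)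
  have le: "norm (hm_ip E y (s n) - hm_ip E y l) \<le> hm_norm E y * hm_norm E (s n - l)" for n
    using Cauchy_Schwarz[of y "s n - l"] hm_limD[OF s] y by (simp add: ip_diff_right)
  have "(\<lambda>n. hm_ip E y (s n) - hm_ip E y l) \<longlonglongrightarrow> 0"
    by (rule Lim_null_comparison[OF always_eventually lim]) (use le in blast)
  then show ?thesis by (rule LIM_zero_cancel)
qed

lemma hm_lim_norm:
  assumes s: "hm_lim E s l"
  shows "(\<lambda>n. hm_norm E (s n)) \<longlonglongrightarrow> hm_norm E l"
proof -
  have le: "\<bar>hm_norm E (s n) - hm_norm E l\<bar> \<le> hm_norm E (s n - l)" for n
    using norm_triangle[of "s n - l" l] norm_triangle[of "l - s n" "s n"] s
    by (auto simp: hm_lim_def norm_minus_commute)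
  have lim: "(\<lambda>n. hm_norm E (s n - l)) \<longlonglongrightarrow> 0" using s by (simp add: hm_lim_def)
  have "(\<lambda>n. hm_norm E (s n) - hm_norm E l) \<longlonglongrightarrow> 0"
    by (rule Lim_null_comparison[OF always_eventually lim]) (use le in simp)
  then show ?thesis by (rule LIM_zero_cancel)
qed

lemma hm_lim_Cauchy:
  assumes s: "\<And>n. s n \<in> hm_carrier E"
    and q: "\<And>m n. hm_norm E (s m - s n) \<le> B * \<bar>q m - q n\<bar>" "Cauchy (q :: nat \<Rightarrow> real)"
  shows "\<exists>l. hm_lim E s l"
proof -
  have "\<exists>l\<in>hm_carrier E. (\<lambda>n. hm_norm E (s n - l)) \<longlonglongrightarrow> 0"
  proof (rule complete[OF s])
    fix e :: real assume e: "e > 0"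
    define d where "d = e / (\<bar>B\<bar> + 1)"
    have d: "d > 0" using e by (simp add: d_def add_nonneg_pos)
    from q(2) d obtain N where N: "\<And>m n. m \<ge> N \<Longrightarrow> n \<ge> N \<Longrightarrow> \<bar>q m - q n\<bar> < d"
      unfolding Cauchy_def dist_real_def by blast
    have "hm_norm E (s m - s n) < e" if "m \<ge> N" "n \<ge> N" for m n
    proof -
      have "hm_norm E (s m - s n) \<le> (\<bar>B\<bar> + 1) * \<bar>q m - q n\<bar>"
        using q(1)[of m n] mult_right_mono[of B "\<bar>B\<bar> + 1" "\<bar>q m - q n\<bar>"] by linarith
      also have "\<dots> < (\<bar>B\<bar> + 1) * d"
        using N[OF that] by (simp add: add_nonneg_pos)
      also have "\<dots> = e"
        by (simp add: d_def add_nonneg_pos)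
      finally show ?thesis .
    qed
    then show "\<exists>N. \<forall>m\<ge>N. \<forall>n\<ge>N. hm_norm E (s m - s n) < e" by blast
  qed
  then show ?thesis using s by (auto simp: hm_lim_def)
qed

lemma closure_limI:
  assumes "hm_lim E s x" "\<And>n. s n \<in> S"
  shows "x \<in> hm_closure E S"
proof -
  have "\<exists>y\<in>S. hm_norm E (x - y) < e" if "e > 0" for e
  proof -
    from assms(1) that obtain n where "hm_norm E (s n - x) < e"
      by (rule hm_lim_approx)
    then show ?thesis
      using assms norm_minus_commute[of x "s n"] by (intro bexI[of _ "s n"]) (auto simp: hm_lim_def)
  qed
  then show ?thesis using assms by (auto simp: hm_closure_def hm_lim_def)
qed

lemma closure_iff_lim:
  assumes "S \<subseteq> hm_carrier E"
  shows "x \<in> hm_closure E S \<longleftrightarrow> (\<exists>s. (\<forall>n. s n \<in> S) \<and> hm_lim E s x)"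
proof
  assume x: "x \<in> hm_closure E S"
  then have "\<forall>n. \<exists>y\<in>S. hm_norm E (x - y) < 1 / real (Suc n)"
    by (simp add: hm_closure_def)
  then obtain s where s: "\<And>n. s n \<in> S" "\<And>n. hm_norm E (x - s n) < 1 / real (Suc n)"
    by metis
  have "hm_lim E s x"
  proof (rule hm_lim_squeeze)
    show "hm_norm E (s n - x) \<le> 1 / real (Suc n)" for n
      using s[of n] x assms by (subst norm_minus_commute) (auto simp: hm_closure_def)
    show "(\<lambda>n. 1 / real (Suc n)) \<longlonglongrightarrow> 0"
      using LIMSEQ_inverse_real_of_nat by (simp add: inverse_eq_divide)
  qed (use s x assms in \<open>auto simp: hm_closure_def\<close>)
  with s show "\<exists>s. (\<forall>n. s n \<in> S) \<and> hm_lim E s x" by blast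
next
  assume "\<exists>s. (\<forall>n. s n \<in> S) \<and> hm_lim E s x"
  then show "x \<in> hm_closure E S" using closure_limI by blast
qed

lemma closure_subset_carrier: "hm_closure E S \<subseteq> hm_carrier E"
  by (auto simp: hm_closure_def)

lemma subset_closure: "S \<subseteq> hm_carrier E \<Longrightarrow> S \<subseteq> hm_closure E S"
  by (force simp: hm_closure_def)

lemma closure_limD: "hm_lim E s x \<Longrightarrow> (\<And>n. s n \<in> hm_closure E S) \<Longrightarrow> S \<subseteq> hm_carrier E \<Longrightarrow>
  x \<in> hm_closure E S"
proof -
  assume s: "hm_lim E s x" "\<And>n. s n \<in> hm_closure E S" and S: "S \<subseteq> hm_carrier E"
  have "\<exists>y\<in>S. hm_norm E (x - y) < e" if "e > 0" for e
  proof -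
    from s(1) half_gt_zero[OF that] obtain n where n: "hm_norm E (s n - x) < e / 2"
      by (rule hm_lim_approx)
    from s(2)[of n] that obtain y where y: "y \<in> S" "hm_norm E (s n - y) < e / 2"
      by (auto simp: hm_closure_def dest: spec[of _ "e / 2"])
    have "hm_norm E (x - y) < e"
      using norm_triangle_diff[of x "s n" y] n y S s norm_minus_commute[of x "s n"]
      by (auto simp: hm_lim_def)
    with y show ?thesis by blast
  qed
  then show ?thesis
    using s by (auto simp: hm_closure_def hm_lim_def)
qed

end


section \<open>Adjoint pairs of operators and square roots\<close>

text \<open>
  Operators between carriers are represented by functions on the ambient types whose values outside
  the carrier are irrelevant. Such a pair is automatically linear over the scalars and over the algebra.
\<close>

definition adj :: "('a::cstar_algebra, 'e::complex_vector) hilbert_mod \<Rightarrow> ('a, 'f::complex_vector) hilbert_mod \<Rightarrow>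
    ('e \<Rightarrow> 'f) \<Rightarrow> ('f \<Rightarrow> 'e) \<Rightarrow> bool" where
  "adj E F f g \<longleftrightarrow> (\<forall>x\<in>hm_carrier E. f x \<in> hm_carrier F) \<and> (\<forall>y\<in>hm_carrier F. g y \<in> hm_carrier E) \<and>
     (\<forall>x\<in>hm_carrier E. \<forall>y\<in>hm_carrier F. hm_ip F (f x) y = hm_ip E x (g y))"

lemma adjD:
  assumes "adj E F f g"
  shows "x \<in> hm_carrier E \<Longrightarrow> f x \<in> hm_carrier F"
    and "y \<in> hm_carrier F \<Longrightarrow> g y \<in> hm_carrier E"
    and "x \<in> hm_carrier E \<Longrightarrow> y \<in> hm_carrier F \<Longrightarrow> hm_ip F (f x) y = hm_ip E x (g y)"
  using assms by (auto simp: adj_def)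

lemma adj_comp: "adj E F f g \<Longrightarrow> adj F G f' g' \<Longrightarrow> adj E G (\<lambda>x. f' (f x)) (\<lambda>x. g (g' x))"
  by (auto simp: adj_def)

locale two_modules = E: cs_module E + F: cs_module F
  for E :: "('a::cstar_algebra, 'e::complex_vector) hilbert_mod"
    and F :: "('a, 'f::complex_vector) hilbert_mod"
begin

lemma adj_sym: "adj E F f g \<Longrightarrow> adj F E g f"
  unfolding adj_def using E.ip_cstar F.ip_cstar by metis

lemma adj_linear:
  assumes f: "adj E F f g" and x: "x \<in> hm_carrier E"
  shows "y \<in> hm_carrier E \<Longrightarrow> f (x + y) = f x + f y"
    and "y \<in> hm_carrier E \<Longrightarrow> f (x - y) = f x - f y"
    and "f (c *\<^sub>C x) = c *\<^sub>C f x"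
    and "f (- x) = - f x"
    and "f (hm_act E x a) = hm_act F (f x) a"
    and "f 0 = 0"
proof -
  note [simp] = adjD[OF f] adjD[OF adj_sym[OF f]]
  note s = E.ip_simps F.ip_simps E.ip_act_right F.ip_act_right
  show "y \<in> hm_carrier E \<Longrightarrow> f (x + y) = f x + f y"
    using x by (intro F.ip_eqI) (simp_all add: s flip: adjD(3)[OF adj_sym[OF f]])
  show "y \<in> hm_carrier E \<Longrightarrow> f (x - y) = f x - f y"
    using x by (intro F.ip_eqI) (simp_all add: s flip: adjD(3)[OF adj_sym[OF f]])
  show "f (c *\<^sub>C x) = c *\<^sub>C f x"
    using x by (intro F.ip_eqI) (simp_all add: s flip: adjD(3)[OF adj_sym[OF f]])
  show "f (- x) = - f x"
    using x by (intro F.ip_eqI) (simp_all add: s flip: adjD(3)[OF adj_sym[OF f]])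
  show "f (hm_act E x a) = hm_act F (f x) a"
    using x by (intro F.ip_eqI) (simp_all add: s flip: adjD(3)[OF adj_sym[OF f]])
  show "f 0 = 0"
    by (intro F.ip_eqI) (simp_all add: s flip: adjD(3)[OF adj_sym[OF f]])
qed

text \<open>The limit is determined by its inner products, and these pass over to the adjoint.\<close>

lemma adj_lim_eq:
  assumes f: "adj E F f g" and s: "hm_lim E s l" and r: "hm_lim F (\<lambda>n. f (s n)) m"
  shows "f l = m"
proof (rule F.ip_eqI)
  show "f l \<in> hm_carrier F" "m \<in> hm_carrier F"
    using s r adjD(1)[OF f] by (auto simp: hm_lim_def)
  fix z assume z: "z \<in> hm_carrier F"
  have "(\<lambda>n. hm_ip F (f (s n)) z) \<longlonglongrightarrow> hm_ip E l (g z)"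
    using E.hm_lim_ip_left[OF s, of "g z"] adjD[OF f] z E.hm_limD[OF s] by simp
  then have "hm_ip F m z = hm_ip F (f l) z"
    using LIMSEQ_unique[OF F.hm_lim_ip_left[OF r z]] adjD(3)[OF f, of l z] z E.hm_limD[OF s] by metis
  then show "hm_ip F z (f l) = hm_ip F z m"
    using F.ip_cstar z \<open>f l \<in> _\<close> \<open>m \<in> _\<close> by metis
qed

end

text \<open>The scalar version of the iteration below; it bounds the steps of the operator version.\<close>

fun sqrt_bound :: "nat \<Rightarrow> real" where
  "sqrt_bound 0 = 0"
| "sqrt_bound (Suc n) = (1 + (sqrt_bound n)\<^sup>2) / 2"

lemma sqrt_bound_bounds: "0 \<le> sqrt_bound n \<and> sqrt_bound n \<le> 1"
proof (induction n)
  case (Suc n)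
  then have "(sqrt_bound n)\<^sup>2 \<le> 1" by (simp add: power_le_one)
  then show ?case by simp
qed simp

lemma sqrt_bound_Suc_ge: "sqrt_bound n \<le> sqrt_bound (Suc n)"
proof -
  have "0 \<le> (1 - sqrt_bound n)\<^sup>2" by simp
  then show ?thesis by (simp add: power2_eq_square algebra_simps)
qed

lemma sqrt_bound_Cauchy: "Cauchy sqrt_bound"
proof -
  have "incseq sqrt_bound" using sqrt_bound_Suc_ge by (rule incseq_SucI)
  moreover have "Bseq sqrt_bound"
    using sqrt_bound_bounds by (intro BseqI'[of _ 1]) simp
  ultimately show ?thesis
    by (intro convergent_Cauchy Bseq_monoseq_convergent) (auto simp: monoseq_iff)
qed

text \<open>
  Starting from \<open>0\<close> makes every iterate a polynomial in \<open>y\<close> without constant term, so that iterates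
  commute and inherit self-adjointness and invariant subspaces from \<open>y\<close>.
\<close>

fun sqrt_iter :: "('e::complex_vector \<Rightarrow> 'e) \<Rightarrow> nat \<Rightarrow> 'e \<Rightarrow> 'e" where
  "sqrt_iter y 0 x = 0"
| "sqrt_iter y (Suc n) x = (1/2) *\<^sub>C (y x + sqrt_iter y n (sqrt_iter y n x))"

text \<open>
  The positive square root of \<open>1 - y\<close> for a self-adjoint contraction \<open>y\<close>, as \<open>1 - z\<close> where \<open>z\<close>
  solves \<open>z = (y + z\<^sup>2) / 2\<close>.
\<close>

definition sqrt_one_minus :: "('a::cstar_algebra, 'e::complex_vector) hilbert_mod \<Rightarrow> ('e \<Rightarrow> 'e) \<Rightarrow> 'e \<Rightarrow> 'e" where
  "sqrt_one_minus E y x = x - (THE l. hm_lim E (\<lambda>n. sqrt_iter y n x) l)"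

text \<open>
  Closed subspaces of the direct sum of the module with itself. Invariance of such a subspace
  under an operator, acting on both entries, covers invariance of closed subspaces as well as
  commutation with closed operators.
\<close>

definition closed_relation :: "('a::cstar_algebra, 'e::complex_vector) hilbert_mod \<Rightarrow> ('e \<times> 'e) set \<Rightarrow> bool" where
  "closed_relation E G \<longleftrightarrow> G \<subseteq> hm_carrier E \<times> hm_carrier E \<and> (0, 0) \<in> G \<and>
     (\<forall>x u y v. (x, u) \<in> G \<longrightarrow> (y, v) \<in> G \<longrightarrow> (x + y, u + v) \<in> G) \<and>
     (\<forall>c x u. (x, u) \<in> G \<longrightarrow> (c *\<^sub>C x, c *\<^sub>C u) \<in> G) \<and>
     (\<forall>s l r m. (\<forall>n. (s n, r n) \<in> G) \<longrightarrow> hm_lim E s l \<longrightarrow> hm_lim E r m \<longrightarrow> (l, m) \<in> G)"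

lemma closed_relationD:
  assumes "closed_relation E G"
  shows "(x, u) \<in> G \<Longrightarrow> x \<in> hm_carrier E" "(x, u) \<in> G \<Longrightarrow> u \<in> hm_carrier E" "(0, 0) \<in> G"
    "(x, u) \<in> G \<Longrightarrow> (y, v) \<in> G \<Longrightarrow> (x + y, u + v) \<in> G"
    "(x, u) \<in> G \<Longrightarrow> (c *\<^sub>C x, c *\<^sub>C u) \<in> G"
    "(\<And>n. (s n, r n) \<in> G) \<Longrightarrow> hm_lim E s l \<Longrightarrow> hm_lim E r m \<Longrightarrow> (l, m) \<in> G"
  using assms unfolding closed_relation_def by blast+

lemma closed_relation_diff:
  assumes "closed_relation E G" "(x, u) \<in> G" "(y, v) \<in> G"
  shows "(x - y, u - v) \<in> G"
  using closed_relationD(4)[OF assms(1,2) closed_relationD(5)[OF assms(1,3), of "-1"]] by simp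

locale contraction = cs_module E for E :: "('a::cstar_algebra, 'e::complex_vector) hilbert_mod" +
  fixes y :: "'e \<Rightarrow> 'e"
  assumes y_adj: "adj E E y y"
    and y_contr: "x \<in> hm_carrier E \<Longrightarrow> hm_norm E (y x) \<le> hm_norm E x"
begin

sublocale two_modules E E ..

abbreviation "Z \<equiv> sqrt_iter y"

lemma y_closed [simp]: "x \<in> hm_carrier E \<Longrightarrow> y x \<in> hm_carrier E"
  by (rule adjD(1)[OF y_adj])

lemma Z_closed [simp]: "x \<in> hm_carrier E \<Longrightarrow> Z n x \<in> hm_carrier E"
  by (induction n arbitrary: x) simp_all

lemma Z_adj: "adj E E (Z n) (Z n)"
proof (induction n)
  case (Suc n)
  then show ?case
    unfolding adj_def using adjD[OF Suc] adjD[OF y_adj] by (simp add: ip_simps)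
qed (simp add: adj_def)

lemmas Z_lin = adj_linear[OF Z_adj]

lemma Z_rel:
  assumes G: "closed_relation E G" and y: "\<And>x u. (x, u) \<in> G \<Longrightarrow> (y x, y u) \<in> G" and x: "(x, u) \<in> G"
  shows "(Z n x, Z n u) \<in> G"
  using x
proof (induction n arbitrary: x u)
  case (Suc n)
  then show ?case
    using closed_relationD[OF G] y by simp
qed (use closed_relationD[OF G] in simp)

lemma adj_closed_relation:
  assumes c: "adj E E c c'"
  shows "closed_relation E {(x, c x) | x. x \<in> hm_carrier E}"
proof -
  note [simp] = adjD[OF c] adj_linear[OF c] adj_linear(6)[OF c zero_closed]
  show ?thesis
    unfolding closed_relation_def
  proof (intro conjI allI impI)
    fix s l r m
    assume n: "\<forall>n. (s n, r n) \<in> {(x, c x) | x. x \<in> hm_carrier E}"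
      and s: "hm_lim E s l" and r: "hm_lim E r m"
    then have "r = (\<lambda>n. c (s n))" by auto
    with r have "c l = m" by (intro adj_lim_eq[OF c s]) simp
    with s show "(l, m) \<in> {(x, c x) | x. x \<in> hm_carrier E}" by (auto simp: hm_lim_def)
  qed (auto intro!: exI[of _ 0])
qed

lemma Z_commute:
  assumes c: "adj E E c c'" and cy: "\<And>x. x \<in> hm_carrier E \<Longrightarrow> c (y x) = y (c x)"
    and x: "x \<in> hm_carrier E"
  shows "c (Z n x) = Z n (c x)"
  using Z_rel[OF adj_closed_relation[OF c], of x "c x" n] x cy by auto

lemma Z_Z: "x \<in> hm_carrier E \<Longrightarrow> Z m (Z n x) = Z n (Z m x)"
  by (intro Z_commute[OF Z_adj] Z_commute[OF y_adj, symmetric]) simp_all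

lemma Z_bound: "x \<in> hm_carrier E \<Longrightarrow> hm_norm E (Z n x) \<le> sqrt_bound n * hm_norm E x"
proof (induction n arbitrary: x)
  case (Suc n)
  have "hm_norm E (Z n (Z n x)) \<le> sqrt_bound n * (sqrt_bound n * hm_norm E x)"
    using Suc.IH[of "Z n x"] mult_left_mono[OF Suc.IH[of x], of "sqrt_bound n"]
      sqrt_bound_bounds[of n] Suc.prems by simp
  moreover have "hm_norm E (Z (Suc n) x) \<le> (hm_norm E (y x) + hm_norm E (Z n (Z n x))) / 2"
    using norm_triangle[of "y x" "Z n (Z n x)"] Suc.prems by (simp add: norm_scaleC)
  ultimately show ?case
    using y_contr[OF Suc.prems] by (simp add: power2_eq_square algebra_simps)
qed simp

lemma Z_contr: "x \<in> hm_carrier E \<Longrightarrow> hm_norm E (Z n x) \<le> hm_norm E x"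
  using Z_bound[of x n] sqrt_bound_bounds[of n] mult_right_mono[of "sqrt_bound n" 1 "hm_norm E x"]
  by simp

text \<open>
  The iterates commute, so the difference of two squares factors as the sum times the difference, and
  the scalar iteration satisfies the same identity with equality.
\<close>

lemma Z_step:
  "x \<in> hm_carrier E \<Longrightarrow>
    hm_norm E (Z (Suc n) x - Z n x) \<le> (sqrt_bound (Suc n) - sqrt_bound n) * hm_norm E x"
proof (induction n arbitrary: x)
  case 0
  then show ?case using y_contr[of x] by (simp add: norm_scaleC)
next
  case (Suc n)
  define d where "d = Z (Suc n) x - Z n x"
  have d: "d \<in> hm_carrier E" using Suc.prems by (simp add: d_def del: sqrt_iter.simps)
  have "Z (Suc (Suc n)) x - Z (Suc n) x =
      (1/2) *\<^sub>C (Z (Suc n) (Z (Suc n) x) - Z n (Z n x))"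
    by (subst (1 2) sqrt_iter.simps) (simp del: sqrt_iter.simps flip: cv.scale_right_diff_distrib)
  also have "\<dots> = (1/2) *\<^sub>C (Z (Suc n) d + Z n d)"
    using Suc.prems Z_Z[of x "Suc n" n] by (simp add: d_def Z_lin del: sqrt_iter.simps)
  finally have "hm_norm E (Z (Suc (Suc n)) x - Z (Suc n) x) \<le>
      (hm_norm E (Z (Suc n) d) + hm_norm E (Z n d)) / 2"
    using norm_triangle[of "Z (Suc n) d" "Z n d"] d by (simp add: norm_scaleC del: sqrt_iter.simps)
  also have "\<dots> \<le> (sqrt_bound (Suc n) + sqrt_bound n) / 2 * hm_norm E d"
    using Z_bound[OF d, of "Suc n"] Z_bound[OF d, of n]
    by (simp add: algebra_simps add_divide_distrib del: sqrt_iter.simps sqrt_bound.simps)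
  also have "\<dots> \<le> (sqrt_bound (Suc n) + sqrt_bound n) / 2 *
      ((sqrt_bound (Suc n) - sqrt_bound n) * hm_norm E x)"
    using Suc sqrt_bound_bounds[of n] sqrt_bound_bounds[of "Suc n"] unfolding d_def
    by (intro mult_left_mono) (auto simp del: sqrt_iter.simps sqrt_bound.simps)
  also have "\<dots> = (sqrt_bound (Suc (Suc n)) - sqrt_bound (Suc n)) * hm_norm E x"
  proof -
    have e: "sqrt_bound (Suc (Suc n)) - sqrt_bound (Suc n) =
        (sqrt_bound (Suc n) + sqrt_bound n) / 2 * (sqrt_bound (Suc n) - sqrt_bound n)"
      by (subst sqrt_bound.simps(2)[of "Suc n"], subst (2) sqrt_bound.simps(2)[of n])
        (simp add: power2_eq_square field_simps del: sqrt_bound.simps)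
    show ?thesis by (simp only: e mult.assoc)
  qed
  finally show ?case .
qed

lemma Z_diff:
  assumes x: "x \<in> hm_carrier E"
  shows "hm_norm E (Z m x - Z n x) \<le> hm_norm E x * \<bar>sqrt_bound m - sqrt_bound n\<bar>"
proof -
  have le: "hm_norm E (Z (n + k) x - Z n x) \<le> (sqrt_bound (n + k) - sqrt_bound n) * hm_norm E x" for n k
  proof (induction k)
    case (Suc k)
    have "hm_norm E (Z (n + Suc k) x - Z n x) \<le>
        hm_norm E (Z (Suc (n + k)) x - Z (n + k) x) + hm_norm E (Z (n + k) x - Z n x)"
      using x norm_triangle_diff[of "Z (Suc (n + k)) x" "Z (n + k) x" "Z n x"]
      by (simp del: sqrt_iter.simps)
    also have "\<dots> \<le> (sqrt_bound (n + Suc k) - sqrt_bound n) * hm_norm E x"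
      using Suc Z_step[OF x, of "n + k"] by (simp add: algebra_simps del: sqrt_iter.simps sqrt_bound.simps)
    finally show ?case .
  qed simp
  have sym: "hm_norm E (Z m x - Z n x) = hm_norm E (Z n x - Z m x)"
    using x by (intro norm_minus_commute) simp_all
  have mono: "sqrt_bound i \<le> sqrt_bound (i + k)" for i k
    using lift_Suc_mono_le[of sqrt_bound i "i + k"] sqrt_bound_Suc_ge by simp
  show ?thesis
  proof (cases "n \<le> m")
    case True
    then show ?thesis using le[of n "m - n"] mono[of n "m - n"] by (simp add: mult.commute)
  next
    case False
    then show ?thesis using le[of m "n - m"] mono[of m "n - m"] sym by (simp add: mult.commute)
  qed
qed

abbreviation "h \<equiv> sqrt_one_minus E y"

lemma Z_lim: 
  assumes x: "x \<in> hm_carrier E"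
  shows "hm_lim E (\<lambda>n. Z n x) (x - h x)"
proof -
  obtain l where l: "hm_lim E (\<lambda>n. Z n x) l"
    using hm_lim_Cauchy[OF _ Z_diff[OF x] sqrt_bound_Cauchy] x by auto
  then have "(THE l. hm_lim E (\<lambda>n. Z n x) l) = l"
    using hm_lim_unique by blast
  with l show ?thesis by (simp add: sqrt_one_minus_def)
qed

lemma h_lim: 
  assumes x: "x \<in> hm_carrier E"
  shows "hm_lim E (\<lambda>n. x - Z n x) (h x)"
  using hm_lim_diff[OF hm_lim_const[OF x] Z_lim[OF x]] by simp

lemma h_closed [simp]: "x \<in> hm_carrier E \<Longrightarrow> h x \<in> hm_carrier E"
  using h_lim hm_limD by blast

lemma sqrt_adj: "adj E E h h"
proof -
  have "hm_ip E (h x) u = hm_ip E x (h u)" if x: "x \<in> hm_carrier E" and u: "u \<in> hm_carrier E" for x u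
  proof -
    have "hm_ip E (x - Z n x) u = hm_ip E x (u - Z n u)" for n
      using x u adjD[OF Z_adj] by (simp add: ip_simps)
    then show ?thesis
      using LIMSEQ_unique[OF hm_lim_ip_left[OF h_lim[OF x] u]] hm_lim_ip_right[OF h_lim[OF u] x]
      by simp
  qed
  then show ?thesis by (simp add: adj_def)
qed

text \<open>
  Whatever can be tested on a closed relation is inherited by the square root: the relation may be
  the graph of an operator commuting with \<open>y\<close>, or the diagonal of an invariant subspace.
\<close>

lemma sqrt_rel:
  assumes G: "closed_relation E G" and y: "\<And>x u. (x, u) \<in> G \<Longrightarrow> (y x, y u) \<in> G" and x: "(x, u) \<in> G"
  shows "(h x, h u) \<in> G"
proof (rule closed_relationD(6)[OF G])
  show "(x - Z n x, u - Z n u) \<in> G" for n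
    using closed_relation_diff[OF G x Z_rel[OF G y x]] .
  show "hm_lim E (\<lambda>n. x - Z n x) (h x)" "hm_lim E (\<lambda>n. u - Z n u) (h u)"
    using closed_relationD(1,2)[OF G x] by (simp_all add: h_lim)
qed

lemma sqrt_commute:
  assumes c: "adj E E c c'" and cy: "\<And>x. x \<in> hm_carrier E \<Longrightarrow> c (y x) = y (c x)"
    and x: "x \<in> hm_carrier E"
  shows "c (h x) = h (c x)"
  using sqrt_rel[OF adj_closed_relation[OF c], of x "c x"] x cy by auto

lemma one_minus_sqrt_contr:
  assumes x: "x \<in> hm_carrier E"
  shows "hm_norm E (x - h x) \<le> hm_norm E x"
  using hm_lim_norm[OF Z_lim[OF x]] by (rule LIMSEQ_le_const2) (use x Z_contr in blast)

lemma sqrt_sqrt: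
  assumes x: "x \<in> hm_carrier E"
  shows "h (h x) = x - y x"
proof -
  define z where "z x = x - h x" for x
  have zc: "u \<in> hm_carrier E \<Longrightarrow> z u \<in> hm_carrier E" for u by (simp add: z_def)
  have zl: "u \<in> hm_carrier E \<Longrightarrow> hm_lim E (\<lambda>n. Z n u) (z u)" for u using Z_lim by (simp add: z_def)
  have "hm_lim E (\<lambda>n. Z n (Z n x)) (z (z x))"
  proof (rule hm_lim_squeeze)
    show "hm_norm E (Z n (Z n x) - z (z x)) \<le>
        hm_norm E (Z n x - z x) + hm_norm E (Z n (z x) - z (z x))" for n
      using norm_triangle_diff[of "Z n (Z n x)" "Z n (z x)" "z (z x)"] x zc
        Z_contr[of "Z n x - z x" n] by (simp add: Z_lin)
    show "(\<lambda>n. hm_norm E (Z n x - z x) + hm_norm E (Z n (z x) - z (z x))) \<longlonglongrightarrow> 0"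
      using zl[OF x] zl[OF zc[OF x]] tendsto_add[of _ 0 _ _ 0] by (auto simp: hm_lim_def)
  qed (use x zc in auto)
  then have "hm_lim E (\<lambda>n. Z (Suc n) x) ((1/2) *\<^sub>C (y x + z (z x)))"
    using x by (auto intro!: hm_lim_scaleC hm_lim_add hm_lim_const)
  moreover have "hm_lim E (\<lambda>n. Z (Suc n) x) (z x)"
    using zl[OF x] unfolding hm_lim_def by (auto simp del: sqrt_iter.simps intro: LIMSEQ_Suc[where f = "\<lambda>n. hm_norm E (Z n x - z x)"])
  ultimately have "z x = (1/2) *\<^sub>C (y x + z (z x))"
    by (rule hm_lim_unique[symmetric])
  from arg_cong[OF this, of "scaleC 2"] have "2 *\<^sub>C z x = y x + z (z x)" by simp
  moreover have "2 *\<^sub>C z x = z x + z x"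
    using scaleC_add_left[of 1 1 "z x"] by simp
  ultimately have "z x + z x = y x + z (z x)" by simp
  then show ?thesis
    using adj_linear(2)[OF sqrt_adj, of x "h x"] x by (simp add: z_def algebra_simps)
qed

end


section \<open>Positive multipliers of a C*-algebra\<close>

definition self_module :: "('a::cstar_algebra, 'a) hilbert_mod" where
  "self_module = \<lparr>hm_carrier = UNIV, hm_act = (*), hm_ip = (\<lambda>x y. cstar x * y)\<rparr>"

lemma self_module_simps [simp]:
  "hm_carrier self_module = UNIV" "hm_act self_module = (*)"
  "hm_ip self_module x y = cstar x * y" "hm_norm self_module x = norm x"
  by (simp_all add: self_module_def hm_norm_def norm_cstar_mult)

lemma cs_module_self: "cs_module (self_module :: ('a::cstar_algebra, 'a) hilbert_mod)"
proof
  fix s :: "nat \<Rightarrow> 'a"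
  assume "\<And>e. e > 0 \<Longrightarrow> \<exists>N. \<forall>m\<ge>N. \<forall>n\<ge>N. hm_norm self_module (s m - s n) < e"
  then have "Cauchy s" by (simp add: Cauchy_def dist_norm)
  then obtain l where "s \<longlonglongrightarrow> l" using Cauchy_convergent convergent_def by blast
  then have "(\<lambda>n. norm (s n - l)) \<longlonglongrightarrow> 0"
    using LIM_zero tendsto_norm_zero by blast
  then show "\<exists>l\<in>hm_carrier self_module. (\<lambda>n. hm_norm self_module (s n - l)) \<longlonglongrightarrow> 0"
    by (intro bexI[of _ l]) simp_all
next
  fix x y :: 'a
  show "norm (hm_ip self_module x y) \<le> hm_norm self_module x * hm_norm self_module y"
    using norm_mult_ineq[of "cstar x" y] by simp
next
  fix x :: 'a
  assume "hm_ip self_module x x = 0"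
  then show "x = 0" using norm_cstar_mult[of x] by simp
qed (simp_all add: distrib_left scaleC_mult_right cstar_mult cstar_cstar mult.assoc)

text \<open>
  Bounded adjointable operators of the algebra, as a module over itself. They form a unital
  C*-algebra that contains the left multiplications, and so replace a unitization.
\<close>

definition multiplier :: "('a::cstar_algebra \<Rightarrow> 'a) \<Rightarrow> ('a \<Rightarrow> 'a) \<Rightarrow> bool" where
  "multiplier f g \<longleftrightarrow> (\<forall>x y. cstar (f x) * y = cstar x * g y) \<and> (\<exists>B\<ge>0. \<forall>x. norm (f x) \<le> B * norm x)"

text \<open>
  For a self-adjoint element the condition places the spectrum in the interval from \<open>0\<close> to \<open>2 r\<close>, without
  speaking of the spectrum. It makes closure under sums immediate, while the existence of square roots
  follows from the iteration above, applied to the contraction \<open>1 - p / r\<close>.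
\<close>

definition pos :: "('a::cstar_algebra \<Rightarrow> 'a) \<Rightarrow> bool" where
  "pos p \<longleftrightarrow> multiplier p p \<and> (\<exists>r\<ge>0. \<forall>x. norm (r *\<^sub>R x - p x) \<le> r * norm x)"

lemma multiplier_adj: "multiplier f g \<Longrightarrow> adj self_module self_module f g"
  by (simp add: multiplier_def adj_def)

lemma multiplierD:
  "multiplier f g \<Longrightarrow> cstar (f x) * y = cstar x * g y"
  by (simp add: multiplier_def)

lemma multiplier_lin:
  assumes "multiplier f g"
  shows "f (x + y) = f x + f y" "f (x - y) = f x - f y" "f (c *\<^sub>C x) = c *\<^sub>C f x"
    "f (r *\<^sub>R x) = r *\<^sub>R f x" "f (- x) = - f x" "f 0 = 0"
proof -
  interpret self: cs_module "self_module :: ('a, 'a) hilbert_mod" by (rule cs_module_self)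
  interpret two_modules "self_module :: ('a, 'a) hilbert_mod" "self_module :: ('a, 'a) hilbert_mod" ..
  note l = adj_linear[OF multiplier_adj[OF assms]]
  show "f (x + y) = f x + f y" "f (x - y) = f x - f y" "f (c *\<^sub>C x) = c *\<^sub>C f x" "f (- x) = - f x" "f 0 = 0"
    using l by simp_all
  show "f (r *\<^sub>R x) = r *\<^sub>R f x"
    using l(3)[of x "complex_of_real r"] by (simp add: scaleC_of_real)
qed

lemma multiplier_sym:
  assumes "multiplier f g"
  shows "multiplier g f"
proof -
  from assms obtain B where B: "B \<ge> 0" "\<And>x. norm (f x) \<le> B * norm x"
    by (auto simp: multiplier_def)
  have eq: "cstar (g x) * y = cstar x * f y" for x y
    using arg_cong[OF multiplierD[OF assms, of y x], of cstar] by (simp add: cstar_mult cstar_cstar)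
  have "norm (g x) \<le> B * norm x" for x
  proof (cases "g x = 0")
    case False
    have "norm (g x) * norm (g x) = norm (cstar x * f (g x))"
      using norm_cstar_mult[of "g x"] eq[of x "g x"] by (simp add: power2_eq_square)
    also have "\<dots> \<le> norm x * (B * norm (g x))"
      using norm_mult_ineq[of "cstar x" "f (g x)"] mult_left_mono[OF B(2)[of "g x"], of "norm x"] by simp
    finally have "norm (g x) * norm (g x) \<le> (B * norm x) * norm (g x)" by (simp add: mult_ac)
    with False show ?thesis by (simp add: mult_le_cancel_right)
  qed (use B in simp)
  with eq B(1) show ?thesis by (auto simp: multiplier_def)
qed

lemma multiplier_add:
  assumes f: "multiplier f g" and f': "multiplier f' g'"
  shows "multiplier (\<lambda>x. f x + f' x) (\<lambda>x. g x + g' x)"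
proof -
  from f f' obtain B B' where B: "B \<ge> 0" "\<And>x. norm (f x) \<le> B * norm x"
    "B' \<ge> 0" "\<And>x. norm (f' x) \<le> B' * norm x" by (auto simp: multiplier_def)
  have "norm (f x + f' x) \<le> (B + B') * norm x" for x
    using norm_triangle_ineq[of "f x" "f' x"] B(2)[of x] B(4)[of x] by (simp add: algebra_simps)
  with B(1,3) show ?thesis
    using f f' unfolding multiplier_def
    by (auto simp: cstar_add algebra_simps intro!: exI[of _ "B + B'"])
qed

lemma multiplier_scaleC:
  assumes f: "multiplier f g"
  shows "multiplier (\<lambda>x. c *\<^sub>C f x) (\<lambda>x. cnj c *\<^sub>C g x)"
proof -
  from f obtain B where B: "B \<ge> 0" "\<And>x. norm (f x) \<le> B * norm x" by (auto simp: multiplier_def)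
  have "norm (c *\<^sub>C f x) \<le> (cmod c * B) * norm x" for x
    using mult_left_mono[OF B(2)[of x], of "cmod c"] by (simp add: norm_scaleC mult.assoc)
  with B(1) show ?thesis
    using f unfolding multiplier_def
    by (auto simp: cstar_scaleC scaleC_mult_left scaleC_mult_right intro!: exI[of _ "cmod c * B"])
qed

lemma multiplier_scaleR:
  "multiplier f g \<Longrightarrow> multiplier (\<lambda>x. r *\<^sub>R f x) (\<lambda>x. r *\<^sub>R g x)"
  using multiplier_scaleC[of f g "complex_of_real r"] by (simp add: scaleC_of_real)

lemma multiplier_diff:
  "multiplier f g \<Longrightarrow> multiplier f' g' \<Longrightarrow> multiplier (\<lambda>x. f x - f' x) (\<lambda>x. g x - g' x)"
  using multiplier_add[of f g "\<lambda>x. - f' x" "\<lambda>x. - g' x"] multiplier_scaleR[of f' g' "-1"] by simp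

lemma multiplier_id: "multiplier (\<lambda>x. x) (\<lambda>x. x)"
  by (auto simp: multiplier_def intro!: exI[of _ 1])

lemma multiplier_comp:
  assumes f: "multiplier f g" and f': "multiplier f' g'"
  shows "multiplier (\<lambda>x. f' (f x)) (\<lambda>x. g (g' x))"
proof -
  from f f' obtain B B' where B: "B \<ge> 0" "\<And>x. norm (f x) \<le> B * norm x"
    "B' \<ge> 0" "\<And>x. norm (f' x) \<le> B' * norm x" by (auto simp: multiplier_def)
  have "norm (f' (f x)) \<le> (B' * B) * norm x" for x
    using B(4)[of "f x"] mult_left_mono[OF B(2)[of x] B(3)] by (simp add: mult_ac)
  with B(1,3) show ?thesis
    using f f' unfolding multiplier_def by (auto intro!: exI[of _ "B' * B"])
qed

lemma multiplier_left_mult: "multiplier (\<lambda>x. a * x) (\<lambda>x. cstar a * x)"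
  using norm_mult_ineq
  by (auto simp: multiplier_def cstar_mult cstar_cstar mult.assoc intro!: exI[of _ "norm a"])

lemma multiplier_eq_0:
  assumes "multiplier f f" "f (f x) = 0"
  shows "f x = 0"
  using norm_cstar_mult[of "f x"] multiplierD[OF assms(1), of x "f x"] assms(2) by simp

lemma pos_multiplier: "pos p \<Longrightarrow> multiplier p p"
  by (simp add: pos_def)

lemma pos_add:
  assumes p: "pos p" and q: "pos q"
  shows "pos (\<lambda>x. p x + q x)"
proof -
  from p q obtain r s where r: "r \<ge> 0" "\<And>x. norm (r *\<^sub>R x - p x) \<le> r * norm x"
    "s \<ge> 0" "\<And>x. norm (s *\<^sub>R x - q x) \<le> s * norm x" by (auto simp: pos_def)
  have "norm ((r + s) *\<^sub>R x - (p x + q x)) \<le> (r + s) * norm x" for x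
    using norm_triangle_ineq[of "r *\<^sub>R x - p x" "s *\<^sub>R x - q x"] r(2)[of x] r(4)[of x]
    by (simp add: algebra_simps)
  with r(1,3) show ?thesis
    unfolding pos_def using p q
    by (auto simp: pos_multiplier intro!: multiplier_add exI[of _ "r + s"])
qed

lemma pos_scaleR:
  assumes p: "pos p" and c: "c \<ge> 0"
  shows "pos (\<lambda>x. c *\<^sub>R p x)"
proof -
  from p obtain r where r: "r \<ge> 0" "\<And>x. norm (r *\<^sub>R x - p x) \<le> r * norm x" by (auto simp: pos_def)
  have "norm ((c * r) *\<^sub>R x - c *\<^sub>R p x) \<le> (c * r) * norm x" for x
    using mult_left_mono[OF r(2)[of x] c] c
    by (simp add: mult_ac flip: scaleR_scaleR scaleR_diff_right)
  with r(1) c show ?thesis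
    unfolding pos_def using p
    by (auto simp: pos_multiplier intro!: multiplier_scaleR exI[of _ "c * r"])
qed

lemma pos_one_minus:
  assumes "multiplier p p" "\<And>x. norm (p x) \<le> r * norm x" "r \<ge> 0"
  shows "pos (\<lambda>x. r *\<^sub>R x - p x)"
  using assms multiplier_diff[OF multiplier_scaleR[OF multiplier_id]]
  by (auto simp: pos_def intro!: exI[of _ r])

lemma contraction_sqrt:
  fixes y :: "'a::cstar_algebra \<Rightarrow> 'a"
  assumes y: "multiplier y y" and le: "\<And>x. norm (y x) \<le> norm x"
  obtains h where "multiplier h h" "\<And>x. h (h x) = x - y x" "\<And>x. norm (x - h x) \<le> norm x"
    "\<And>c c' x. multiplier c c' \<Longrightarrow> (\<And>x. c (y x) = y (c x)) \<Longrightarrow> c (h x) = h (c x)"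
proof -
  interpret self: cs_module "self_module :: ('a, 'a) hilbert_mod" by (rule cs_module_self)
  interpret y: contraction "self_module :: ('a, 'a) hilbert_mod" y
    using multiplier_adj[OF y] le by unfold_locales auto
  define h where "h = sqrt_one_minus self_module y"
  have le': "norm (x - h x) \<le> norm x" for x
    using y.one_minus_sqrt_contr[of x] by (simp add: h_def)
  have "norm (h x) \<le> 2 * norm x" for x
    using le'[of x] norm_triangle_ineq2[of "h x" x] by (simp add: norm_minus_commute)
  then have "multiplier h h"
    using y.sqrt_adj unfolding multiplier_def adj_def h_def[symmetric]
    by (auto intro!: exI[of _ 2])
  moreover have "h (h x) = x - y x" for x
    using y.sqrt_sqrt[of x] by (simp add: h_def)
  moreover have "c (h x) = h (c x)" if "multiplier c c'" "\<And>x. c (y x) = y (c x)" for c c' x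
    using y.sqrt_commute[OF multiplier_adj[OF that(1)], of x] that(2) by (simp add: h_def)
  ultimately show ?thesis using le' that by blast
qed

text \<open>
  The condition on commuting operators in the conclusion records that the root is a limit of
  polynomials in \<open>p\<close>.
\<close>

lemma pos_sqrt:
  assumes p: "pos p"
  obtains h where "pos h" "\<And>x. h (h x) = p x"
    "\<And>c c' x. multiplier c c' \<Longrightarrow> (\<And>x. c (p x) = p (c x)) \<Longrightarrow> c (h x) = h (c x)"
proof -
  from p obtain r0 where r0: "r0 \<ge> 0" "\<And>x. norm (r0 *\<^sub>R x - p x) \<le> r0 * norm x" by (auto simp: pos_def)
  define r where "r = r0 + 1"
  have r: "r > 0" using r0 by (simp add: r_def)
  have rle: "norm (r *\<^sub>R x - p x) \<le> r * norm x" for x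
    using r0(2)[of x] norm_triangle_ineq[of "r0 *\<^sub>R x - p x" x] by (simp add: r_def algebra_simps)
  define y where "y x = x - (1/r) *\<^sub>R p x" for x
  have y: "multiplier y y"
    unfolding y_def using p by (intro multiplier_diff multiplier_id multiplier_scaleR pos_multiplier)
  have y_eq: "y x = (1/r) *\<^sub>R (r *\<^sub>R x - p x)" for x
    using r by (simp add: y_def scaleR_diff_right)
  have "norm (y x) = norm (r *\<^sub>R x - p x) / r" for x
    unfolding y_eq norm_scaleR using r by simp
  then have le: "norm (y x) \<le> norm x" for x
    using rle[of x] r by (simp add: divide_le_eq mult.commute)
  obtain h where h: "multiplier h h" "\<And>x. h (h x) = x - y x" "\<And>x. norm (x - h x) \<le> norm x"
    "\<And>c c' x. multiplier c c' \<Longrightarrow> (\<And>x. c (y x) = y (c x)) \<Longrightarrow> c (h x) = h (c x)"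
    using contraction_sqrt[OF y le] by blast
  show ?thesis
  proof (rule that[of "\<lambda>x. sqrt r *\<^sub>R h x"])
    have "pos h" using h(1,3) by (auto simp: pos_def intro!: exI[of _ 1])
    then show "pos (\<lambda>x. sqrt r *\<^sub>R h x)" using r by (intro pos_scaleR) (simp_all add: less_imp_le)
    show "sqrt r *\<^sub>R h (sqrt r *\<^sub>R h x) = p x" for x
      using r h(2)[of x] by (simp add: multiplier_lin[OF h(1)] y_def)
    fix c c' x assume c: "multiplier c c'" "\<And>x. c (p x) = p (c x)"
    then have "c (y x) = y (c x)" for x
      by (simp add: y_def multiplier_lin[OF c(1)])
    with h(4)[OF c(1)] show "c (sqrt r *\<^sub>R h x) = sqrt r *\<^sub>R h (c x)"
      by (simp add: multiplier_lin[OF c(1)])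
  qed
qed

text \<open>
  The operators \<open>u + \<i> e\<close> and \<open>u - \<i> e\<close> are isometries, and \<open>u\<close> is their mean.
\<close>

lemma norm_le_of_squares:
  fixes u e :: "'a::cstar_algebra \<Rightarrow> 'a"
  assumes u: "multiplier u u" and e: "multiplier e e" and ue: "\<And>x. u (e x) = e (u x)"
    and sum: "\<And>x. u (u x) + e (e x) = x"
  shows "norm (u x) \<le> norm x"
proof -
  have iso: "norm (u x + c *\<^sub>C e x) = norm x" if c: "cnj c = - c" "c * c = -1" for c
  proof -
    have "cstar (u x + c *\<^sub>C e x) * (u x + c *\<^sub>C e x) =
        cstar x * u (u x) + c *\<^sub>C (cstar x * u (e x)) - c *\<^sub>C (cstar x * e (u x))
          - (c * c) *\<^sub>C (cstar x * e (e x))"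
      using c(1) by (simp add: cstar_add cstar_scaleC distrib_left distrib_right scaleC_mult_left
          scaleC_mult_right multiplierD[OF u] multiplierD[OF e] scaleC_scaleC algebra_simps)
    also have "\<dots> = cstar x * (u (u x) + e (e x))"
      using c(2) by (simp add: ue distrib_left)
    finally have "cstar (u x + c *\<^sub>C e x) * (u x + c *\<^sub>C e x) = cstar x * x" by (simp add: sum)
    then have "(norm (u x + c *\<^sub>C e x))\<^sup>2 = (norm x)\<^sup>2" by (metis norm_cstar_mult)
    then show ?thesis by simp
  qed
  have "2 *\<^sub>R u x = (u x + \<i> *\<^sub>C e x) + (u x + (- \<i>) *\<^sub>C e x)"
    by (simp add: scaleR_2)
  then have "norm (2 *\<^sub>R u x) \<le> norm (u x + \<i> *\<^sub>C e x) + norm (u x + (- \<i>) *\<^sub>C e x)"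
    by (metis norm_triangle_ineq)
  then show ?thesis using iso[of \<i>] iso[of "- \<i>"] by simp
qed

text \<open>
  After scaling, \<open>s\<close> is a contraction \<open>u\<close> and \<open>c = sqrt (1 - u\<^sup>2)\<close> exists. Since \<open>u\<^sup>2 + c\<^sup>2 = 1\<close> with commuting
  \<open>u\<close> and \<open>c\<close>, also \<open>c\<close> is a contraction. Hence so is \<open>1 - u\<^sup>2 = c\<^sup>2\<close>, which is positivity of \<open>u\<^sup>2\<close> with bound \<open>1\<close>.
\<close>

lemma pos_square:
  fixes s :: "'a::cstar_algebra \<Rightarrow> 'a"
  assumes s: "multiplier s s"
  shows "pos (\<lambda>x. s (s x))"
proof -
  from s obtain B0 where B0: "B0 \<ge> 0" "\<And>x. norm (s x) \<le> B0 * norm x" by (auto simp: multiplier_def)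
  define B where "B = B0 + 1"
  have B: "B > 0" using B0 by (simp add: B_def)
  have sB: "norm (s x) \<le> B * norm x" for x using B0(2)[of x] norm_ge_zero[of x] unfolding B_def distrib_right by linarith
  define u where "u x = (1/B) *\<^sub>R s x" for x
  have u: "multiplier u u" unfolding u_def by (rule multiplier_scaleR[OF s])
  have u_le: "norm (u x) \<le> norm x" for x using sB[of x] B by (simp add: u_def field_simps)
  obtain c where c: "multiplier c c" "\<And>x. c (c x) = x - u (u x)"
    "\<And>c' c'' x. multiplier c' c'' \<Longrightarrow> (\<And>x. c' (u (u x)) = u (u (c' x))) \<Longrightarrow> c' (c x) = c (c' x)"
    using contraction_sqrt[OF multiplier_comp[OF u u]] u_le order_trans by metis
  have "u (c x) = c (u x)" for x by (rule c(3)[OF u]) simp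
  then have c_le: "norm (c x) \<le> norm x" for x
    by (intro norm_le_of_squares[OF c(1) u]) (simp_all add: c(2))
  have "norm (x - u (u x)) \<le> norm x" for x
    using c_le[of x] c_le[of "c x"] c(2)[of x] by simp
  then have "pos (\<lambda>x. u (u x))"
    using multiplier_comp[OF u u] by (auto simp: pos_def intro!: exI[of _ 1])
  from pos_scaleR[OF this, of "B * B"] show ?thesis
    using B by (simp add: u_def multiplier_lin[OF s])
qed

text \<open>
  With \<open>c = sqrt (1 - p)\<close> and \<open>d = sqrt (1 + p)\<close> the product \<open>e = c d\<close> satisfies \<open>e\<^sup>2 = 1 - p\<^sup>2\<close>.
\<close>

lemma norm_le_of_pos:
  assumes p: "multiplier p p" "pos (\<lambda>x. x - p x)" "pos (\<lambda>x. x + p x)"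
  shows "norm (p x) \<le> norm x"
proof -
  note pl = multiplier_lin[OF p(1)]
  obtain c where c: "pos c" "\<And>x. c (c x) = x - p x"
    "\<And>k k' x. multiplier k k' \<Longrightarrow> (\<And>x. k (x - p x) = k x - p (k x)) \<Longrightarrow> k (c x) = c (k x)"
    using pos_sqrt[OF p(2)] by blast
  obtain d where d: "pos d" "\<And>x. d (d x) = x + p x"
    "\<And>k k' x. multiplier k k' \<Longrightarrow> (\<And>x. k (x + p x) = k x + p (k x)) \<Longrightarrow> k (d x) = d (k x)"
    using pos_sqrt[OF p(3)] by blast
  note cm = pos_multiplier[OF c(1)] and dm = pos_multiplier[OF d(1)]
  have pc: "p (c x) = c (p x)" for x by (rule c(3)[OF p(1)]) (simp add: pl)
  have pd: "p (d x) = d (p x)" for x by (rule d(3)[OF p(1)]) (simp add: pl)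
  have dc: "d (c x) = c (d x)" for x by (rule c(3)[OF dm]) (simp add: multiplier_lin[OF dm] pd)
  have e: "multiplier (\<lambda>x. c (d x)) (\<lambda>x. c (d x))"
    using multiplier_comp[OF dm cm] by (simp add: dc)
  show ?thesis
    by (rule norm_le_of_squares[OF p(1) e]) (simp_all add: pc pd dc c(2) d(2) pl)
qed

text \<open>
  Monotonicity of the norm: if \<open>p + q\<close> is a contraction then \<open>1 - p\<close> is positive, as the sum of
  \<open>1 - (p + q)\<close> and \<open>q\<close>.
\<close>

lemma pos_norm_le_add:
  assumes p: "pos p" and q: "pos q" and le: "\<And>x. norm (p x + q x) \<le> C * norm x" and C: "C \<ge> 0"
  shows "norm (p x) \<le> C * norm x"
proof -
  have main: "norm (p x) \<le> D * norm x" if D: "D > C" for D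
  proof -
    have D0: "D > 0" using D C by simp
    define P where "P x = (1/D) *\<^sub>R p x" for x
    define Q where "Q x = (1/D) *\<^sub>R q x" for x
    have P: "pos P" and Q: "pos Q"
      unfolding P_def Q_def using D0 by (intro pos_scaleR p q; simp)+
    have "norm (p x + q x) \<le> D * norm x" for x
      using le[of x] mult_right_mono[of C D "norm x"] D by simp
    moreover have "norm (P x + Q x) = norm (p x + q x) / D" for x
      using D0 unfolding P_def Q_def scaleR_add_right[symmetric] norm_scaleR by simp
    ultimately have "norm (P x + Q x) \<le> 1 * norm x" for x
      using D0 by (simp add: divide_le_eq mult.commute)
    then have "pos (\<lambda>x. 1 *\<^sub>R x - (P x + Q x))"
      using P Q by (intro pos_one_minus multiplier_add pos_multiplier) auto
    from pos_add[OF this Q] have "pos (\<lambda>x. x - P x)" by (simp add: algebra_simps)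
    moreover have "pos (\<lambda>x. x)" by (auto simp: pos_def multiplier_id intro!: exI[of _ 1])
    from pos_add[OF this P] have "pos (\<lambda>x. x + P x)" .
    ultimately have "norm (P x) \<le> norm x" using norm_le_of_pos pos_multiplier[OF P] by blast
    moreover have "norm (P x) = norm (p x) / D"
      using D0 unfolding P_def norm_scaleR by simp
    ultimately show ?thesis using D0 by (simp add: divide_le_eq mult.commute)
  qed
  show ?thesis
  proof (rule field_le_epsilon)
    fix e :: real assume e: "e > 0"
    have n: "norm x + 1 > 0" by (simp add: add_nonneg_pos)
    have "norm (p x) \<le> (C + e / (norm x + 1)) * norm x" using e n by (intro main) simp
    also have "\<dots> = C * norm x + e * (norm x / (norm x + 1))" by (simp add: algebra_simps)
    also have "\<dots> \<le> C * norm x + e"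
      using e n by (intro add_left_mono mult_left_le) (simp_all add: divide_le_eq_1)
    finally show "norm (p x) \<le> C * norm x + e" .
  qed
qed

lemma pos_sum_eq_0:
  assumes "pos p" "pos q" "\<And>x. p x + q x = 0"
  shows "p x = 0"
  using pos_norm_le_add[OF assms(1,2), of 0 x] assms(3) by simp

text \<open>
  The theorem of Kelley and Vaught. For \<open>a = T\<^sup>* T\<close> let \<open>m = \<bar>a\<bar>\<close> and \<open>n = m - a\<close>, twice the negative part; one
  has to show \<open>n = 0\<close>. From \<open>n (m + a) = 0\<close> one gets \<open>n a n = - p\<close> with \<open>p = n m n\<close> positive, so that
  \<open>c = T n\<close> satisfies \<open>c\<^sup>* c = - p\<close>. The usual argument compares the spectra of \<open>c\<^sup>* c\<close> and \<open>c c\<^sup>*\<close>; here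
  it is replaced by the passage to \<open>e = c sqrt p\<close>, for which both \<open>e\<^sup>* e\<close> and \<open>e e\<^sup>*\<close> are minus a
  square.
\<close>

theorem pos_star_mult:
  assumes T: "multiplier T T'"
  shows "pos (\<lambda>x. T' (T x))"
proof -
  define a where "a x = T' (T x)" for x
  have a: "multiplier a a" unfolding a_def by (rule multiplier_comp[OF T multiplier_sym[OF T]])
  obtain m where m: "pos m" "\<And>x. m (m x) = a (a x)"
    "\<And>c c' x. multiplier c c' \<Longrightarrow> (\<And>x. c (a (a x)) = a (a (c x))) \<Longrightarrow> c (m x) = m (c x)"
    using pos_sqrt[OF pos_square[OF a]] by blast
  note mm = pos_multiplier[OF m(1)]
  have am: "a (m x) = m (a x)" for x by (rule m(3)[OF a]) simp
  define n where "n x = m x - a x" for x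
  have n: "multiplier n n" unfolding n_def by (rule multiplier_diff[OF mm a])
  note ml = multiplier_lin[OF mm] and al = multiplier_lin[OF a] and nl = multiplier_lin[OF n]
  have nm: "n (m x) = m (n x)" and na: "n (a x) = a (n x)" for x
    by (simp_all add: n_def ml al am)
  have n_ma: "n (a x) = - n (m x)" for x
    by (simp add: n_def ml al am m(2))
  obtain k where k: "pos k" "\<And>x. k (k x) = m x"
    "\<And>c c' x. multiplier c c' \<Longrightarrow> (\<And>x. c (m x) = m (c x)) \<Longrightarrow> c (k x) = k (c x)"
    using pos_sqrt[OF m(1)] by blast
  note km = pos_multiplier[OF k(1)]
  have nk: "n (k x) = k (n x)" for x by (rule k(3)[OF n nm])
  define s where "s x = k (n x)" for x
  have s: "multiplier s s"
    using multiplier_comp[OF n km] by (simp add: s_def[abs_def] nk)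
  define p where "p x = s (s x)" for x
  have p_eq: "p x = n (m (n x))" for x
    by (simp add: p_def s_def nk k(2) nm)
  have p: "pos p" unfolding p_def by (rule pos_square[OF s])
  obtain v where v: "pos v" "\<And>x. v (v x) = p x" by (rule pos_sqrt[OF p]) (rule that)
  have vp: "v (p x) = p (v x)" for x using v(2)[of x] v(2)[of "v x"] by simp
  note vm = pos_multiplier[OF v(1)] and pm = pos_multiplier[OF p]
  have p_neg: "n (a (n x)) = - p x" for x by (simp add: n_ma p_eq)
  define q where "q x = T (n (n (T' x)))" for x
  have q: "multiplier q q"
    unfolding q_def
    using multiplier_comp[OF multiplier_comp[OF multiplier_sym[OF T] n] multiplier_comp[OF n T]] .
  \<comment> \<open>\<open>e = T n v\<close> has both \<open>e\<^sup>* e\<close> and \<open>e e\<^sup>*\<close> negative, although their sum is positive.\<close>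
  define e where "e x = T (n (v x))" for x
  define e' where "e' x = v (n (T' x))" for x
  have e: "multiplier e e'"
    unfolding e_def e'_def using multiplier_comp[OF vm multiplier_comp[OF n T]] .
  note e' = multiplier_sym[OF e]
  have e'e: "e' (e x) = - p (p x)" for x
  proof -
    have "e' (e x) = v (n (a (n (v x))))" by (simp add: e_def e'_def a_def)
    also have "\<dots> = - v (v (v (v x)))" by (simp add: p_neg multiplier_lin[OF vm] v(2) vp)
    finally show ?thesis by (simp add: v(2))
  qed
  have ee': "e (e' x) = - q (q x)" for x
  proof -
    have "e (e' x) = T (n (p (n (T' x))))" by (simp add: e_def e'_def v(2))
    also have "p (n (T' x)) = - n (a (n (n (T' x))))" by (simp add: p_neg)
    finally show ?thesis by (simp add: q_def a_def multiplier_lin[OF T] nl)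
  qed
  define s1 where "s1 x = e x + e' x" for x
  define s2 where "s2 x = \<i> *\<^sub>C (e x - e' x)" for x
  have s1: "multiplier s1 s1"
    unfolding s1_def using multiplier_add[OF e e'] by (simp add: add.commute)
  have "multiplier s2 (\<lambda>x. cnj \<i> *\<^sub>C (e' x - e x))"
    unfolding s2_def by (intro multiplier_scaleC multiplier_diff e e')
  moreover have "(\<lambda>x. cnj \<i> *\<^sub>C (e' x - e x)) = s2"
    by (simp add: s2_def fun_eq_iff cv.scale_right_diff_distrib)
  ultimately have s2: "multiplier s2 s2" by simp
  have sum: "p (p x) + (q (q x) + (1/2) *\<^sub>R (s1 (s1 x) + s2 (s2 x))) = 0" for x
  proof -
    have "s1 (s1 x) + s2 (s2 x) = 2 *\<^sub>R (e (e' x) + e' (e x))"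
      by (simp add: s1_def s2_def multiplier_lin[OF e] multiplier_lin[OF e'] scaleC_scaleC scaleR_2
          cv.scale_right_diff_distrib algebra_simps)
    then show ?thesis by (simp add: e'e ee')
  qed
  have pp: "p (p x) = 0" for x
    by (rule pos_sum_eq_0[OF pos_square[OF pm] pos_add[OF pos_square[OF q] pos_scaleR[OF
            pos_add[OF pos_square[OF s1] pos_square[OF s2]], of "1/2"]] sum]) simp
  have p0: "p x = 0" for x by (rule multiplier_eq_0[OF pm pp])
  have s0: "s x = 0" for x by (rule multiplier_eq_0[OF s]) (use p0 p_def in simp)
  have "m (n x) = 0" for x
    using s0[of x] k(2)[of "n x"] by (simp add: s_def multiplier_lin[OF km])
  then have "n (n x) = 0" for x
    using n_ma[of x] by (simp add: n_def[of "n x"] nm na)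
  then have "n x = 0" for x by (rule multiplier_eq_0[OF n])
  then have "a = m" by (simp add: n_def fun_eq_iff)
  with m(1) show ?thesis by (simp add: a_def[abs_def])
qed

text \<open>
  Positivity of an element, expressed by its left multiplication so that no root inside the algebra
  is required. Every \<open>b\<^sup>* b\<close> is positive in this sense, and so are finite sums of such elements.
\<close>

definition apos :: "'a::cstar_algebra \<Rightarrow> bool" where
  "apos a \<longleftrightarrow> pos (\<lambda>x. a * x)"

lemma apos_0: "apos 0"
  by (auto simp: apos_def pos_def multiplier_def intro!: exI[of _ 0])

lemma apos_add: "apos a \<Longrightarrow> apos b \<Longrightarrow> apos (a + b)"
  unfolding apos_def distrib_right by (rule pos_add)

lemma apos_cstar_mult: "apos (cstar b * b)"
  unfolding apos_def mult.assoc by (rule pos_star_mult[OF multiplier_left_mult])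

lemma apos_norm_le_add:
  assumes "apos a" "apos b"
  shows "norm a \<le> norm (a + b)"
proof (cases "a = 0")
  case False
  have "norm (a * x) \<le> norm (a + b) * norm x" for x
    using assms norm_mult_ineq[of "a + b"] unfolding apos_def
    by (intro pos_norm_le_add[of "\<lambda>x. a * x" "\<lambda>x. b * x"]) (simp_all add: distrib_right)
  from this[of "cstar a"] norm_cstar_mult[of "cstar a"]
  have "norm a * norm a \<le> norm (a + b) * norm a" by (simp add: cstar_cstar power2_eq_square)
  with False show ?thesis by (simp add: mult_le_cancel_right)
qed simp


section \<open>The Cauchy-Schwarz inequality\<close>

text \<open>
  The classical proof: for \<open>a = \<langle>x, y\<rangle>\<close>, \<open>g = \<langle>x, x\<rangle>\<close> and \<open>N\<close> the norm of \<open>g\<close>, the inner square of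
  \<open>x a / N - y\<close> is positive, and so is \<open>N a\<^sup>* a - a\<^sup>* g a = T\<^sup>* T\<close> for \<open>T = sqrt (N - g) a\<close>. Together they
  exhibit \<open>\<langle>y, y\<rangle>\<close> as \<open>a\<^sup>* a / N\<close> plus a positive element.
\<close>

lemma (in pre_module) Cauchy_Schwarz_of_positive:
  assumes pos: "\<And>x. x \<in> hm_carrier E \<Longrightarrow> apos (hm_ip E x x)"
    and x: "x \<in> hm_carrier E" and y: "y \<in> hm_carrier E"
  shows "norm (hm_ip E x y) \<le> hm_norm E x * hm_norm E y"
proof (cases "x = 0")
  case True
  then show ?thesis using y by simp
next
  case False
  define a where "a = hm_ip E x y"
  define g where "g = hm_ip E x x"
  define N where "N = norm g"
  have N: "N > 0" using False ip_definite[OF x] by (auto simp: N_def g_def)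
  have g: "pos (\<lambda>z. g * z)" using pos[OF x] by (simp add: g_def apos_def)
  have Ng: "pos (\<lambda>z. N *\<^sub>R z - g * z)"
    using g N norm_mult_ineq[of g] by (intro pos_one_minus pos_multiplier) (auto simp: N_def)
  obtain k where k: "pos k" "\<And>z. k (k z) = N *\<^sub>R z - g * z"
    by (rule pos_sqrt[OF Ng]) (rule that)
  note T = multiplier_comp[OF multiplier_left_mult[of a] pos_multiplier[OF k(1)]]
  define z where "z = hm_act E x ((1/N) *\<^sub>R a) - y"
  have zz: "hm_ip E z z = (1/N^2) *\<^sub>R (cstar a * (g * a)) - (2/N) *\<^sub>R (cstar a * a) + hm_ip E y y"
  proof -
    define b where "b = (1/N) *\<^sub>R a"
    have "hm_ip E z z = hm_ip E (hm_act E x b) (hm_act E x b) - hm_ip E (hm_act E x b) y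
        - hm_ip E y (hm_act E x b) + hm_ip E y y"
      using x y by (simp add: z_def b_def[symmetric] ip_simps)
    also have "\<dots> = cstar b * (g * b) - cstar b * a - cstar a * b + hm_ip E y y"
      using x y ip_cstar[OF x y] by (simp add: ip_act_left ip_act_right a_def g_def mult.assoc)
    finally have "hm_ip E z z = cstar ((1/N) *\<^sub>R a) * (g * ((1/N) *\<^sub>R a)) - cstar ((1/N) *\<^sub>R a) * a
        - cstar a * ((1/N) *\<^sub>R a) + hm_ip E y y"
      by (simp add: b_def)
    also have "\<dots> = (1/N^2) *\<^sub>R (cstar a * (g * a)) - (2/N) *\<^sub>R (cstar a * a) + hm_ip E y y"
      by (simp add: cstar_scaleR power2_eq_square scaleR_left_distrib[of "1/N" "1/N", simplified])
    finally show ?thesis .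
  qed
  have zpos: "pos (\<lambda>w. hm_ip E z z * w)"
    using pos[of z] x y by (simp add: z_def apos_def)
  have apos': "pos (\<lambda>w. cstar a * a * w)" using apos_cstar_mult[of a] by (simp add: apos_def)
  define p where "p w = (1/N) *\<^sub>R (cstar a * a * w)" for w
  define q where "q w = hm_ip E z z * w + (1/N^2) *\<^sub>R (cstar a * k (k (a * w)))" for w
  have "p w + q w = hm_ip E y y * w" for w
  proof -
    have "q w = hm_ip E z z * w + ((1/N) *\<^sub>R (cstar a * a * w) - (1/N^2) *\<^sub>R (cstar a * (g * (a * w))))"
      using N by (simp add: q_def k(2) right_diff_distrib scaleR_diff_right mult.assoc power2_eq_square)
    also have "\<dots> = hm_ip E y y * w - (1/N) *\<^sub>R (cstar a * a * w)"
      by (simp add: zz distrib_right left_diff_distrib mult.assoc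
          scaleR_left_distrib[of "1/N" "1/N", simplified])
    finally show ?thesis by (simp add: p_def)
  qed
  moreover have "pos p" unfolding p_def using N by (intro pos_scaleR apos') simp
  moreover have "pos q"
    unfolding q_def using N pos_star_mult[OF T] by (intro pos_add zpos pos_scaleR) simp_all
  ultimately have "norm (p w) \<le> norm (hm_ip E y y) * norm w" for w
    using norm_mult_ineq[of "hm_ip E y y"] by (intro pos_norm_le_add[of p q]) simp_all
  from this[of "cstar a * a"]
  have "norm (cstar a * a * (cstar a * a)) \<le> N * norm (hm_ip E y y) * norm (cstar a * a)"
    using N by (simp add: p_def field_simps)
  moreover have "norm (cstar a * a * (cstar a * a)) = norm (cstar a * a) * norm (cstar a * a)"
    using norm_cstar_mult[of "cstar a * a"] by (simp add: cstar_mult cstar_cstar power2_eq_square)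
  ultimately have "norm (cstar a * a) \<le> N * norm (hm_ip E y y)"
    using N by (cases "cstar a * a = 0") (auto simp: mult_le_cancel_right)
  then have "(norm a)\<^sup>2 \<le> (hm_norm E x * hm_norm E y)\<^sup>2"
    by (simp add: norm_cstar_mult power_mult_distrib norm_sq N_def g_def)
  then show ?thesis
    unfolding a_def by (rule power2_le_imp_le) simp
qed

locale hmodule = cs_module +
  assumes ip_apos: "x \<in> hm_carrier E \<Longrightarrow> apos (hm_ip E x x)"

lemma hmoduleI:
  assumes "pre_module E" "\<And>x. x \<in> hm_carrier E \<Longrightarrow> apos (hm_ip E x x)"
  shows "hmodule E"
proof -
  interpret pre_module E by fact
  show ?thesis
    using assms(2) Cauchy_Schwarz_of_positive by unfold_locales auto
qed

lemma hilbert_module_imp_hmodule: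
  assumes "hilbert_module E"
  shows "hmodule E"
proof (rule hmoduleI)
  interpret hilbert_module E by fact
  show "pre_module E"
    by unfold_locales (fact zero_closed add_closed scaleC_closed act_closed ip_add_right
        ip_scaleC_right ip_act_right ip_cstar ip_definite complete)+
  show "apos (hm_ip E x x)" if "x \<in> hm_carrier E" for x
    using ip_positive[OF that] by (auto simp: cstar_positive_def apos_cstar_mult)
qed


section \<open>Graphs of adjointable operators\<close>

definition graph_on :: "('a, 'e) hilbert_mod \<Rightarrow> ('e \<Rightarrow> 'f) \<Rightarrow> ('e \<times> 'f) set" where
  "graph_on E f = {(x, f x) | x. x \<in> hm_carrier E}"

lemma graph_on_iff: "(x, y) \<in> graph_on E f \<longleftrightarrow> x \<in> hm_carrier E \<and> y = f x"
  by (auto simp: graph_on_def)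

lemma graph_on_eq_iff: "graph_on E f = graph_on E f' \<longleftrightarrow> (\<forall>x\<in>hm_carrier E. f x = f' x)"
  by (auto simp: set_eq_iff graph_on_iff)

lemma Domain_graph_on: "Domain (graph_on E f) = hm_carrier E"
  by (auto simp: graph_on_def)

lemma Range_graph_on: "Range (graph_on E f) = f ` hm_carrier E"
  by (auto simp: graph_on_def)

lemma op_ker_graph_on: "op_ker (graph_on E f) = {x \<in> hm_carrier E. f x = 0}"
  by (auto simp: op_ker_def graph_on_iff)

lemma graph_on_comp:
  assumes "\<And>x. x \<in> hm_carrier E \<Longrightarrow> f x \<in> hm_carrier F"
  shows "graph_on E f O graph_on F f' = graph_on E (\<lambda>x. f' (f x))"
  using assms by (auto simp: relcomp_unfold graph_on_iff set_eq_iff)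

context two_modules
begin

lemma op_adjoint_graph_on:
  assumes f: "adj E F f g"
  shows "op_adjoint E F (graph_on E f) = graph_on F g"
proof -
  have "(y, z) \<in> op_adjoint E F (graph_on E f) \<longleftrightarrow> (y, z) \<in> graph_on F g" for y z
  proof
    assume "(y, z) \<in> op_adjoint E F (graph_on E f)"
    then have yz: "y \<in> hm_carrier F" "z \<in> hm_carrier E"
      "\<And>x. x \<in> hm_carrier E \<Longrightarrow> hm_ip F (f x) y = hm_ip E x z"
      by (auto simp: op_adjoint_def graph_on_def)
    then have "z = g y" using adjD[OF f] by (intro E.ip_eqI) auto
    with yz show "(y, z) \<in> graph_on F g" by (simp add: graph_on_iff)
  next
    assume "(y, z) \<in> graph_on F g"
    then show "(y, z) \<in> op_adjoint E F (graph_on E f)"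
      using adjD[OF f] by (auto simp: op_adjoint_def graph_on_def)
  qed
  then show ?thesis by auto
qed

lemma adjointable_graph_on:
  assumes f: "adj E F f g"
  shows "adjointable E F (graph_on E f)"
  unfolding adjointable_def module_operator_def op_adjoint_graph_on[OF f]
  using adjD[OF f] adj_linear[OF f] adj_linear(6)[OF f E.zero_closed]
  by (auto simp: Domain_graph_on graph_on_iff single_valued_def)

lemma adjointable_imp_graph_on:
  assumes T: "adjointable E F T"
  obtains f g where "adj E F f g" "T = graph_on E f"
proof -
  have sub: "T \<subseteq> hm_carrier E \<times> hm_carrier F" and sv: "single_valued T"
    and dom: "Domain T = hm_carrier E" "Domain (op_adjoint E F T) = hm_carrier F"
    using T by (auto simp: adjointable_def module_operator_def)
  have "\<forall>x\<in>hm_carrier E. \<exists>y. (x, y) \<in> T" using dom(1) by blast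
  then obtain f where f: "\<And>x. x \<in> hm_carrier E \<Longrightarrow> (x, f x) \<in> T" by metis
  have "\<forall>y\<in>hm_carrier F. \<exists>z. (y, z) \<in> op_adjoint E F T" using dom(2) by blast
  then obtain g where g: "\<And>y. y \<in> hm_carrier F \<Longrightarrow> (y, g y) \<in> op_adjoint E F T" by metis
  have "hm_ip F (f x) y = hm_ip E x (g y)" if "x \<in> hm_carrier E" "y \<in> hm_carrier F" for x y
    using f[OF that(1)] g[OF that(2)] by (auto simp: op_adjoint_def)
  moreover have "f x \<in> hm_carrier F" if "x \<in> hm_carrier E" for x
    using f[OF that] sub by blast
  moreover have "g y \<in> hm_carrier E" if "y \<in> hm_carrier F" for y
    using g[OF that] by (simp add: op_adjoint_def)
  ultimately have "adj E F f g"
    by (simp add: adj_def)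
  moreover have "(x, y) \<in> T \<longleftrightarrow> (x, y) \<in> graph_on E f" for x y
    using f[of x] sub single_valuedD[OF sv, of x y "f x"] by (auto simp: graph_on_iff)
  then have "T = graph_on E f" by auto
  ultimately show ?thesis using that by blast
qed

lemma adj_contraction:
  assumes f: "adj E F f g" and le: "\<And>x. x \<in> hm_carrier E \<Longrightarrow> hm_norm F (f x) \<le> hm_norm E x"
    and y: "y \<in> hm_carrier F"
  shows "hm_norm E (g y) \<le> hm_norm F y"
proof (cases "hm_norm E (g y) = 0")
  case False
  have "(hm_norm E (g y))\<^sup>2 = norm (hm_ip F (f (g y)) y)"
    using adjD[OF f] y by (simp add: E.norm_sq)
  also have "\<dots> \<le> hm_norm F (f (g y)) * hm_norm F y"
    using adjD[OF f] y by (intro F.Cauchy_Schwarz) auto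
  also have "\<dots> \<le> hm_norm E (g y) * hm_norm F y"
    using le[of "g y"] adjD[OF f] y by (intro mult_right_mono) auto
  finally show ?thesis
    using False E.norm_nonneg[of "g y"] by (auto simp: power2_eq_square mult_le_cancel_left)
qed simp

lemma lim_contraction:
  assumes f: "adj E F f g" and le: "\<And>x. x \<in> hm_carrier E \<Longrightarrow> hm_norm F (f x) \<le> hm_norm E x"
    and s: "hm_lim E s l"
  shows "hm_lim F (\<lambda>n. f (s n)) (f l)"
proof (rule F.hm_lim_squeeze)
  note sl = E.hm_limD[OF s]
  show "f (s n) \<in> hm_carrier F" "f l \<in> hm_carrier F" for n
    using adjD[OF f] sl by auto
  show "hm_norm F (f (s n) - f l) \<le> hm_norm E (s n - l)" for n
    using le[of "s n - l"] sl by (simp add: adj_linear[OF f])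
  show "(\<lambda>n. hm_norm E (s n - l)) \<longlonglongrightarrow> 0" using s by (simp add: hm_lim_def)
qed

lemma lim_transfer:
  assumes s: "hm_lim E s l" and r: "\<And>n. r n \<in> hm_carrier F"
    and le: "\<And>m n. hm_norm F (r m - r n) \<le> hm_norm E (s m - s n)"
  shows "\<exists>l'. hm_lim F r l'"
proof -
  note sl = E.hm_limD[OF s]
  have "\<exists>l'\<in>hm_carrier F. (\<lambda>n. hm_norm F (r n - l')) \<longlonglongrightarrow> 0"
  proof (rule F.complete[OF r])
    fix e :: real assume e: "e > 0"
    have "\<forall>\<^sub>F n in sequentially. hm_norm E (s n - l) < e / 2"
      using s e by (intro order_tendstoD(2)[of _ 0]) (auto simp: hm_lim_def)
    then obtain N where N: "\<And>n. n \<ge> N \<Longrightarrow> hm_norm E (s n - l) < e / 2"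
      by (auto simp: eventually_sequentially)
    have "hm_norm F (r m - r n) < e" if "m \<ge> N" "n \<ge> N" for m n
      using le[of m n] N[OF that(1)] N[OF that(2)] E.norm_triangle_diff[of "s m" l "s n"]
        E.norm_minus_commute[of l "s n"] sl by fastforce
    then show "\<exists>N. \<forall>m\<ge>N. \<forall>n\<ge>N. hm_norm F (r m - r n) < e" by blast
  qed
  then show ?thesis using r by (auto simp: hm_lim_def)
qed

end

lemma hm_norm_eq_of_ip: "hm_ip E x x = hm_ip F y y \<Longrightarrow> hm_norm E x = hm_norm F y"
  by (simp add: hm_norm_def)

locale two_hmodules = E: hmodule E + F: hmodule F
  for E :: "('a::cstar_algebra, 'e::complex_vector) hilbert_mod"
    and F :: "('a, 'f::complex_vector) hilbert_mod"
begin

sublocale two_modules E F ..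

lemma norm_sq_le_ip_add:
  assumes "x \<in> hm_carrier E" "y \<in> hm_carrier F"
  shows "(hm_norm E x)\<^sup>2 \<le> norm (hm_ip E x x + hm_ip F y y)"
  using apos_norm_le_add[OF E.ip_apos[OF assms(1)] F.ip_apos[OF assms(2)]] by (simp add: E.norm_sq)

lemma ip_add_eq_0:
  assumes "x \<in> hm_carrier E" "y \<in> hm_carrier F" "hm_ip E x x + hm_ip F y y = 0"
  shows "x = 0" "y = 0"
  using norm_sq_le_ip_add[OF assms(1,2)] assms E.norm_eq_0[OF assms(1)] F.ip_definite[OF assms(2)]
  by simp_all

end

lemma two_hmodules_sym: "two_hmodules E F \<Longrightarrow> two_hmodules F E"
  by (simp add: two_hmodules_def)

text \<open>
  The square root of \<open>p\<close> in the sense of positive operators is the one constructed above. Another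
  positive root \<open>s\<close> commutes with \<open>p = s\<^sup>2\<close>, hence with \<open>h\<close>; then \<open>(h + s) (h - s) = 0\<close>, and positivity
  of both summands forces \<open>h (h - s) = s (h - s) = 0\<close>, so \<open>(h - s)\<^sup>2 = 0\<close>.
\<close>

lemma (in hmodule) op_sqrt_graph_on:
  assumes p: "adj E E p p" and le: "\<And>x. x \<in> hm_carrier E \<Longrightarrow> hm_norm E (x - p x) \<le> hm_norm E x"
  defines "h \<equiv> sqrt_one_minus E (\<lambda>x. x - p x)"
  shows "adj E E h h" "x \<in> hm_carrier E \<Longrightarrow> h (h x) = p x"
    "op_sqrt E (graph_on E p) = graph_on E h"
proof -
  interpret EE: two_hmodules E E ..
  note [simp] = adjD(1)[OF p]
  have y: "adj E E (\<lambda>x. x - p x) (\<lambda>x. x - p x)"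
    using adjD[OF p] by (simp add: adj_def ip_simps)
  interpret y: contraction E "\<lambda>x. x - p x"
    using y le by unfold_locales
  have h: "adj E E h h" and hh: "\<And>x. x \<in> hm_carrier E \<Longrightarrow> h (h x) = p x"
    and h_le: "\<And>x. x \<in> hm_carrier E \<Longrightarrow> hm_norm E (x - h x) \<le> hm_norm E x"
    using y.sqrt_adj y.sqrt_sqrt y.one_minus_sqrt_contr by (simp_all add: h_def)
  show "adj E E h h" "x \<in> hm_carrier E \<Longrightarrow> h (h x) = p x" by (fact h, rule hh)
  note hc [simp] = adjD(1)[OF h]
  have z: "adj E E (\<lambda>x. x - h x) (\<lambda>x. x - h x)"
    using adjD[OF h] by (simp add: adj_def ip_simps)
  interpret z: contraction E "\<lambda>x. x - h x"
    using z h_le by unfold_locales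
  define k where "k = sqrt_one_minus E (\<lambda>x. x - h x)"
  have k: "adj E E k k" and kk: "\<And>x. x \<in> hm_carrier E \<Longrightarrow> k (k x) = h x"
    using z.sqrt_adj z.sqrt_sqrt by (simp_all add: k_def)
  note [simp] = adjD(1)[OF k]
  show "op_sqrt E (graph_on E p) = graph_on E h"
    unfolding op_sqrt_def
  proof (rule the_equality)
    have "graph_on E h = graph_on E k O graph_on E k"
      by (subst graph_on_comp[of E k E]) (simp_all add: graph_on_eq_iff kk)
    then have "positive_operator E (graph_on E h)"
      unfolding positive_operator_def
      using EE.adjointable_graph_on[OF k] EE.op_adjoint_graph_on[OF k] by metis
    moreover have "graph_on E h O graph_on E h = graph_on E p"
      by (subst graph_on_comp[of E h E]) (simp_all add: graph_on_eq_iff hh)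
    ultimately show "positive_operator E (graph_on E h) \<and> graph_on E h O graph_on E h = graph_on E p"
      by blast
  next
    fix S assume S: "positive_operator E S \<and> S O S = graph_on E p"
    then obtain B where B: "adjointable E E B" "S = B O op_adjoint E E B"
      by (auto simp: positive_operator_def)
    obtain b b' where b: "adj E E b b'" "B = graph_on E b"
      using EE.adjointable_imp_graph_on[OF B(1)] by blast
    note [simp] = adjD(1,2)[OF b(1)]
    define s where "s x = b' (b x)" for x
    have s: "adj E E s s"
      unfolding s_def using adj_comp[OF b(1) EE.adj_sym[OF b(1)]] .
    note [simp] = adjD(1)[OF s]
    have S_eq: "S = graph_on E s"
      unfolding B(2) b(2) EE.op_adjoint_graph_on[OF b(1)] s_def by (rule graph_on_comp) simp
    have "S O S = graph_on E (\<lambda>x. s (s x))"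
      unfolding S_eq by (rule graph_on_comp) simp
    with S have ss: "s (s x) = p x" if "x \<in> hm_carrier E" for x
      using that by (simp add: graph_on_eq_iff)
    note sl = EE.adj_linear[OF s] and hl = EE.adj_linear[OF h]
    have sp: "s (p x) = p (s x)" if "x \<in> hm_carrier E" for x
      using that by (simp flip: ss)
    have sh: "s (h x) = h (s x)" if "x \<in> hm_carrier E" for x
      unfolding h_def by (rule y.sqrt_commute[OF s _ that]) (simp add: sl sp)
    have "h x = s x" if x: "x \<in> hm_carrier E" for x
    proof -
      define u where "u = h x - s x"
      have u: "u \<in> hm_carrier E" using x by (simp add: u_def)
      have "h u + s u = 0" using x by (simp add: u_def sl hl hh ss sh)
      then have "hm_ip E u (h u + s u) = 0" using u by simp
      then have "hm_ip E (k u) (k u) + hm_ip E (b u) (b u) = 0"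
        using u adjD(3)[OF k, of u "k u"] adjD(3)[OF b(1), of u "b u"]
        by (simp add: ip_add_right kk s_def)
      from EE.ip_add_eq_0[OF _ _ this] have "k u = 0" "b u = 0" using u by simp_all
      then have "h u = 0" "s u = 0"
        using kk[OF u] EE.adj_linear(6)[OF k u] EE.adj_linear(6)[OF EE.adj_sym[OF b(1)] u]
        by (simp_all add: s_def)
      moreover have "hm_ip E u u = hm_ip E x (h u - s u)"
        using x u adjD(3)[OF h x u] adjD(3)[OF s x u] unfolding u_def[symmetric]
        by (subst (1) u_def) (simp add: ip_simps)
      ultimately have "u = 0" using ip_definite[OF u] x by simp
      then show ?thesis by (simp add: u_def)
    qed
    then show "S = graph_on E h" by (simp add: S_eq graph_on_eq_iff)
  qed
qed


section \<open>Polar decomposition of a bounded operator\<close>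

definition spanned :: "('a, 'e::plus) hilbert_mod \<Rightarrow> 'e set \<Rightarrow> 'e set \<Rightarrow> bool" where
  "spanned E M N \<longleftrightarrow> (\<forall>x\<in>hm_carrier E. \<exists>a\<in>M. \<exists>b\<in>N. x = a + b)"

text \<open>
  A contraction \<open>f\<close> with adjoint \<open>g\<close> and modulus \<open>k\<close>. It has a polar decomposition exactly when the two
  modules are spanned by the kernels and the closed ranges of \<open>f\<close> and \<open>g\<close>.
\<close>

locale modulus = two_hmodules E F
  for E :: "('a::cstar_algebra, 'b::complex_vector) hilbert_mod"
    and F :: "('a, 'c::complex_vector) hilbert_mod" +
  fixes f :: "'b \<Rightarrow> 'c" and g :: "'c \<Rightarrow> 'b" and k :: "'b \<Rightarrow> 'b"
  assumes f: "adj E F f g"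
    and f_contr: "x \<in> hm_carrier E \<Longrightarrow> hm_norm F (f x) \<le> hm_norm E x"
    and k: "adj E E k k"
    and kk: "x \<in> hm_carrier E \<Longrightarrow> k (k x) = g (f x)"
begin

interpretation FE: two_hmodules F E
  by (rule two_hmodules_sym) unfold_locales

interpretation EE: two_hmodules E E ..

lemmas g = adj_sym[OF f]
lemmas [simp] = adjD(1,2)[OF f] adjD(1)[OF k]
lemmas f_lin = adj_linear[OF f] and g_lin = FE.adj_linear[OF g] and k_lin = EE.adj_linear[OF k]

lemma zeros [simp]: "f 0 = 0" "g 0 = 0" "k 0 = 0"
  by (rule f_lin(6)[OF E.zero_closed], rule g_lin(6)[OF F.zero_closed], rule k_lin(6)[OF E.zero_closed])

lemma ip_f_k: "x \<in> hm_carrier E \<Longrightarrow> y \<in> hm_carrier E \<Longrightarrow> hm_ip F (f x) (f y) = hm_ip E (k x) (k y)"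
  by (simp add: adjD(3)[OF f] adjD(3)[OF k] kk)

lemma range_closed: "f ` hm_carrier E \<subseteq> hm_carrier F" "g ` hm_carrier F \<subseteq> hm_carrier E"
  "k ` hm_carrier E \<subseteq> hm_carrier E"
  by auto

text \<open>
  The projections \<open>v' v\<close> and \<open>v v'\<close> split the modules. What remains is to compare the range of \<open>k\<close>,
  which occurs in the polar decomposition, with the range of \<open>g\<close>: \<open>f = v k\<close> gives \<open>k = v' f\<close>, and the
  adjoint of this is \<open>k = g v\<close>.
\<close>

lemma polar_imp_spanned:
  assumes v: "adj E F v v'"
    and idem: "\<And>x. x \<in> hm_carrier E \<Longrightarrow> v' (v (v' (v x))) = v' (v x)"
    and fvk: "\<And>x. x \<in> hm_carrier E \<Longrightarrow> f x = v (k x)"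
    and ker: "{x \<in> hm_carrier E. v x = 0} = {x \<in> hm_carrier E. f x = 0}"
      "{y \<in> hm_carrier F. v' y = 0} = {y \<in> hm_carrier F. g y = 0}"
    and ran: "v ` hm_carrier E = hm_closure F (f ` hm_carrier E)"
      "v' ` hm_carrier F = hm_closure E (k ` hm_carrier E)"
  shows "spanned E {x \<in> hm_carrier E. f x = 0} (hm_closure E (g ` hm_carrier F))"
    and "spanned F {y \<in> hm_carrier F. g y = 0} (hm_closure F (f ` hm_carrier E))"
proof -
  note [simp] = adjD(1,2)[OF v]
  note v_lin = adj_linear[OF v] and v'_lin = FE.adj_linear[OF adj_sym[OF v]]
  have vv'v: "v (v' (v x)) = v x" if x: "x \<in> hm_carrier E" for x
  proof -
    define w where "w = v (x - v' (v x))"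
    have w: "w \<in> hm_carrier F" using x by (simp add: w_def)
    have "v' w = 0" using x idem[OF x] by (simp add: w_def v_lin v'_lin)
    then have "hm_ip F w w = 0"
      using adjD(3)[OF v, of "x - v' (v x)" w] x w by (simp flip: w_def)
    then have "w = 0" using F.ip_definite[OF w] by simp
    then show ?thesis using x by (simp add: w_def v_lin)
  qed
  have v'vv': "v' (v (v' y)) = v' y" if y: "y \<in> hm_carrier F" for y
  proof (rule E.ip_eqI)
    fix z assume z: "z \<in> hm_carrier E"
    show "hm_ip E z (v' (v (v' y))) = hm_ip E z (v' y)"
      using y z vv'v[OF z] by (simp add: adjD(3)[OF adj_sym[OF v], symmetric] flip: adjD(3)[OF v])
  qed (use y in simp_all)
  have kv'f: "k x = v' (f x)" if x: "x \<in> hm_carrier E" for x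
  proof -
    have "k x \<in> v' ` hm_carrier F"
      unfolding ran using x E.subset_closure[OF range_closed(3)] by blast
    then obtain y where "y \<in> hm_carrier F" "k x = v' y" by blast
    with v'vv' show ?thesis using fvk[OF x] by simp
  qed
  have kgv: "k x = g (v x)" if x: "x \<in> hm_carrier E" for x
  proof (rule E.ip_eqI)
    fix z assume z: "z \<in> hm_carrier E"
    have "hm_ip E z (k x) = hm_ip E (v' (f z)) x"
      using x z by (simp add: kv'f[symmetric] adjD(3)[OF k])
    also have "\<dots> = hm_ip E z (g (v x))"
      using x z by (simp add: adjD(3)[OF adj_sym[OF v]] adjD(3)[OF f])
    finally show "hm_ip E z (k x) = hm_ip E z (g (v x))" .
  qed (use x in simp_all)
  then have sub: "hm_closure E (k ` hm_carrier E) \<subseteq> hm_closure E (g ` hm_carrier F)"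
    by (fastforce simp: hm_closure_def)
  show "spanned E {x \<in> hm_carrier E. f x = 0} (hm_closure E (g ` hm_carrier F))"
    unfolding spanned_def
  proof
    fix x assume x: "x \<in> hm_carrier E"
    have "x - v' (v x) \<in> {x \<in> hm_carrier E. v x = 0}" using x by (simp add: v_lin vv'v)
    then have "x - v' (v x) \<in> {x \<in> hm_carrier E. f x = 0}" unfolding ker .
    moreover have "v' (v x) \<in> hm_closure E (g ` hm_carrier F)" using ran(2) sub x by auto
    ultimately show "\<exists>a\<in>{x \<in> hm_carrier E. f x = 0}. \<exists>b\<in>hm_closure E (g ` hm_carrier F). x = a + b"
      by (metis diff_add_cancel)
  qed
  show "spanned F {y \<in> hm_carrier F. g y = 0} (hm_closure F (f ` hm_carrier E))"
    unfolding spanned_def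
  proof
    fix y assume y: "y \<in> hm_carrier F"
    have "y - v (v' y) \<in> {y \<in> hm_carrier F. v' y = 0}" using y by (simp add: v'_lin v'vv')
    then have "y - v (v' y) \<in> {y \<in> hm_carrier F. g y = 0}" unfolding ker .
    moreover have "v (v' y) \<in> hm_closure F (f ` hm_carrier E)" using ran(1) y by auto
    ultimately show "\<exists>a\<in>{y \<in> hm_carrier F. g y = 0}. \<exists>b\<in>hm_closure F (f ` hm_carrier E). y = a + b"
      by (metis diff_add_cancel)
  qed
qed

text \<open>The closure of the isometric relation \<open>k u \<mapsto> f u\<close>.\<close>

definition G :: "('b \<times> 'c) set" where
  "G = {(p, q). \<exists>u. (\<forall>n. u n \<in> hm_carrier E) \<and> hm_lim E (\<lambda>n. k (u n)) p \<and> hm_lim F (\<lambda>n. f (u n)) q}"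

lemma G_carrier: "(p, q) \<in> G \<Longrightarrow> p \<in> hm_carrier E" "(p, q) \<in> G \<Longrightarrow> q \<in> hm_carrier F"
  by (auto simp: G_def hm_lim_def)

lemma G_const: "x \<in> hm_carrier E \<Longrightarrow> (k x, f x) \<in> G"
  unfolding G_def using E.hm_lim_const F.hm_lim_const by (auto intro!: exI[of _ "\<lambda>_. x"])

lemma G_closure:
  assumes "(p, q) \<in> G"
  shows "p \<in> hm_closure E (k ` hm_carrier E)" "q \<in> hm_closure F (f ` hm_carrier E)"
proof -
  from assms obtain u where u: "\<And>n. u n \<in> hm_carrier E" "hm_lim E (\<lambda>n. k (u n)) p" "hm_lim F (\<lambda>n. f (u n)) q"
    by (auto simp: G_def)
  then show "p \<in> hm_closure E (k ` hm_carrier E)" "q \<in> hm_closure F (f ` hm_carrier E)"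
    by (auto intro: E.closure_limI[OF u(2)] F.closure_limI[OF u(3)])
qed

lemma norm_k_f:
  "x \<in> hm_carrier E \<Longrightarrow> y \<in> hm_carrier E \<Longrightarrow> hm_norm F (f x - f y) = hm_norm E (k x - k y)"
  using ip_f_k[of "x - y" "x - y"] by (intro hm_norm_eq_of_ip) (simp add: f_lin k_lin)

lemma G_left:
  assumes "p \<in> hm_closure E (k ` hm_carrier E)"
  obtains q where "(p, q) \<in> G"
proof -
  from assms obtain s where s: "\<And>n. s n \<in> k ` hm_carrier E" "hm_lim E s p"
    unfolding E.closure_iff_lim[OF range_closed(3)] by blast
  then have "\<forall>n. \<exists>x. x \<in> hm_carrier E \<and> s n = k x" by blast
  then obtain u where u: "\<And>n. u n \<in> hm_carrier E" "\<And>n. s n = k (u n)"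
    unfolding choice_iff by blast
  have le: "hm_norm F (f (u m) - f (u n)) \<le> hm_norm E (s m - s n)" for m n
    using u by (simp add: norm_k_f)
  obtain q where "hm_lim F (\<lambda>n. f (u n)) q"
    using lim_transfer[OF s(2) _ le] u(1) by auto
  moreover have "hm_lim E (\<lambda>n. k (u n)) p" using s(2) by (simp flip: u(2))
  ultimately show ?thesis using u(1) that by (auto simp: G_def)
qed

lemma G_right:
  assumes "q \<in> hm_closure F (f ` hm_carrier E)"
  obtains p where "(p, q) \<in> G"
proof -
  from assms obtain s where s: "\<And>n. s n \<in> f ` hm_carrier E" "hm_lim F s q"
    unfolding F.closure_iff_lim[OF range_closed(1)] by blast
  then have "\<forall>n. \<exists>x. x \<in> hm_carrier E \<and> s n = f x" by blast
  then obtain u where u: "\<And>n. u n \<in> hm_carrier E" "\<And>n. s n = f (u n)"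
    unfolding choice_iff by blast
  have le: "hm_norm E (k (u m) - k (u n)) \<le> hm_norm F (s m - s n)" for m n
    using u by (simp add: norm_k_f)
  obtain p where "hm_lim E (\<lambda>n. k (u n)) p"
    using FE.lim_transfer[OF s(2) _ le] u(1) by auto
  moreover have "hm_lim F (\<lambda>n. f (u n)) q" using s(2) by (simp flip: u(2))
  ultimately show ?thesis using u(1) that by (auto simp: G_def)
qed

lemma G_ip:
  assumes "(p, q) \<in> G" "(p', q') \<in> G"
  shows "hm_ip E p p' = hm_ip F q q'"
proof -
  from assms obtain u u' where u: "\<And>n. u n \<in> hm_carrier E" "hm_lim E (\<lambda>n. k (u n)) p" "hm_lim F (\<lambda>n. f (u n)) q"
    and u': "\<And>n. u' n \<in> hm_carrier E" "hm_lim E (\<lambda>n. k (u' n)) p'" "hm_lim F (\<lambda>n. f (u' n)) q'"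
    by (auto simp: G_def)
  have "hm_ip E (k (u n)) p' = hm_ip F (f (u n)) q'" for n
    using LIMSEQ_unique[OF E.hm_lim_ip_right[OF u'(2), of "k (u n)"]]
      F.hm_lim_ip_right[OF u'(3), of "f (u n)"] u(1) u'(1) by (simp add: ip_f_k)
  then show ?thesis
    using LIMSEQ_unique[OF E.hm_lim_ip_left[OF u(2)]] F.hm_lim_ip_left[OF u(3)]
      G_carrier[OF assms(2)] by simp
qed

lemma G_diff:
  assumes "(p, q) \<in> G" "(p', q') \<in> G"
  shows "(p - p', q - q') \<in> G"
proof -
  from assms obtain u u' where u: "\<And>n. u n \<in> hm_carrier E" "hm_lim E (\<lambda>n. k (u n)) p" "hm_lim F (\<lambda>n. f (u n)) q"
    and u': "\<And>n. u' n \<in> hm_carrier E" "hm_lim E (\<lambda>n. k (u' n)) p'" "hm_lim F (\<lambda>n. f (u' n)) q'"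
    by (auto simp: G_def)
  have "hm_lim E (\<lambda>n. k (u n - u' n)) (p - p')" "hm_lim F (\<lambda>n. f (u n - u' n)) (q - q')"
    using E.hm_lim_diff[OF u(2) u'(2)] F.hm_lim_diff[OF u(3) u'(3)] u(1) u'(1)
    by (simp_all add: f_lin k_lin)
  then show ?thesis using u(1) u'(1) by (auto simp: G_def intro!: exI[of _ "\<lambda>n. u n - u' n"])
qed

lemma G_zero_iff: "(p, q) \<in> G \<Longrightarrow> p = 0 \<longleftrightarrow> q = 0"
  using G_ip[of p q p q] G_carrier[of p q] E.ip_definite F.ip_definite by auto

lemma ker_f_orthogonal:
  assumes a: "a \<in> hm_carrier E" "f a = 0" and p: "(p, q) \<in> G"
  shows "hm_ip E a p = 0"
proof -
  from p obtain u where u: "\<And>n. u n \<in> hm_carrier E" "hm_lim E (\<lambda>n. k (u n)) p"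
    by (auto simp: G_def)
  have "hm_ip E (k a) (k a) = 0" using ip_f_k[OF a(1) a(1)] a by simp
  then have "k a = 0" using E.ip_definite a by simp
  then have "hm_ip E a (k (u n)) = 0" for n
    using adjD(3)[OF k a(1) u(1)[of n]] u(1) by simp
  then show ?thesis using E.hm_lim_ip_right[OF u(2) a(1)] by (simp add: LIMSEQ_const_iff)
qed

lemma ker_g_orthogonal:
  assumes b: "b \<in> hm_carrier F" "g b = 0" and p: "(p, q) \<in> G"
  shows "hm_ip F q b = 0"
proof -
  from p obtain u where u: "\<And>n. u n \<in> hm_carrier E" "hm_lim F (\<lambda>n. f (u n)) q"
    by (auto simp: G_def)
  have "hm_ip F (f (u n)) b = 0" for n
    using adjD(3)[OF f u(1) b(1)] b u(1) by simp
  then show ?thesis using F.hm_lim_ip_left[OF u(2) b(1)] by (simp add: LIMSEQ_const_iff)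
qed

text \<open>
  The partial isometry is the closed isometric relation on the closed ranges of \<open>k\<close> and \<open>f\<close>, extended by
  zero on the kernels. Spanning makes it everywhere defined, in both directions.
\<close>

lemma spanned_imp_polar:
  assumes E: "spanned E {x \<in> hm_carrier E. f x = 0} (hm_closure E (g ` hm_carrier F))"
    and F: "spanned F {y \<in> hm_carrier F. g y = 0} (hm_closure F (f ` hm_carrier E))"
  obtains v v' where "adj E F v v'"
    "\<And>x. x \<in> hm_carrier E \<Longrightarrow> v' (v (v' (v x))) = v' (v x)"
    "\<And>x. x \<in> hm_carrier E \<Longrightarrow> f x = v (k x)"
    "{x \<in> hm_carrier E. v x = 0} = {x \<in> hm_carrier E. f x = 0}"
    "{y \<in> hm_carrier F. v' y = 0} = {y \<in> hm_carrier F. g y = 0}"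
    "v ` hm_carrier E = hm_closure F (f ` hm_carrier E)"
    "v' ` hm_carrier F = hm_closure E (k ` hm_carrier E)"
proof -
  have F': "\<exists>p q. (p, q) \<in> G \<and> g (y - q) = 0" if y: "y \<in> hm_carrier F" for y
  proof -
    obtain b q where b: "b \<in> hm_carrier F" "g b = 0" "q \<in> hm_closure F (f ` hm_carrier E)" "y = b + q"
      using F y by (auto simp: spanned_def)
    then show ?thesis using G_right[of q] by (metis add_diff_cancel_right')
  qed
  \<comment> \<open>Since \<open>F\<close> is spanned, \<open>g\<close> takes no values beyond those on the closed range of \<open>f\<close>.\<close>
  have "g y \<in> hm_closure E (k ` hm_carrier E)" if y: "y \<in> hm_carrier F" for y
  proof -
    obtain p q where pq: "(p, q) \<in> G" "g (y - q) = 0" using F'[OF y] by blast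
    obtain u where u: "\<And>n. u n \<in> hm_carrier E" "hm_lim F (\<lambda>n. f (u n)) q"
      using pq(1) by (auto simp: G_def)
    have "hm_lim E (\<lambda>n. g (f (u n))) (g q)"
      using FE.lim_contraction[OF g _ u(2)] adj_contraction[OF f f_contr] by blast
    moreover have "g y = g q" using pq(2) y G_carrier[OF pq(1)] by (simp add: g_lin)
    ultimately have "hm_lim E (\<lambda>n. k (k (u n))) (g y)" using u(1) by (simp add: kk)
    moreover have "k (k (u n)) \<in> k ` hm_carrier E" for n using u(1) by simp
    ultimately show ?thesis by (rule E.closure_limI)
  qed
  then have gk: "g ` hm_carrier F \<subseteq> hm_closure E (k ` hm_carrier E)" by blast
  have cl: "hm_closure E (g ` hm_carrier F) \<subseteq> hm_closure E (k ` hm_carrier E)"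
  proof
    fix x assume "x \<in> hm_closure E (g ` hm_carrier F)"
    then obtain s where s: "\<And>n. s n \<in> g ` hm_carrier F" "hm_lim E s x"
      unfolding E.closure_iff_lim[OF range_closed(2)] by blast
    show "x \<in> hm_closure E (k ` hm_carrier E)"
      by (rule E.closure_limD[OF s(2) _ range_closed(3)]) (use s(1) gk in blast)
  qed
  have E': "\<exists>p q. (p, q) \<in> G \<and> f (x - p) = 0" if x: "x \<in> hm_carrier E" for x
  proof -
    obtain a p where a: "a \<in> hm_carrier E" "f a = 0" "p \<in> hm_closure E (g ` hm_carrier F)" "x = a + p"
      using E x by (auto simp: spanned_def)
    then show ?thesis using G_left[of p] cl by (metis add_diff_cancel_right' subsetD)
  qed
  obtain P v where v: "\<And>x. x \<in> hm_carrier E \<Longrightarrow> (P x, v x) \<in> G"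
      "\<And>x. x \<in> hm_carrier E \<Longrightarrow> f (x - P x) = 0"
    using E' by metis
  obtain Q v' where v': "\<And>y. y \<in> hm_carrier F \<Longrightarrow> (v' y, Q y) \<in> G"
      "\<And>y. y \<in> hm_carrier F \<Longrightarrow> g (y - Q y) = 0"
    using F' by metis
  note c = G_carrier[OF v(1)] G_carrier[OF v'(1)]
  have U: "q = v x" if x: "x \<in> hm_carrier E" "(p, q) \<in> G" "f (x - p) = 0" for x p q
  proof -
    have d: "(P x - p, v x - q) \<in> G" using G_diff[OF v(1)[OF x(1)] x(2)] .
    have p: "p \<in> hm_carrier E" using G_carrier[OF x(2)] by blast
    have "f (P x - p) = f (x - p) - f (x - P x)"
      using c(1)[OF x(1)] p x(1) by (simp add: f_lin)
    then have "f (P x - p) = 0" using x(3) v(2)[OF x(1)] by simp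
    then have "hm_ip E (P x - p) (P x - p) = 0"
      using ker_f_orthogonal[OF _ _ d] G_carrier[OF d] by blast
    then have "P x - p = 0" using E.ip_definite G_carrier[OF d] by blast
    then show ?thesis using G_zero_iff[OF d] by simp
  qed
  have U': "p = v' y" if y: "y \<in> hm_carrier F" "(p, q) \<in> G" "g (y - q) = 0" for y p q
  proof -
    have d: "(v' y - p, Q y - q) \<in> G" using G_diff[OF v'(1)[OF y(1)] y(2)] .
    have q: "q \<in> hm_carrier F" using G_carrier[OF y(2)] by blast
    have "g (Q y - q) = g (y - q) - g (y - Q y)"
      using c(4)[OF y(1)] q y(1) by (simp add: g_lin)
    then have "g (Q y - q) = 0" using y(3) v'(2)[OF y(1)] by simp
    then have "hm_ip F (Q y - q) (Q y - q) = 0"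
      using ker_g_orthogonal[OF _ _ d] G_carrier[OF d] by blast
    then have "Q y - q = 0" using F.ip_definite G_carrier[OF d] by blast
    then show ?thesis using G_zero_iff[OF d] by simp
  qed
  have v'v: "v' (v x) = P x" if x: "x \<in> hm_carrier E" for x
    using U'[OF c(2)[OF x] v(1)[OF x]] by simp
  have vP: "v (P x) = v x" if x: "x \<in> hm_carrier E" for x
    using U[OF c(1)[OF x] v(1)[OF x]] by simp
  show ?thesis
  proof (rule that[of v v'])
    have "hm_ip F (v x) y = hm_ip E x (v' y)" if x: "x \<in> hm_carrier E" and y: "y \<in> hm_carrier F" for x y
    proof -
      have "hm_ip F (v x) y - hm_ip F (v x) (Q y) = hm_ip F (v x) (y - Q y)"
        using x y c by (simp add: F.ip_diff_right)
      also have "\<dots> = 0"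
        using ker_g_orthogonal[OF _ v'(2)[OF y] v(1)[OF x]] y c(4) by simp
      finally have "hm_ip F (v x) y = hm_ip E (P x) (v' y)"
        using G_ip[OF v(1)[OF x] v'(1)[OF y]] by simp
      moreover have "hm_ip E x (v' y) - hm_ip E (P x) (v' y) = hm_ip E (x - P x) (v' y)"
        using x y c by (simp add: E.ip_diff_left)
      moreover have "\<dots> = 0"
        using ker_f_orthogonal[OF _ v(2)[OF x] v'(1)[OF y]] x c(1) by simp
      ultimately show ?thesis by simp
    qed
    then show "adj E F v v'" using c by (auto simp: adj_def)
    show "v' (v (v' (v x))) = v' (v x)" if "x \<in> hm_carrier E" for x
      using that by (simp add: v'v vP)
    show "f x = v (k x)" if "x \<in> hm_carrier E" for x
      using U[OF _ G_const[OF that]] that by simp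
    show "{x \<in> hm_carrier E. v x = 0} = {x \<in> hm_carrier E. f x = 0}"
    proof (intro Collect_cong conj_cong refl iffI)
      fix x assume x: "x \<in> hm_carrier E"
      show "f x = 0" if "v x = 0" using v[OF x] G_zero_iff[OF v(1)[OF x]] that by simp
      show "v x = 0" if "f x = 0" using U[OF x, of 0 0] G_const[OF E.zero_closed] that by simp
    qed
    show "{y \<in> hm_carrier F. v' y = 0} = {y \<in> hm_carrier F. g y = 0}"
    proof (intro Collect_cong conj_cong refl iffI)
      fix y assume y: "y \<in> hm_carrier F"
      show "g y = 0" if "v' y = 0" using v'[OF y] G_zero_iff[OF v'(1)[OF y]] that by simp
      show "v' y = 0" if "g y = 0" using U'[OF y, of 0 0] G_const[OF E.zero_closed] that by simp
    qed
    show "v ` hm_carrier E = hm_closure F (f ` hm_carrier E)"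
    proof (intro equalityI subsetI)
      fix q assume "q \<in> hm_closure F (f ` hm_carrier E)"
      then obtain p where p: "(p, q) \<in> G" by (rule G_right)
      then have "q = v p" using U[OF G_carrier(1)[OF p] p] by simp
      then show "q \<in> v ` hm_carrier E" using G_carrier[OF p] by blast
    qed (use G_closure[OF v(1)] in auto)
    show "v' ` hm_carrier F = hm_closure E (k ` hm_carrier E)"
    proof (intro equalityI subsetI)
      fix p assume "p \<in> hm_closure E (k ` hm_carrier E)"
      then obtain q where p: "(p, q) \<in> G" by (rule G_left)
      then have "p = v' q" using U'[OF G_carrier(2)[OF p] p] by simp
      then show "p \<in> v' ` hm_carrier F" using G_carrier[OF p] by blast
    qed (use G_closure[OF v'(1)] in auto)
  qed
qed

theorem adjointable_polar_decomposable_iff: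
  assumes modulus: "op_modulus E F (graph_on E f) = graph_on E k"
  shows "adjointable_polar_decomposable E F (graph_on E f) \<longleftrightarrow>
     spanned E {x \<in> hm_carrier E. f x = 0} (hm_closure E (g ` hm_carrier F)) \<and>
     spanned F {y \<in> hm_carrier F. g y = 0} (hm_closure F (f ` hm_carrier E))"
proof
  assume "adjointable_polar_decomposable E F (graph_on E f)"
  then obtain V where V: "partial_isometry E F V" "graph_on E f = graph_on E k O V"
    "op_ker V = op_ker (graph_on E f)" "op_ker (op_adjoint E F V) = op_ker (graph_on F g)"
    "Range V = hm_closure F (Range (graph_on E f))"
    "Range (op_adjoint E F V) = hm_closure E (Range (graph_on E k))"
    unfolding adjointable_polar_decomposable_def modulus op_adjoint_graph_on[OF f] by blast
  obtain v v' where v: "adj E F v v'" "V = graph_on E v"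
    using V(1) adjointable_imp_graph_on unfolding partial_isometry_def by blast
  note [simp] = adjD(1,2)[OF v(1)]
  have comp: "graph_on E v O graph_on F v' = graph_on E (\<lambda>x. v' (v x))"
    by (rule graph_on_comp) simp
  have comp': "graph_on E (\<lambda>x. v' (v x)) O graph_on E (\<lambda>x. v' (v x)) = graph_on E (\<lambda>x. v' (v (v' (v x))))"
    by (rule graph_on_comp) simp
  have "v' (v (v' (v x))) = v' (v x)" if "x \<in> hm_carrier E" for x
    using V(1) that unfolding partial_isometry_def op_projection_def v(2) op_adjoint_graph_on[OF v(1)] comp comp'
    by (simp add: graph_on_eq_iff)
  moreover have "graph_on E k O graph_on E v = graph_on E (\<lambda>x. v (k x))" by (rule graph_on_comp) simp
  then have "f x = v (k x)" if "x \<in> hm_carrier E" for x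
    using V(2) that by (simp add: v(2) graph_on_eq_iff)
  ultimately show "spanned E {x \<in> hm_carrier E. f x = 0} (hm_closure E (g ` hm_carrier F)) \<and>
     spanned F {y \<in> hm_carrier F. g y = 0} (hm_closure F (f ` hm_carrier E))"
    using polar_imp_spanned[OF v(1)] V(3-) unfolding v(2) op_adjoint_graph_on[OF v(1)]
      op_ker_graph_on Range_graph_on by blast
next
  assume "spanned E {x \<in> hm_carrier E. f x = 0} (hm_closure E (g ` hm_carrier F)) \<and>
     spanned F {y \<in> hm_carrier F. g y = 0} (hm_closure F (f ` hm_carrier E))"
  then obtain v v' where v: "adj E F v v'"
    "\<And>x. x \<in> hm_carrier E \<Longrightarrow> v' (v (v' (v x))) = v' (v x)"
    "\<And>x. x \<in> hm_carrier E \<Longrightarrow> f x = v (k x)"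
    "{x \<in> hm_carrier E. v x = 0} = {x \<in> hm_carrier E. f x = 0}"
    "{y \<in> hm_carrier F. v' y = 0} = {y \<in> hm_carrier F. g y = 0}"
    "v ` hm_carrier E = hm_closure F (f ` hm_carrier E)"
    "v' ` hm_carrier F = hm_closure E (k ` hm_carrier E)"
    using spanned_imp_polar by blast
  note [simp] = adjD(1,2)[OF v(1)]
  note adj2 = adj_comp[OF v(1) adj_sym[OF v(1)]]
  have comp: "graph_on E v O graph_on F v' = graph_on E (\<lambda>x. v' (v x))"
    by (rule graph_on_comp) simp
  have comp': "graph_on E (\<lambda>x. v' (v x)) O graph_on E (\<lambda>x. v' (v x)) = graph_on E (\<lambda>x. v' (v (v' (v x))))"
    by (rule graph_on_comp) simp
  have comp'': "graph_on E k O graph_on E v = graph_on E (\<lambda>x. v (k x))" by (rule graph_on_comp) simp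
  have "partial_isometry E F (graph_on E v)"
    unfolding partial_isometry_def op_projection_def op_adjoint_graph_on[OF v(1)] comp comp'
      EE.op_adjoint_graph_on[OF adj2]
    using adjointable_graph_on[OF v(1)] EE.adjointable_graph_on[OF adj2] v(2) by (simp add: graph_on_eq_iff)
  moreover have "graph_on E f = graph_on E k O graph_on E v"
    unfolding comp'' using v(3) by (simp add: graph_on_eq_iff)
  ultimately have "partial_isometry E F (graph_on E v) \<and> graph_on E f = graph_on E k O graph_on E v \<and>
      op_ker (graph_on E v) = op_ker (graph_on E f) \<and>
      op_ker (op_adjoint E F (graph_on E v)) = op_ker (graph_on F g) \<and>
      Range (graph_on E v) = hm_closure F (Range (graph_on E f)) \<and>
      Range (op_adjoint E F (graph_on E v)) = hm_closure E (Range (graph_on E k))"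
    unfolding op_adjoint_graph_on[OF v(1)] op_ker_graph_on Range_graph_on using v(4-) by blast
  then show "adjointable_polar_decomposable E F (graph_on E f)"
    unfolding adjointable_polar_decomposable_def modulus op_adjoint_graph_on[OF f]
    using adjointable_graph_on[OF f] by blast
qed

end


section \<open>Regular operators\<close>

definition linear_relation :: "('e::complex_vector \<times> 'f::complex_vector) set \<Rightarrow> bool" where
  "linear_relation t \<longleftrightarrow> (0, 0) \<in> t \<and>
     (\<forall>x y x' y'. (x, y) \<in> t \<longrightarrow> (x', y') \<in> t \<longrightarrow> (x + x', y + y') \<in> t) \<and>
     (\<forall>c x y. (x, y) \<in> t \<longrightarrow> (c *\<^sub>C x, c *\<^sub>C y) \<in> t)"

lemma linear_relationD:
  assumes "linear_relation t"
  shows "(0, 0) \<in> t" "(x, y) \<in> t \<Longrightarrow> (x', y') \<in> t \<Longrightarrow> (x + x', y + y') \<in> t"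
    "(x, y) \<in> t \<Longrightarrow> (c *\<^sub>C x, c *\<^sub>C y) \<in> t"
    "(x, y) \<in> t \<Longrightarrow> (x', y') \<in> t \<Longrightarrow> (x - x', y - y') \<in> t"
    "(x, y) \<in> t \<Longrightarrow> (- x, - y) \<in> t"
proof -
  show 1: "(0, 0) \<in> t" and 2: "\<And>x y x' y'. (x, y) \<in> t \<Longrightarrow> (x', y') \<in> t \<Longrightarrow> (x + x', y + y') \<in> t"
    and 3: "\<And>c x y. (x, y) \<in> t \<Longrightarrow> (c *\<^sub>C x, c *\<^sub>C y) \<in> t"
    using assms unfolding linear_relation_def by blast+
  show 4: "\<And>x y. (x, y) \<in> t \<Longrightarrow> (- x, - y) \<in> t" using 3[of _ _ "-1"] by simp
  show "(x, y) \<in> t \<Longrightarrow> (x', y') \<in> t \<Longrightarrow> (x - x', y - y') \<in> t"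
    using 2[OF _ 4, of x y x' y'] by simp
qed

definition seq_closed :: "('a::cstar_algebra, 'e::complex_vector) hilbert_mod \<Rightarrow>
    ('a, 'f::complex_vector) hilbert_mod \<Rightarrow> ('e \<times> 'f) set \<Rightarrow> bool" where
  "seq_closed E F t \<longleftrightarrow>
     (\<forall>a b l m. (\<forall>n. (a n, b n) \<in> t) \<longrightarrow> hm_lim E a l \<longrightarrow> hm_lim F b m \<longrightarrow> (l, m) \<in> t)"

lemma seq_closedD:
  "seq_closed E F t \<Longrightarrow> hm_lim E a l \<Longrightarrow> hm_lim F b m \<Longrightarrow> (\<And>n. (a n, b n) \<in> t) \<Longrightarrow> (l, m) \<in> t"
  unfolding seq_closed_def by blast

context two_modules
begin

lemma op_closed_iff_seq_closed:
  assumes t: "t \<subseteq> hm_carrier E \<times> hm_carrier F"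
  shows "op_closed E F t \<longleftrightarrow> seq_closed E F t"
proof
  assume cl: "op_closed E F t"
  show "seq_closed E F t"
    unfolding seq_closed_def
  proof (intro allI impI)
    fix a b l m assume ab: "\<forall>n. (a n, b n) \<in> t" and a: "hm_lim E a l" and b: "hm_lim F b m"
    have "\<exists>(u, v)\<in>t. hm_norm E (l - u) < e \<and> hm_norm F (m - v) < e" if e: "e > 0" for e
    proof -
      have "\<forall>\<^sub>F n in sequentially. hm_norm E (a n - l) < e \<and> hm_norm F (b n - m) < e"
        using a b e by (intro eventually_conj order_tendstoD(2)[of _ 0]) (auto simp: hm_lim_def)
      then obtain n where "hm_norm E (a n - l) < e" "hm_norm F (b n - m) < e"
        by (auto simp: eventually_sequentially)
      then show ?thesis
        using ab E.norm_minus_commute[of l "a n"] F.norm_minus_commute[of m "b n"]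
          E.hm_limD[OF a] F.hm_limD[OF b] by (intro bexI[of _ "(a n, b n)"]) auto
    qed
    then show "(l, m) \<in> t"
      using cl E.hm_limD[OF a] F.hm_limD[OF b] unfolding op_closed_def by blast
  qed
next
  assume cl: "seq_closed E F t"
  show "op_closed E F t"
    unfolding op_closed_def
  proof (intro ballI impI)
    fix x y assume x: "x \<in> hm_carrier E" and y: "y \<in> hm_carrier F"
      and *: "\<forall>e>0. \<exists>(u, v)\<in>t. hm_norm E (x - u) < e \<and> hm_norm F (y - v) < e"
    have "\<exists>(u, v)\<in>t. hm_norm E (x - u) < 1 / real (Suc n) \<and> hm_norm F (y - v) < 1 / real (Suc n)" for n
      by (rule *[rule_format]) simp
    then have "\<forall>n. \<exists>u v. (u, v) \<in> t \<and> hm_norm E (x - u) < 1 / real (Suc n) \<and> hm_norm F (y - v) < 1 / real (Suc n)"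
      by blast
    then obtain u v where w: "\<And>n. (u n, v n) \<in> t" "\<And>n. hm_norm E (x - u n) < 1 / real (Suc n)"
      "\<And>n. hm_norm F (y - v n) < 1 / real (Suc n)"
      unfolding choice_iff by blast
    have lim0: "(\<lambda>n. 1 / real (Suc n)) \<longlonglongrightarrow> 0"
      using LIMSEQ_inverse_real_of_nat by (simp add: inverse_eq_divide)
    have wc: "u n \<in> hm_carrier E" "v n \<in> hm_carrier F" for n
      using w(1)[of n] t by auto
    have "hm_lim E u x"
      by (rule E.hm_lim_squeeze[OF wc(1) x _ lim0])
        (use w wc(1) x in \<open>simp add: E.norm_minus_commute[of _ x] less_imp_le\<close>)
    moreover have "hm_lim F v y"
      by (rule F.hm_lim_squeeze[OF wc(2) y _ lim0])
        (use w wc(2) y in \<open>simp add: F.norm_minus_commute[of _ y] less_imp_le\<close>)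
    ultimately show "(x, y) \<in> t" using seq_closedD[OF cl] w(1) by blast
  qed
qed

lemma op_adjoint_subset: "op_adjoint E F t \<subseteq> hm_carrier F \<times> hm_carrier E"
  by (auto simp: op_adjoint_def)

lemma op_adjointD:
  "(y, z) \<in> op_adjoint E F t \<Longrightarrow> (x, w) \<in> t \<Longrightarrow> hm_ip F w y = hm_ip E x z"
  by (auto simp: op_adjoint_def)

lemma op_adjointI:
  "y \<in> hm_carrier F \<Longrightarrow> z \<in> hm_carrier E \<Longrightarrow> (\<And>x w. (x, w) \<in> t \<Longrightarrow> hm_ip F w y = hm_ip E x z) \<Longrightarrow>
    (y, z) \<in> op_adjoint E F t"
  by (auto simp: op_adjoint_def)

lemma linear_relation_op_adjoint:
  assumes "t \<subseteq> hm_carrier E \<times> hm_carrier F"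
  shows "linear_relation (op_adjoint E F t)"
proof -
  have t: "x \<in> hm_carrier E" "w \<in> hm_carrier F" if "(x, w) \<in> t" for x w
    using that assms by auto
  show ?thesis
    unfolding linear_relation_def op_adjoint_def
    using t by (auto simp: E.ip_simps F.ip_simps split: prod.splits)
qed

lemma seq_closed_op_adjoint:
  assumes "t \<subseteq> hm_carrier E \<times> hm_carrier F"
  shows "seq_closed F E (op_adjoint E F t)"
  unfolding seq_closed_def
proof (intro allI impI)
  fix a b l m assume ab: "\<forall>n. (a n, b n) \<in> op_adjoint E F t" and a: "hm_lim F a l" and b: "hm_lim E b m"
  show "(l, m) \<in> op_adjoint E F t"
  proof (rule op_adjointI)
    fix x w assume xw: "(x, w) \<in> t"
    then have "x \<in> hm_carrier E" "w \<in> hm_carrier F" using assms by auto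
    moreover have "hm_ip F w (a n) = hm_ip E x (b n)" for n using ab xw op_adjointD by blast
    ultimately show "hm_ip F w l = hm_ip E x m"
      using LIMSEQ_unique[OF F.hm_lim_ip_right[OF a]] E.hm_lim_ip_right[OF b] by simp
  qed (use a b in \<open>auto simp: hm_lim_def\<close>)
qed

end

context cs_module
begin

lemma dense_approx:
  assumes "hm_dense E S" "S \<subseteq> hm_carrier E" "x \<in> hm_carrier E"
  obtains s where "\<And>n. s n \<in> S" "hm_lim E s x"
  using assms closure_iff_lim[OF assms(2), of x] unfolding hm_dense_def by blast

lemma ip_dense_eq_0:
  assumes S: "hm_dense E S" "S \<subseteq> hm_carrier E" and x: "x \<in> hm_carrier E"
    and 0: "\<And>y. y \<in> S \<Longrightarrow> hm_ip E x y = 0"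
  shows "x = 0"
proof -
  obtain s where s: "\<And>n. s n \<in> S" "hm_lim E s x" using dense_approx[OF S x] by blast
  have "hm_ip E x x = 0" using hm_lim_ip_right[OF s(2) x] 0[OF s(1)] by (simp add: LIMSEQ_const_iff)
  then show ?thesis using ip_definite[OF x] by simp
qed

lemma closure_add:
  assumes S: "S \<subseteq> hm_carrier E" "\<And>a b. a \<in> S \<Longrightarrow> b \<in> S \<Longrightarrow> a + b \<in> S"
    and x: "x \<in> hm_closure E S" and y: "y \<in> hm_closure E S"
  shows "x + y \<in> hm_closure E S"
proof -
  obtain s r where "\<And>n. s n \<in> S" "hm_lim E s x" "\<And>n. r n \<in> S" "hm_lim E r y"
    using x y unfolding closure_iff_lim[OF S(1)] by blast
  then show ?thesis using S(2) by (intro closure_limI[OF hm_lim_add]) auto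
qed

lemma closure_scaleC:
  assumes S: "S \<subseteq> hm_carrier E" "\<And>a. a \<in> S \<Longrightarrow> c *\<^sub>C a \<in> S" and x: "x \<in> hm_closure E S"
  shows "c *\<^sub>C x \<in> hm_closure E S"
proof -
  obtain s where "\<And>n. s n \<in> S" "hm_lim E s x"
    using x unfolding closure_iff_lim[OF S(1)] by blast
  then show ?thesis using S(2) by (intro closure_limI[OF hm_lim_scaleC]) auto
qed

lemma closure_mono_closure:
  assumes "S \<subseteq> hm_closure E S'" "S' \<subseteq> hm_carrier E"
  shows "hm_closure E S \<subseteq> hm_closure E S'"
proof
  fix x assume "x \<in> hm_closure E S"
  moreover have "S \<subseteq> hm_carrier E" using assms(1) closure_subset_carrier by blast
  ultimately obtain s where s: "\<And>n. s n \<in> S" "hm_lim E s x"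
    unfolding closure_iff_lim[OF \<open>S \<subseteq> hm_carrier E\<close>] by blast
  show "x \<in> hm_closure E S'"
    by (rule closure_limD[OF s(2) _ assms(2)]) (use s(1) assms(1) in blast)
qed

end

lemma (in two_modules) image_closure_subset:
  assumes f: "adj E F f g" and le: "\<And>x. x \<in> hm_carrier E \<Longrightarrow> hm_norm F (f x) \<le> hm_norm E x"
    and S: "S \<subseteq> hm_carrier E" "S' \<subseteq> hm_carrier F" "\<And>x. x \<in> S \<Longrightarrow> f x \<in> hm_closure F S'"
    and x: "x \<in> hm_closure E S"
  shows "f x \<in> hm_closure F S'"
proof -
  obtain s where s: "\<And>n. s n \<in> S" "hm_lim E s x"
    using x unfolding E.closure_iff_lim[OF S(1)] by blast
  show ?thesis
    by (rule F.closure_limD[OF lim_contraction[OF f le s(2)] _ S(2)]) (simp_all add: S(3) s(1))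
qed

text \<open>
  The setting is symmetric in \<open>t\<close> and \<open>s\<close>, so that each lemma below also holds with the roles exchanged. That
  is how the adjoint of an operator is treated on the same footing as the operator.
\<close>

locale formal_pair = two_hmodules E F
  for E :: "('a::cstar_algebra, 'e::complex_vector) hilbert_mod"
    and F :: "('a, 'f::complex_vector) hilbert_mod" +
  fixes t :: "('e \<times> 'f) set" and s :: "('f \<times> 'e) set"
  assumes t_sub: "t \<subseteq> hm_carrier E \<times> hm_carrier F" and s_sub: "s \<subseteq> hm_carrier F \<times> hm_carrier E"
    and t_lin: "linear_relation t" and s_lin: "linear_relation s"
    and formal: "(x, w) \<in> t \<Longrightarrow> (y, z) \<in> s \<Longrightarrow> hm_ip F w y = hm_ip E x z"
begin

lemma t_carrier: "(x, w) \<in> t \<Longrightarrow> x \<in> hm_carrier E" "(x, w) \<in> t \<Longrightarrow> w \<in> hm_carrier F"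
  and s_carrier: "(y, z) \<in> s \<Longrightarrow> y \<in> hm_carrier F" "(y, z) \<in> s \<Longrightarrow> z \<in> hm_carrier E"
  using t_sub s_sub by auto

lemmas t_rel = linear_relationD[OF t_lin] and s_rel = linear_relationD[OF s_lin]

lemma formal_pair_swap: "formal_pair F E s t"
proof -
  interpret FE: two_hmodules F E by (rule two_hmodules_sym) unfold_locales
  show ?thesis
  proof
    fix y z x w assume "(y, z) \<in> s" "(x, w) \<in> t"
    then show "hm_ip E z x = hm_ip F y w"
      using formal[of x w y z] t_carrier[of x w] s_carrier[of y z] E.ip_cstar[of x z] F.ip_cstar[of w y]
      by simp
  qed (fact t_sub s_sub t_lin s_lin)+
qed

text \<open>
  The inner square of \<open>x + s t x\<close> is the sum of those of \<open>x\<close> and \<open>s t x\<close> and of twice that of \<open>t x\<close>.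
\<close>

lemma bounds:
  assumes xw: "(x, w) \<in> t" and wz: "(w, z) \<in> s"
  shows "hm_norm E x \<le> hm_norm E (x + z)" "hm_norm F w \<le> hm_norm E (x + z)"
    "hm_norm E z \<le> hm_norm E (x + z)"
proof -
  note c [simp] = t_carrier[OF xw] s_carrier[OF wz]
  have xz: "hm_ip E x z = hm_ip F w w" using formal[OF xw wz] by simp
  then have zx: "hm_ip E z x = hm_ip F w w"
    using E.ip_cstar[OF c(1,4)] F.ip_cstar[OF c(2,2)] by simp
  have eq: "hm_ip E (x + z) (x + z) = hm_ip E x x + hm_ip F w w + (hm_ip F w w + hm_ip E z z)"
    by (simp add: E.ip_simps xz zx add.assoc)
  note pos [simp] = E.ip_apos[OF c(1)] E.ip_apos[OF c(4)] F.ip_apos[OF c(2)]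
  have "norm (hm_ip E x x) \<le> norm (hm_ip E x x + (hm_ip F w w + (hm_ip F w w + hm_ip E z z)))"
    by (intro apos_norm_le_add apos_add pos)
  then show "hm_norm E x \<le> hm_norm E (x + z)"
    unfolding hm_norm_def eq by (simp add: add_ac)
  have "norm (hm_ip F w w) \<le> norm (hm_ip F w w + (hm_ip E x x + (hm_ip F w w + hm_ip E z z)))"
    by (intro apos_norm_le_add apos_add pos)
  then show "hm_norm F w \<le> hm_norm E (x + z)"
    unfolding hm_norm_def eq by (simp add: add_ac)
  have "norm (hm_ip E z z) \<le> norm (hm_ip E z z + (hm_ip F w w + (hm_ip F w w + hm_ip E x x)))"
    by (intro apos_norm_le_add apos_add pos)
  then show "hm_norm E z \<le> hm_norm E (x + z)"
    unfolding hm_norm_def eq by (simp add: add_ac)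
qed

lemma unique:
  assumes "(x, w) \<in> t" "(w, u - x) \<in> s" "(x', w') \<in> t" "(w', u - x') \<in> s"
  shows "x = x'" "w = w'"
proof -
  have t: "(x - x', w - w') \<in> t" using t_rel(4)[OF assms(1,3)] .
  have s: "(w - w', x' - x) \<in> s" using s_rel(4)[OF assms(2,4)] by simp
  have "hm_norm E (x - x') = 0" "hm_norm F (w - w') = 0"
    using bounds[OF t s] E.norm_nonneg[of "x - x'"] F.norm_nonneg[of "w - w'"] by simp_all
  then show "x = x'" "w = w'"
    using E.norm_eq_0 F.norm_eq_0 t_carrier[OF t] by simp_all
qed

text \<open>
  The range of \<open>1 + s t\<close> is closed, because a preimage and its image under \<open>t\<close> are controlled by the value.
\<close>

lemma surj_limit:
  assumes cl: "seq_closed E F t" "seq_closed F E s"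
    and x: "\<And>n. (x n, w n) \<in> t" "\<And>n. (w n, u n - x n) \<in> s" and u: "hm_lim E u l"
  obtains x0 w0 where "(x0, w0) \<in> t" "(w0, l - x0) \<in> s"
proof -
  interpret EE: two_modules E E ..
  note t_c = t_carrier[OF x(1)]
  have le: "hm_norm E (x m - x n) \<le> hm_norm E (u m - u n)" "hm_norm F (w m - w n) \<le> hm_norm E (u m - u n)" for m n
    using bounds[OF t_rel(4)[OF x(1)[of m] x(1)[of n]] s_rel(4)[OF x(2)[of m] x(2)[of n]]] by simp_all
  obtain x0 where x0: "hm_lim E x x0" using EE.lim_transfer[OF u t_c(1) le(1)] by blast
  obtain w0 where w0: "hm_lim F w w0" using lim_transfer[OF u t_c(2) le(2)] by blast
  show ?thesis
    using that seq_closedD[OF cl(1) x0 w0 x(1)] seq_closedD[OF cl(2) w0 E.hm_lim_diff[OF u x0] x(2)] by blast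
qed

end

text \<open>
  A regular operator \<open>t\<close> together with \<open>s = t\<^sup>*\<close>, characterised symmetrically.
\<close>

locale graph_pair = formal_pair +
  assumes surj_E: "u \<in> hm_carrier E \<Longrightarrow> \<exists>x w. (x, w) \<in> t \<and> (w, u - x) \<in> s"
    and surj_F: "v \<in> hm_carrier F \<Longrightarrow> \<exists>y z. (y, z) \<in> s \<and> (z, v - y) \<in> t"
    and dense_t: "hm_dense E (Domain t)"
    and dense_s: "hm_dense F (Domain s)"

text \<open>
  Closedness of the range makes \<open>1 + t\<^sup>* t\<close> onto. For \<open>1 + t t\<^sup>*\<close> it suffices to reach the vectors \<open>v\<close> of the
  domain of \<open>t\<^sup>*\<close>, which is dense: if \<open>x + t\<^sup>* t x = t\<^sup>* v\<close>, then \<open>v - t x\<close> is a preimage of \<open>v\<close>.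
\<close>

theorem graph_pair_of_regular:
  assumes "hmodule E" "hmodule F" and reg: "regular_operator E F t"
  shows "graph_pair E F t (op_adjoint E F t)"
proof -
  interpret E: hmodule E by fact
  interpret F: hmodule F by fact
  interpret two_hmodules E F ..
  define s where "s = op_adjoint E F t"
  have sub: "t \<subseteq> hm_carrier E \<times> hm_carrier F" and lin: "linear_relation t"
    and dense: "hm_dense E (Domain t)" "hm_dense F (Domain s)" and cl0: "op_closed E F t"
    and range: "hm_dense E (Range (one_plus_adjoint_self E F t))"
    using reg unfolding regular_operator_def semiregular_def module_operator_def linear_relation_def s_def
    by blast+
  have cl: "seq_closed E F t" "seq_closed F E s"
    using cl0 op_closed_iff_seq_closed[OF sub] seq_closed_op_adjoint[OF sub] by (auto simp: s_def)
  interpret formal_pair E F t s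
    using sub lin op_adjoint_subset linear_relation_op_adjoint[OF sub] op_adjointD
    by unfold_locales (auto simp: s_def)
  interpret swap: formal_pair F E s t by (rule formal_pair_swap)
  have surj: "\<exists>x w. (x, w) \<in> t \<and> (w, u - x) \<in> s" if u: "u \<in> hm_carrier E" for u
  proof -
    have sub': "Range (one_plus_adjoint_self E F t) \<subseteq> hm_carrier E"
      using t_carrier s_carrier unfolding one_plus_adjoint_self_def s_def[symmetric] by auto
    obtain v where v: "\<And>n. v n \<in> Range (one_plus_adjoint_self E F t)" "hm_lim E v u"
      using E.dense_approx[OF range sub' u] by blast
    have "\<exists>x w. (x, w) \<in> t \<and> (w, v n - x) \<in> s" for n
      using v(1)[of n] unfolding one_plus_adjoint_self_def s_def[symmetric] by force
    then have "\<forall>n. \<exists>x w. (x, w) \<in> t \<and> (w, v n - x) \<in> s" by blast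
    then obtain x w where "\<And>n. (x n, w n) \<in> t" "\<And>n. (w n, v n - x n) \<in> s"
      unfolding choice_iff by blast
    from surj_limit[OF cl this v(2)] show ?thesis by blast
  qed
  have surj_dom: "\<exists>y z. (y, z) \<in> s \<and> (z, v - y) \<in> t" if v: "(v, z0) \<in> s" for v z0
  proof -
    obtain x w where xw: "(x, w) \<in> t" "(w, z0 - x) \<in> s" using surj[of z0] s_carrier[OF v] by blast
    then show ?thesis using s_rel(4)[OF v xw(2)] by (intro exI[of _ "v - w"] exI[of _ x]) simp
  qed
  have surj': "\<exists>y z. (y, z) \<in> s \<and> (z, v - y) \<in> t" if v: "v \<in> hm_carrier F" for v
  proof -
    obtain r where r: "\<And>n. r n \<in> Domain s" "hm_lim F r v"
      using F.dense_approx[OF dense(2) _ v] s_sub by blast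
    have "\<exists>y z. (y, z) \<in> s \<and> (z, r n - y) \<in> t" for n
      using r(1)[of n] surj_dom by blast
    then have "\<forall>n. \<exists>y z. (y, z) \<in> s \<and> (z, r n - y) \<in> t" by blast
    then obtain y z where "\<And>n. (y n, z n) \<in> s" "\<And>n. (z n, r n - y n) \<in> t"
      unfolding choice_iff by blast
    from swap.surj_limit[OF cl(2,1) this r(2)] show ?thesis by blast
  qed
  show ?thesis
    unfolding s_def[symmetric] using surj surj' dense by unfold_locales
qed

context graph_pair
begin

lemma graph_pair_swap: "graph_pair F E s t"
proof -
  interpret swap: formal_pair F E s t by (rule formal_pair_swap)
  show ?thesis using surj_E surj_F dense_t dense_s by unfold_locales
qed

text \<open>
  Given \<open>(y, z)\<close> in the adjoint of \<open>t\<close>, the matrix with rows \<open>(1, - s)\<close> and \<open>(t, 1)\<close> is onto, which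
  yields \<open>(w, b) \<in> s\<close> and \<open>(x, a) \<in> t\<close> with \<open>x - b = - z\<close> and \<open>a + w = y\<close>; then \<open>(a, - x)\<close> lies in the
  adjoint, so that the inner square of \<open>a\<close> is minus the one of \<open>x\<close>, and both vanish.
\<close>

lemma s_eq_adjoint: "s = op_adjoint E F t"
proof (intro equalityI subrelI)
  fix y z assume "(y, z) \<in> s"
  then show "(y, z) \<in> op_adjoint E F t"
    using s_carrier formal by (intro op_adjointI) auto
next
  fix y z assume yz: "(y, z) \<in> op_adjoint E F t"
  then have c: "y \<in> hm_carrier F" "z \<in> hm_carrier E" using op_adjoint_subset by auto
  obtain x1 a1 where 1: "(x1, a1) \<in> t" "(a1, - z - x1) \<in> s" using surj_E[of "- z"] c by auto
  obtain w2 b2 where 2: "(w2, b2) \<in> s" "(b2, y - w2) \<in> t" using surj_F[of y] c by auto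
  define x where "x = x1 + b2"
  define a where "a = a1 + (y - w2)"
  have xa: "(x, a) \<in> t" unfolding x_def a_def using t_rel(2)[OF 1(1) 2(2)] .
  have wb: "(y - a, z + x) \<in> s"
    using s_rel(4)[OF 2(1) 1(2)] by (simp add: a_def x_def algebra_simps)
  note cx = t_carrier[OF xa]
  have "hm_ip F a a = hm_ip F a y - hm_ip F a (y - a)" using c cx by (simp add: F.ip_simps)
  also have "\<dots> = hm_ip E x z - hm_ip E x (z + x)" using op_adjointD[OF yz xa] formal[OF xa wb] by simp
  also have "\<dots> = - hm_ip E x x" using c cx by (simp add: E.ip_simps)
  finally have "hm_ip E x x + hm_ip F a a = 0" by simp
  then have "x = 0" "a = 0" using ip_add_eq_0[OF cx] by simp_all
  with wb show "(y, z) \<in> s" by simp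
qed

lemma t_eq_adjoint: "t = op_adjoint F E s"
  using graph_pair.s_eq_adjoint[OF graph_pair_swap] .

lemma Domain_t_sub: "Domain t \<subseteq> hm_carrier E" and Domain_s_sub: "Domain s \<subseteq> hm_carrier F"
  and Range_t_sub: "Range t \<subseteq> hm_carrier F" and Range_s_sub: "Range s \<subseteq> hm_carrier E"
  using t_sub s_sub by auto

lemma t_single: 
  assumes "(x, w) \<in> t" "(x, w') \<in> t"
  shows "w = w'"
proof -
  have d: "(0, w - w') \<in> t" using t_rel(4)[OF assms] by simp
  have "w - w' = 0"
  proof (rule F.ip_dense_eq_0[OF dense_s Domain_s_sub])
    show "w - w' \<in> hm_carrier F" using t_carrier[OF d] by simp
    fix y assume "y \<in> Domain s"
    then obtain z where yz: "(y, z) \<in> s" by blast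
    show "hm_ip F (w - w') y = 0" using formal[OF d yz] s_carrier[OF yz] by simp
  qed
  then show ?thesis by simp
qed

lemma closed_t: "seq_closed E F t"
proof -
  interpret swap: formal_pair F E s t by (rule formal_pair_swap)
  show ?thesis by (subst t_eq_adjoint) (rule swap.seq_closed_op_adjoint[OF s_sub])
qed

theorem regular: "regular_operator E F t"
proof -
  interpret swap: formal_pair F E s t by (rule formal_pair_swap)
  have act: "(hm_act E x a, hm_act F w a) \<in> t" if xw: "(x, w) \<in> t" for x w a
  proof (subst t_eq_adjoint, rule swap.op_adjointI)
    fix y z assume yz: "(y, z) \<in> s"
    show "hm_ip E z (hm_act E x a) = hm_ip F y (hm_act F w a)"
      using swap.formal[OF yz xw] t_carrier[OF xw] s_carrier[OF yz]
      by (simp add: E.ip_act_right F.ip_act_right)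
  qed (use t_carrier[OF xw] in simp_all)
  have "Range (one_plus_adjoint_self E F t) = hm_carrier E"
  proof (intro equalityI subsetI)
    fix u assume "u \<in> Range (one_plus_adjoint_self E F t)"
    then show "u \<in> hm_carrier E"
      unfolding one_plus_adjoint_self_def s_eq_adjoint[symmetric] using t_carrier s_carrier by auto
  next
    fix u assume "u \<in> hm_carrier E"
    then obtain x w where "(x, w) \<in> t" "(w, u - x) \<in> s" using surj_E by blast
    then have "(x, x + (u - x)) \<in> one_plus_adjoint_self E F t"
      unfolding one_plus_adjoint_self_def s_eq_adjoint[symmetric] by blast
    then show "u \<in> Range (one_plus_adjoint_self E F t)" by auto
  qed
  then have "hm_dense E (Range (one_plus_adjoint_self E F t))"
    using E.closure_subset_carrier E.subset_closure by (fastforce simp: hm_dense_def)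
  then show ?thesis
    unfolding regular_operator_def semiregular_def module_operator_def s_eq_adjoint[symmetric]
      op_closed_iff_seq_closed[OF t_sub]
    using t_sub t_single t_rel(1-3) act dense_t dense_s closed_t
    by (auto simp: single_valued_def)
qed

end


section \<open>The bounded transform\<close>

text \<open>
  The operators \<open>(1 + s t)\<^sup>-\<^sup>1\<close> and \<open>t (1 + s t)\<^sup>-\<^sup>1\<close>. Stating them in terms of both relations
  makes the corresponding operators for the exchanged pair instances of the same definitions.
\<close>

definition resolvent :: "('e::complex_vector \<times> 'f) set \<Rightarrow> ('f \<times> 'e) set \<Rightarrow> 'e \<Rightarrow> 'e" where
  "resolvent t s u = (SOME x. \<exists>w. (x, w) \<in> t \<and> (w, u - x) \<in> s)"

definition resolvent_image :: "('e::complex_vector \<times> 'f) set \<Rightarrow> ('f \<times> 'e) set \<Rightarrow> 'e \<Rightarrow> 'f" where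
  "resolvent_image t s u = (SOME w. (resolvent t s u, w) \<in> t \<and> (w, u - resolvent t s u) \<in> s)"

context graph_pair
begin

abbreviation "R \<equiv> resolvent t s"
abbreviation "B \<equiv> resolvent_image t s"
abbreviation "R' \<equiv> resolvent s t"
abbreviation "B' \<equiv> resolvent_image s t"

lemma resolvent_rel:
  assumes "u \<in> hm_carrier E"
  shows "(R u, B u) \<in> t" "(B u, u - R u) \<in> s"
proof -
  have "\<exists>w. (R u, w) \<in> t \<and> (w, u - R u) \<in> s"
    unfolding resolvent_def using surj_E[OF assms] by (rule someI_ex)
  then have "(R u, B u) \<in> t \<and> (B u, u - R u) \<in> s"
    unfolding resolvent_image_def by (rule someI_ex)
  then show "(R u, B u) \<in> t" "(B u, u - R u) \<in> s" by auto
qed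

lemma resolvent_closed [simp]:
  "u \<in> hm_carrier E \<Longrightarrow> R u \<in> hm_carrier E" "u \<in> hm_carrier E \<Longrightarrow> B u \<in> hm_carrier F"
  using t_carrier[OF resolvent_rel(1)] by auto

lemma resolvent_eqI:
  assumes "(x, w) \<in> t" "(w, u - x) \<in> s"
  shows "R u = x" "B u = w"
proof -
  have u: "u \<in> hm_carrier E"
    using E.add_closed[OF t_carrier(1)[OF assms(1)] s_carrier(2)[OF assms(2)]] by simp
  show "R u = x" "B u = w" using unique[OF resolvent_rel[OF u] assms] by auto
qed

lemma resolvent_bounds:
  assumes "u \<in> hm_carrier E"
  shows "hm_norm E (R u) \<le> hm_norm E u" "hm_norm F (B u) \<le> hm_norm E u"
    "hm_norm E (u - R u) \<le> hm_norm E u"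
  using bounds[OF resolvent_rel[OF assms]] by simp_all

lemma ip_resolvent_image:
  assumes "u \<in> hm_carrier E" "v \<in> hm_carrier E"
  shows "hm_ip F (B u) (B v) = hm_ip E (R u) (v - R v)"
  using formal[OF resolvent_rel(1)[OF assms(1)] resolvent_rel(2)[OF assms(2)]] .

lemma resolvent_adj: "adj E E R R"
proof -
  have eq: "hm_ip E (R u) v = hm_ip E (R u) (R v) + hm_ip F (B u) (B v)"
    if "u \<in> hm_carrier E" "v \<in> hm_carrier E" for u v
    using that ip_resolvent_image[OF that] by (simp add: E.ip_simps)
  have "hm_ip E (R u) v = hm_ip E u (R v)" if u: "u \<in> hm_carrier E" and v: "v \<in> hm_carrier E" for u v
    using eq[OF u v] arg_cong[OF eq[OF v u], of cstar] u v
    by (simp add: cstar_add E.ip_cstar F.ip_cstar)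
  then show ?thesis by (simp add: adj_def)
qed

interpretation swap: graph_pair F E s t by (rule graph_pair_swap)

interpretation EE: two_hmodules E E ..

lemma resolvent_image_adj: "adj E F B B'"
proof -
  have "hm_ip F (B u) v = hm_ip E u (B' v)" if u: "u \<in> hm_carrier E" and v: "v \<in> hm_carrier F" for u v
  proof -
    have "hm_ip F (B u) (R' v) = hm_ip E (R u) (B' v)"
      using formal[OF resolvent_rel(1)[OF u] swap.resolvent_rel(1)[OF v]] .
    moreover have "hm_ip F (B u) (v - R' v) = hm_ip E (u - R u) (B' v)"
      using swap.formal[OF resolvent_rel(2)[OF u] swap.resolvent_rel(2)[OF v]] by simp
    ultimately show ?thesis using u v by (simp add: E.ip_simps F.ip_simps)
  qed
  then show ?thesis by (simp add: adj_def)
qed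

text \<open>
  The projection onto the graph of \<open>t\<close> sends \<open>(u, v)\<close> to \<open>(R u + B' v, B u + v - R' v)\<close>. The identities say that
  it fixes the elements of the graph.
\<close>

lemma resolvent_of_graph:
  assumes xw: "(x, w) \<in> t"
  shows "R' w = B x" "B' w = x - R x"
proof -
  have x: "x \<in> hm_carrier E" using t_carrier[OF xw] by blast
  have "(x - R x, w - B x) \<in> t" using t_rel(4)[OF xw resolvent_rel(1)[OF x]] .
  with resolvent_rel(2)[OF x] show "R' w = B x" "B' w = x - R x" by (intro swap.resolvent_eqI; simp)+
qed

end

context graph_pair
begin

interpretation swap: graph_pair F E s t by (rule graph_pair_swap)

interpretation EE: two_hmodules E E ..

lemma resolvent_lin:
  assumes "u \<in> hm_carrier E"
  shows "v \<in> hm_carrier E \<Longrightarrow> R (u + v) = R u + R v" "v \<in> hm_carrier E \<Longrightarrow> R (u - v) = R u - R v"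
    "R (c *\<^sub>C u) = c *\<^sub>C R u"
  using EE.adj_linear[OF resolvent_adj assms] by blast+

text \<open>
  On the domain of \<open>s\<close> this is the identity \<open>s (1 + t s)\<^sup>-\<^sup>1 = (1 + s t)\<^sup>-\<^sup>1 s\<close>.
\<close>

lemma resolvent_image_in_closure:
  assumes v: "v \<in> hm_carrier F"
  shows "B' v \<in> hm_closure E (R ` hm_carrier E)"
proof (rule swap.image_closure_subset[OF swap.resolvent_image_adj swap.resolvent_bounds(2) Domain_s_sub])
  show "v \<in> hm_closure F (Domain s)" using dense_s v by (simp add: hm_dense_def)
  show "B' x \<in> hm_closure E (R ` hm_carrier E)" if "x \<in> Domain s" for x
  proof -
    from that obtain z where z: "(x, z) \<in> s" by blast
    then have "B' x = R z" using swap.resolvent_of_graph(1)[OF z] by simp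
    moreover have "R ` hm_carrier E \<subseteq> hm_carrier E" by auto
    ultimately show ?thesis using s_carrier[OF z] E.subset_closure by blast
  qed
qed auto

text \<open>
  In a Hilbert module a self-adjoint injective operator need not have dense range. Here density follows
  from the decomposition of the graph: a vector of the domain of \<open>t\<close> is a value of \<open>R\<close> plus a value of
  \<open>B'\<close>, and the latter is a limit of values of \<open>R\<close>.
\<close>

lemma dense_range_resolvent: "hm_closure E (R ` hm_carrier E) = hm_carrier E"
proof -
  have sub: "R ` hm_carrier E \<subseteq> hm_carrier E" by auto
  have add: "a + b \<in> R ` hm_carrier E" if ab: "a \<in> R ` hm_carrier E" "b \<in> R ` hm_carrier E" for a b
  proof -
    from ab obtain u v where "u \<in> hm_carrier E" "v \<in> hm_carrier E" "a = R u" "b = R v" by blast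
    then show ?thesis by (intro image_eqI[of _ _ "u + v"]) (simp_all add: resolvent_lin)
  qed
  have "Domain t \<subseteq> hm_closure E (R ` hm_carrier E)"
  proof
    fix x assume "x \<in> Domain t"
    then obtain w where xw: "(x, w) \<in> t" by blast
    have "R x + B' w \<in> hm_closure E (R ` hm_carrier E)"
      using t_carrier[OF xw] E.subset_closure[OF sub]
      by (intro E.closure_add[OF sub add] resolvent_image_in_closure) auto
    then show "x \<in> hm_closure E (R ` hm_carrier E)" by (simp add: resolvent_of_graph[OF xw])
  qed
  then have "hm_closure E (Domain t) \<subseteq> hm_closure E (R ` hm_carrier E)"
    by (rule E.closure_mono_closure[OF _ sub])
  then show ?thesis using dense_t E.closure_subset_carrier by (auto simp: hm_dense_def)
qed

text \<open>The domain of \<open>s t\<close> is a core of \<open>t\<close>, so \<open>t\<close> has no more range, up to closure, than on it.\<close>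

lemma Range_t_in_closure: "Range t \<subseteq> hm_closure F (B ` hm_carrier E)"
proof
  fix w assume "w \<in> Range t"
  then obtain x where xw: "(x, w) \<in> t" by blast
  have sub: "B ` hm_carrier E \<subseteq> hm_carrier F" by auto
  have add: "a + b \<in> B ` hm_carrier E" if ab: "a \<in> B ` hm_carrier E" "b \<in> B ` hm_carrier E" for a b
  proof -
    from ab obtain u v where uv: "u \<in> hm_carrier E" "v \<in> hm_carrier E" "a = B u" "b = B v" by blast
    have "B (u + v) = B u + B v" using adj_linear(1)[OF resolvent_image_adj] uv by blast
    with uv show ?thesis by (intro image_eqI[of _ _ "u + v"]) simp_all
  qed
  interpret FF: two_hmodules F F ..
  have adj: "adj F F (\<lambda>y. y - R' y) (\<lambda>y. y - R' y)"
    using adjD[OF swap.resolvent_adj] by (simp add: adj_def F.ip_simps)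
  have "w - R' w \<in> hm_closure F (B ` hm_carrier E)"
  proof (rule FF.image_closure_subset[OF adj swap.resolvent_bounds(3) Domain_s_sub sub])
    show "w \<in> hm_closure F (Domain s)" using dense_s t_carrier[OF xw] by (simp add: hm_dense_def)
    show "y - R' y \<in> hm_closure F (B ` hm_carrier E)" if y: "y \<in> Domain s" for y
    proof -
      from y obtain z where z: "(y, z) \<in> s" by blast
      then show ?thesis
        using swap.resolvent_of_graph(2)[OF z] s_carrier[OF z] E.subset_closure F.subset_closure[OF sub]
        by (metis image_eqI subsetD)
    qed
  qed auto
  moreover have "B x \<in> hm_closure F (B ` hm_carrier E)"
    using t_carrier[OF xw] F.subset_closure[OF sub] by blast
  ultimately have "B x + (w - R' w) \<in> hm_closure F (B ` hm_carrier E)"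
    using F.closure_add[OF sub add] by blast
  then show "w \<in> hm_closure F (B ` hm_carrier E)" by (simp add: resolvent_of_graph[OF xw])
qed

end

context graph_pair
begin

interpretation swap: graph_pair F E s t by (rule graph_pair_swap)

interpretation EE: two_hmodules E E ..

lemma inverse_one_plus: "(one_plus_adjoint_self E F t)\<inverse> = graph_on E R"
proof -
  have "(x, u) \<in> one_plus_adjoint_self E F t \<longleftrightarrow> u \<in> hm_carrier E \<and> x = R u" for x u
  proof
    assume "(x, u) \<in> one_plus_adjoint_self E F t"
    then obtain z w where xw: "(x, w) \<in> t" and wz: "(w, z) \<in> s" and u: "u = x + z"
      unfolding one_plus_adjoint_self_def s_eq_adjoint[symmetric] by auto
    then show "u \<in> hm_carrier E \<and> x = R u"
      using t_carrier[OF xw] s_carrier[OF wz] resolvent_eqI(1)[OF xw, of u] by simp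
  next
    assume "u \<in> hm_carrier E \<and> x = R u"
    then have "(x, x + (u - x)) \<in> one_plus_adjoint_self E F t"
      using resolvent_rel[of u] unfolding one_plus_adjoint_self_def s_eq_adjoint[symmetric] by blast
    then show "(x, u) \<in> one_plus_adjoint_self E F t" by simp
  qed
  then show ?thesis by (auto simp: graph_on_iff set_eq_iff)
qed

text \<open>
  This is \<open>(1 + s t)\<^sup>-\<^sup>1\<^sup>/\<^sup>2\<close>.
\<close>

definition h :: "'b \<Rightarrow> 'b" where
  "h = sqrt_one_minus E (\<lambda>x. x - R x)"

lemma h_adj: "adj E E h h"
  and h_h: "x \<in> hm_carrier E \<Longrightarrow> h (h x) = R x"
  and op_sqrt_resolvent: "op_sqrt E (graph_on E R) = graph_on E h"
  unfolding h_def using E.op_sqrt_graph_on[OF resolvent_adj resolvent_bounds(3)] by blast+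

lemma h_closed [simp]: "x \<in> hm_carrier E \<Longrightarrow> h x \<in> hm_carrier E"
  by (rule adjD(1)[OF h_adj])

lemmas h_lin = EE.adj_linear[OF h_adj]

lemma h_contr:
  assumes x: "x \<in> hm_carrier E"
  shows "hm_norm E (h x) \<le> hm_norm E x"
proof (rule power2_le_imp_le)
  have "(hm_norm E (h x))\<^sup>2 = norm (hm_ip E x (R x))"
    using x by (simp add: E.norm_sq adjD(3)[OF h_adj] h_h)
  also have "\<dots> \<le> hm_norm E x * hm_norm E (R x)" using x by (intro E.Cauchy_Schwarz) auto
  also have "\<dots> \<le> (hm_norm E x)\<^sup>2"
    using resolvent_bounds(1)[OF x] by (simp add: power2_eq_square mult_left_mono)
  finally show "(hm_norm E (h x))\<^sup>2 \<le> (hm_norm E x)\<^sup>2" .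
qed simp

lemma dense_range_h:
  assumes "x \<in> hm_carrier E"
  obtains a where "\<And>n. a n \<in> hm_carrier E" "hm_lim E (\<lambda>n. h (a n)) x"
proof -
  have "x \<in> hm_closure E (R ` hm_carrier E)" using assms dense_range_resolvent by simp
  moreover have "R ` hm_carrier E \<subseteq> hm_carrier E" by auto
  ultimately obtain r where r: "\<And>n. r n \<in> R ` hm_carrier E" "hm_lim E r x"
    using E.closure_iff_lim by blast
  have "\<forall>n. \<exists>a. a \<in> hm_carrier E \<and> r n = h a"
  proof
    fix n
    obtain u where "u \<in> hm_carrier E" "r n = R u" using r(1) by blast
    then show "\<exists>a. a \<in> hm_carrier E \<and> r n = h a" by (intro exI[of _ "h u"]) (simp add: h_h)
  qed
  then obtain a where a: "\<forall>n. a n \<in> hm_carrier E \<and> r n = h (a n)" by (rule choice[THEN exE])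
  then have "r = (\<lambda>n. h (a n))" by auto
  with r(2) a show ?thesis using that by blast
qed

text \<open>
  The inner square of \<open>t R u\<close> is \<open>\<langle>R u, u - R u\<rangle>\<close>, which equals \<open>\<langle>h u, (1 - R) h u\<rangle>\<close>. Hence \<open>h u \<mapsto> t R u\<close> is
  contractive; its continuous extension is the bounded transform.
\<close>

lemma norm_resolvent_image:
  assumes u: "u \<in> hm_carrier E"
  shows "hm_norm F (B u) \<le> hm_norm E (h u)"
proof (rule power2_le_imp_le)
  have "h (u - R u) = h u - R (h u)"
    using u by (simp add: h_lin flip: h_h)
  then have "hm_ip F (B u) (B u) = hm_ip E (h u) (h u - R (h u))"
    using u by (simp add: ip_resolvent_image flip: h_h) (simp add: adjD(3)[OF h_adj])
  then have "(hm_norm F (B u))\<^sup>2 \<le> hm_norm E (h u) * hm_norm E (h u - R (h u))"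
    using u E.Cauchy_Schwarz[of "h u" "h u - R (h u)"] by (simp add: F.norm_sq)
  also have "\<dots> \<le> (hm_norm E (h u))\<^sup>2"
    using u resolvent_bounds(3)[of "h u"] by (simp add: power2_eq_square mult_left_mono)
  finally show "(hm_norm F (B u))\<^sup>2 \<le> (hm_norm E (h u))\<^sup>2" .
qed simp

lemma transform_exists:
  assumes v: "v \<in> hm_carrier E"
  shows "\<exists>w. (h v, w) \<in> t \<and> hm_norm F w \<le> hm_norm E v"
proof -
  obtain a where a: "\<And>n. a n \<in> hm_carrier E" "hm_lim E (\<lambda>n. h (a n)) v"
    using dense_range_h[OF v] by blast
  have le: "hm_norm F (B (a m) - B (a n)) \<le> hm_norm E (h (a m) - h (a n))" for m n
    using norm_resolvent_image[of "a m - a n"] a(1) by (simp add: h_lin adj_linear[OF resolvent_image_adj])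
  obtain w where w: "hm_lim F (\<lambda>n. B (a n)) w"
    using lim_transfer[OF a(2) _ le] a(1) by auto
  have "hm_lim E (\<lambda>n. h (h (a n))) (h v)" using EE.lim_contraction[OF h_adj h_contr a(2)] .
  moreover have "(h (h (a n)), B (a n)) \<in> t" for n using resolvent_rel(1)[OF a(1)] a(1) by (simp add: h_h)
  ultimately have "(h v, w) \<in> t" by (rule seq_closedD[OF closed_t _ w])
  moreover have "hm_norm F w \<le> hm_norm E v"
    by (rule LIMSEQ_le[OF F.hm_lim_norm[OF w] E.hm_lim_norm[OF a(2)]]) (use norm_resolvent_image a(1) in blast)
  ultimately show ?thesis by blast
qed

text \<open>
  The bounded transform \<open>t h\<close> as a function.
\<close>

definition f :: "'b \<Rightarrow> 'c" where
  "f v = (SOME w. (h v, w) \<in> t)"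

lemma f_rel: "v \<in> hm_carrier E \<Longrightarrow> (h v, f v) \<in> t"
  unfolding f_def by (rule someI_ex) (use transform_exists in blast)

lemma f_contr: "v \<in> hm_carrier E \<Longrightarrow> hm_norm F (f v) \<le> hm_norm E v"
  using transform_exists f_rel t_single by metis

lemma f_closed [simp]: "v \<in> hm_carrier E \<Longrightarrow> f v \<in> hm_carrier F"
  using t_carrier f_rel by blast

lemma bounded_transform_eq: "bounded_transform E F t = graph_on E f"
  unfolding bounded_transform_def inverse_one_plus op_sqrt_resolvent
proof -
  have "(v, w) \<in> graph_on E h O t \<longleftrightarrow> (v, w) \<in> graph_on E f" for v w
    using f_rel[of v] t_single[of "h v" w "f v"] by (auto simp: relcomp_unfold graph_on_iff)
  then show "graph_on E h O t = graph_on E f" by auto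
qed

lemma f_adjoint_on_Domain:
  assumes yz: "(y, z) \<in> s" and x: "x \<in> hm_carrier E"
  shows "hm_ip F (f x) y = hm_ip E x (h z)"
  using formal[OF f_rel[OF x] yz] adjD(3)[OF h_adj x s_carrier(2)[OF yz]] by simp

lemma norm_h_Range_s:
  assumes yz: "(y, z) \<in> s"
  shows "hm_norm E (h z) \<le> hm_norm F y"
proof (cases "hm_norm E (h z) = 0")
  case False
  note c = s_carrier[OF yz]
  have "(hm_norm E (h z))\<^sup>2 = norm (hm_ip F (f (h z)) y)"
    using c f_adjoint_on_Domain[OF yz, of "h z"] by (simp add: E.norm_sq)
  also have "\<dots> \<le> hm_norm F (f (h z)) * hm_norm F y" using c by (intro F.Cauchy_Schwarz) auto
  also have "\<dots> \<le> hm_norm E (h z) * hm_norm F y"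
    using c f_contr[of "h z"] by (intro mult_right_mono) auto
  finally show ?thesis
    using False E.norm_nonneg[of "h z"] by (auto simp: power2_eq_square mult_le_cancel_left)
qed simp

lemma f_adjoint_exists:
  assumes y: "y \<in> hm_carrier F"
  shows "\<exists>z\<in>hm_carrier E. \<forall>x\<in>hm_carrier E. hm_ip F (f x) y = hm_ip E x z"
proof -
  obtain r where r: "\<And>n. r n \<in> Domain s" "hm_lim F r y"
    using F.dense_approx[OF dense_s Domain_s_sub y] by blast
  then have "\<forall>n. \<exists>z. (r n, z) \<in> s" by blast
  then obtain z where "\<forall>n. (r n, z n) \<in> s" by (rule choice[THEN exE])
  then have z: "(r n, z n) \<in> s" for n by blast
  note c = s_carrier[OF z]
  have le: "hm_norm E (h (z m) - h (z n)) \<le> hm_norm F (r m - r n)" for m n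
    using norm_h_Range_s[OF s_rel(4)[OF z[of m] z[of n]]] c by (simp add: h_lin)
  obtain l where l: "hm_lim E (\<lambda>n. h (z n)) l"
    using swap.lim_transfer[OF r(2) _ le] c by auto
  have "hm_ip F (f x) y = hm_ip E x l" if x: "x \<in> hm_carrier E" for x
    using LIMSEQ_unique[OF F.hm_lim_ip_right[OF r(2), of "f x"]] E.hm_lim_ip_right[OF l x]
      f_adjoint_on_Domain[OF z x] x by simp
  then show ?thesis using E.hm_limD[OF l] by blast
qed

text \<open>
  The adjoint of the bounded transform, the continuous extension of \<open>h s\<close>.
\<close>

definition g :: "'c \<Rightarrow> 'b" where
  "g y = (SOME z. z \<in> hm_carrier E \<and> (\<forall>x\<in>hm_carrier E. hm_ip F (f x) y = hm_ip E x z))"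

lemma f_adj: "adj E F f g"
proof -
  have "g y \<in> hm_carrier E \<and> (\<forall>x\<in>hm_carrier E. hm_ip F (f x) y = hm_ip E x (g y))"
    if "y \<in> hm_carrier F" for y
    unfolding g_def by (rule someI_ex) (use f_adjoint_exists[OF that] in blast)
  then show ?thesis by (simp add: adj_def)
qed

lemma g_closed [simp]: "y \<in> hm_carrier F \<Longrightarrow> g y \<in> hm_carrier E"
  by (rule adjD(2)[OF f_adj])

lemma g_adj: "adj F E g f"
  by (rule adj_sym[OF f_adj])

lemma g_contr: "y \<in> hm_carrier F \<Longrightarrow> hm_norm E (g y) \<le> hm_norm F y"
  using adj_contraction[OF f_adj f_contr] .

lemma g_on_Domain:
  assumes yz: "(y, z) \<in> s"
  shows "g y = h z"
proof (rule E.ip_eqI)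
  note c = s_carrier[OF yz]
  show "g y \<in> hm_carrier E" "h z \<in> hm_carrier E" using c by simp_all
  show "hm_ip E x (g y) = hm_ip E x (h z)" if "x \<in> hm_carrier E" for x
    using f_adjoint_on_Domain[OF yz that] adjD(3)[OF f_adj that c(1)] by simp
qed

lemma f_h: "u \<in> hm_carrier E \<Longrightarrow> f (h u) = B u"
  using t_single f_rel[of "h u"] resolvent_rel(1)[of u] by (simp add: h_h)

lemma g_f:
  assumes x: "x \<in> hm_carrier E"
  shows "g (f x) = x - R x"
proof -
  obtain a where a: "\<And>n. a n \<in> hm_carrier E" "hm_lim E (\<lambda>n. h (a n)) x"
    using dense_range_h[OF x] by blast
  have "g (f (h (a n))) = h (a n) - R (h (a n))" for n
    using g_on_Domain[OF resolvent_rel(2)[OF a(1)]] a(1) by (simp add: f_h h_lin flip: h_h)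
  moreover have "hm_lim E (\<lambda>n. g (f (h (a n)))) (g (f x))"
    using swap.lim_contraction[OF g_adj g_contr lim_contraction[OF f_adj f_contr a(2)]] .
  moreover have "hm_lim E (\<lambda>n. h (a n) - R (h (a n))) (x - R x)"
    using E.hm_lim_diff[OF a(2) EE.lim_contraction[OF resolvent_adj resolvent_bounds(1) a(2)]] .
  ultimately show ?thesis using E.hm_lim_unique by simp
qed

text \<open>
  The modulus of the bounded transform, since \<open>g f = 1 - R\<close>.
\<close>

definition k :: "'b \<Rightarrow> 'b" where
  "k = sqrt_one_minus E (\<lambda>x. x - (x - R x))"

lemma k_adj: "adj E E k k" and k_k: "x \<in> hm_carrier E \<Longrightarrow> k (k x) = x - R x"
    and op_modulus_f: "op_modulus E F (graph_on E f) = graph_on E k"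
proof -
  have p: "adj E E (\<lambda>x. x - R x) (\<lambda>x. x - R x)"
    using adjD[OF resolvent_adj] by (simp add: adj_def E.ip_simps)
  have le: "hm_norm E (x - (x - R x)) \<le> hm_norm E x" if "x \<in> hm_carrier E" for x
    using resolvent_bounds(1)[OF that] by simp
  note * = E.op_sqrt_graph_on[OF p le]
  show "adj E E k k" "x \<in> hm_carrier E \<Longrightarrow> k (k x) = x - R x"
    unfolding k_def using *(1,2) by blast+
  have "graph_on E f O graph_on F g = graph_on E (\<lambda>x. g (f x))" by (rule graph_on_comp) simp
  also have "\<dots> = graph_on E (\<lambda>x. x - R x)" by (simp add: graph_on_eq_iff g_f)
  finally show "op_modulus E F (graph_on E f) = graph_on E k"
    unfolding op_modulus_def op_adjoint_graph_on[OF f_adj] k_def using *(3) by simp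
qed

text \<open>
  Both kernels are the fixed space of the resolvent.
\<close>

lemma ker_f: "{x \<in> hm_carrier E. f x = 0} = op_ker t"
proof (intro equalityI subsetI)
  fix x assume "x \<in> {x \<in> hm_carrier E. f x = 0}"
  then have x: "x \<in> hm_carrier E" and 0: "f x = 0" by auto
  have "x = R x" using g_f[OF x] swap.adj_linear(6)[OF g_adj F.zero_closed] by (simp add: 0)
  then have *: "(x, B x) \<in> t" "(B x, 0) \<in> s" using resolvent_rel[OF x] by simp_all
  have "hm_ip F (B x) (B x) = 0" using formal[OF *] x by simp
  then have "B x = 0" using F.ip_definite x by simp
  with * show "x \<in> op_ker t" by (simp add: op_ker_def)
next
  fix x assume "x \<in> op_ker t"
  then have x0: "(x, 0) \<in> t" by (simp add: op_ker_def)
  note x = t_carrier(1)[OF x0]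
  have "B' 0 = 0" using swap.adj_linear(6)[OF swap.resolvent_image_adj F.zero_closed] .
  then have "x = R x" using resolvent_of_graph(2)[OF x0] by simp
  then have "hm_ip F (f x) (f x) = 0" using adjD(3)[OF f_adj x f_closed[OF x]] g_f[OF x] x by simp
  then show "x \<in> {x \<in> hm_carrier E. f x = 0}" using x F.ip_definite by simp
qed

lemma closure_Range_f: "hm_closure F (f ` hm_carrier E) = hm_closure F (Range t)"
proof (intro equalityI F.closure_mono_closure)
  have "f ` hm_carrier E \<subseteq> Range t" using f_rel by blast
  then show "f ` hm_carrier E \<subseteq> hm_closure F (Range t)"
    using F.subset_closure[OF Range_t_sub] by blast
  have "B ` hm_carrier E \<subseteq> f ` hm_carrier E" by (auto simp flip: f_h)
  then have "hm_closure F (B ` hm_carrier E) \<subseteq> hm_closure F (f ` hm_carrier E)"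
    by (fastforce simp: hm_closure_def)
  then show "Range t \<subseteq> hm_closure F (f ` hm_carrier E)" using Range_t_in_closure by blast
qed (use Range_t_sub in auto)

text \<open>
  Both kernels are orthogonal complements of ranges that have the same closure.
\<close>

lemma ker_g: "{y \<in> hm_carrier F. g y = 0} = op_ker s"
proof (intro equalityI subsetI)
  fix y assume "y \<in> {y \<in> hm_carrier F. g y = 0}"
  then have y: "y \<in> hm_carrier F" and 0: "g y = 0" by auto
  have "hm_ip F w y = 0" if "(x, w) \<in> t" for x w
  proof -
    have "w \<in> hm_closure F (f ` hm_carrier E)"
      unfolding closure_Range_f using that F.subset_closure[OF Range_t_sub] by blast
    moreover have "f ` hm_carrier E \<subseteq> hm_carrier F" by auto
    ultimately obtain r where r: "\<And>n. r n \<in> f ` hm_carrier E" "hm_lim F r w"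
      using F.closure_iff_lim by blast
    have "hm_ip F (r n) y = 0" for n
      using r(1)[of n] adjD(3)[OF f_adj _ y] by (auto simp: 0)
    then show ?thesis using F.hm_lim_ip_left[OF r(2) y] by (simp add: LIMSEQ_const_iff)
  qed
  then have "(y, 0) \<in> op_adjoint E F t" using y t_carrier by (intro op_adjointI) auto
  then show "y \<in> op_ker s" by (simp add: op_ker_def s_eq_adjoint)
next
  fix y assume "y \<in> op_ker s"
  then have y0: "(y, 0) \<in> s" by (simp add: op_ker_def)
  then show "y \<in> {y \<in> hm_carrier F. g y = 0}"
    using g_on_Domain[OF y0] s_carrier[OF y0] h_lin(6)[OF E.zero_closed] by simp
qed

text \<open>
  The resolvent maps the range of \<open>s\<close> into itself, as \<open>R s = s (1 + t s)\<^sup>-\<^sup>1\<close>, and its square root inherits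
  the closed invariant subspace.
\<close>

lemma h_closure_Range_s:
  assumes "x \<in> hm_closure E (Range s)"
  shows "h x \<in> hm_closure E (Range s)"
proof -
  let ?M = "hm_closure E (Range s)"
  interpret y: contraction E "\<lambda>x. x - R x"
    using adjD[OF resolvent_adj] resolvent_bounds(3) by unfold_locales (simp_all add: adj_def E.ip_simps)
  have add: "a + b \<in> Range s" if "a \<in> Range s" "b \<in> Range s" for a b
    using that s_rel(2) by blast
  have scale: "c *\<^sub>C a \<in> Range s" if "a \<in> Range s" for a c
    using that s_rel(3) by blast
  have "closed_relation E {(x, x) | x. x \<in> ?M}"
    unfolding closed_relation_def
  proof (intro conjI allI impI)
    show "(0, 0) \<in> {(x, x) | x. x \<in> ?M}" using s_rel(1) E.subset_closure[OF Range_s_sub] by blast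
    fix r l r' m assume *: "\<forall>n. (r n, r' n) \<in> {(x, x) | x. x \<in> ?M}" "hm_lim E r l" "hm_lim E r' m"
    then have "r' = r" by auto
    then have "l = m" using *(2,3) E.hm_lim_unique by blast
    moreover have "l \<in> ?M" using * by (intro E.closure_limD[OF *(2) _ Range_s_sub]) auto
    ultimately show "(l, m) \<in> {(x, x) | x. x \<in> ?M}" by blast
  next
    show "{(x, x) | x. x \<in> ?M} \<subseteq> hm_carrier E \<times> hm_carrier E" using E.closure_subset_carrier by blast
  qed (use E.closure_add[OF Range_s_sub add] E.closure_scaleC[OF Range_s_sub scale] in auto)
  moreover have "x - R x \<in> ?M" if x: "x \<in> ?M" for x
  proof -
    have "R x \<in> ?M"
    proof (rule EE.image_closure_subset[OF resolvent_adj resolvent_bounds(1) Range_s_sub Range_s_sub _ x])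
      fix z assume "z \<in> Range s"
      then obtain y where y: "(y, z) \<in> s" by blast
      have "R z = B' y" using swap.resolvent_of_graph(1)[OF y] by simp
      then have "R z \<in> Range s" using swap.resolvent_rel(1)[of y] s_carrier[OF y] by auto
      then show "R z \<in> ?M" using E.subset_closure[OF Range_s_sub] by blast
    qed
    then have "(-1) *\<^sub>C R x \<in> ?M"
      using E.closure_scaleC[of "Range s" "-1" "R x"] Range_s_sub scale by blast
    then have "x + (-1) *\<^sub>C R x \<in> ?M"
      using E.closure_add[of "Range s" x "(-1) *\<^sub>C R x"] x Range_s_sub add by blast
    then show ?thesis by simp
  qed
  ultimately have "(h x, h x) \<in> {(x, x) | x. x \<in> ?M}"
    unfolding h_def using assms by (intro y.sqrt_rel) auto
  then show ?thesis by blast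
qed

text \<open>
  On the domain of \<open>s\<close> the operator \<open>g\<close> is \<open>h s\<close>, and \<open>h\<close> preserves the closed range of \<open>s\<close>. Conversely that
  closed range is generated by the values of \<open>R s = h (h s)\<close>, where \<open>h s\<close> again lies in it.
\<close>

lemma closure_Range_g: "hm_closure E (g ` hm_carrier F) = hm_closure E (Range s)"
proof (intro equalityI E.closure_mono_closure)
  have gsub: "g ` hm_carrier F \<subseteq> hm_carrier E" by auto
  have g_dom: "g y \<in> hm_closure E (Range s)" if "y \<in> Domain s" for y
    using that g_on_Domain h_closure_Range_s E.subset_closure[OF Range_s_sub] by fastforce
  show "g ` hm_carrier F \<subseteq> hm_closure E (Range s)"
  proof
    fix x assume "x \<in> g ` hm_carrier F"
    then obtain y where y: "y \<in> hm_carrier F" "x = g y" by blast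
    have y_cl: "y \<in> hm_closure F (Domain s)" using y dense_s by (simp add: hm_dense_def)
    show "x \<in> hm_closure E (Range s)"
      unfolding y(2) by (rule swap.image_closure_subset[OF g_adj g_contr Domain_s_sub Range_s_sub g_dom])
        (use y_cl in blast)+
  qed
  have h_in: "h z \<in> hm_closure E (g ` hm_carrier F)" if "z \<in> hm_closure E (Range s)" for z
  proof (rule EE.image_closure_subset[OF h_adj h_contr Range_s_sub gsub _ that])
    fix z assume "z \<in> Range s"
    then obtain y where y: "(y, z) \<in> s" by blast
    then have "h z \<in> g ` hm_carrier F" using g_on_Domain[OF y] s_carrier[OF y] by (metis image_eqI)
    then show "h z \<in> hm_closure E (g ` hm_carrier F)" using E.subset_closure[OF gsub] by blast
  qed
  have B'_dom: "B' y \<in> hm_closure E (g ` hm_carrier F)" if "y \<in> Domain s" for y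
  proof -
    from that obtain z where y: "(y, z) \<in> s" by blast
    have "B' y = h (h z)" using swap.resolvent_of_graph(1)[OF y] s_carrier[OF y] by (simp add: h_h)
    moreover have "h z \<in> hm_closure E (Range s)"
      using y E.subset_closure[OF Range_s_sub] by (intro h_closure_Range_s) blast
    ultimately show ?thesis using h_in by simp
  qed
  have "B' ` hm_carrier F \<subseteq> hm_closure E (g ` hm_carrier F)"
  proof
    fix x assume "x \<in> B' ` hm_carrier F"
    then obtain y where y: "y \<in> hm_carrier F" "x = B' y" by blast
    have y_cl: "y \<in> hm_closure F (Domain s)" using y dense_s by (simp add: hm_dense_def)
    show "x \<in> hm_closure E (g ` hm_carrier F)"
      unfolding y(2) by (rule swap.image_closure_subset[OF swap.resolvent_image_adj
            swap.resolvent_bounds(2) Domain_s_sub gsub B'_dom])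
        (use y_cl in blast)+
  qed
  then have "hm_closure E (B' ` hm_carrier F) \<subseteq> hm_closure E (g ` hm_carrier F)"
    by (rule E.closure_mono_closure[OF _ gsub])
  then show "Range s \<subseteq> hm_closure E (g ` hm_carrier F)" using swap.Range_t_in_closure by blast
qed (use Range_s_sub in auto)

text \<open>
  Polar decomposability transferred from the bounded transform to \<open>t\<close>: kernels and closed ranges of the
  transform and of its adjoint are those of \<open>t\<close> and \<open>s\<close>.
\<close>

theorem polar_decomposable_iff:
  "polar_decomposable E F t \<longleftrightarrow>
     spanned E (op_ker t) (hm_closure E (Range s)) \<and> spanned F (op_ker s) (hm_closure F (Range t))"
proof -
  interpret m: modulus E F f g k
    using f_adj f_contr k_adj k_k g_f by unfold_locales auto
  show ?thesis
    using m.adjointable_polar_decomposable_iff[OF op_modulus_f] regular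
    unfolding polar_decomposable_def bounded_transform_eq ker_f ker_g closure_Range_f closure_Range_g
    by simp
qed

end


section \<open>The Hodge decomposition degree by degree\<close>

context cs_module
begin

lemma orthogonal_closure:
  assumes S: "S \<subseteq> hm_carrier E" and x: "x \<in> hm_carrier E" and 0: "\<And>y. y \<in> S \<Longrightarrow> hm_ip E x y = 0"
    and y: "y \<in> hm_closure E S"
  shows "hm_ip E x y = 0"
proof -
  obtain s where s: "\<And>n. s n \<in> S" "hm_lim E s y"
    using y unfolding closure_iff_lim[OF S] by blast
  have "(\<lambda>n. 0) \<longlonglongrightarrow> hm_ip E x y" using hm_lim_ip_right[OF s(2) x] 0[OF s(1)] by simp
  then show ?thesis by (simp add: LIMSEQ_const_iff)
qed

lemma closure_sum_in_closure:
  assumes "P \<subseteq> hm_carrier E" "Q \<subseteq> hm_carrier E" "p \<in> hm_closure E P" "q \<in> hm_closure E Q"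
  shows "p + q \<in> hm_closure E {a + b | a b. a \<in> P \<and> b \<in> Q}"
proof -
  obtain s r where "\<And>n. s n \<in> P" "hm_lim E s p" "\<And>n. r n \<in> Q" "hm_lim E r q"
    using assms(3,4) unfolding closure_iff_lim[OF assms(1)] closure_iff_lim[OF assms(2)] by blast
  then show ?thesis by (intro closure_limI[OF hm_lim_add]) auto
qed

end

text \<open>For orthogonal summands the components of a convergent sequence converge.\<close>

lemma (in hmodule) closure_orthogonal_sum:
  assumes P: "P \<subseteq> hm_carrier E" "\<And>a b. a \<in> P \<Longrightarrow> b \<in> P \<Longrightarrow> a - b \<in> P"
    and Q: "Q \<subseteq> hm_carrier E" "\<And>a b. a \<in> Q \<Longrightarrow> b \<in> Q \<Longrightarrow> a - b \<in> Q"
    and orth: "\<And>a b. a \<in> P \<Longrightarrow> b \<in> Q \<Longrightarrow> hm_ip E a b = 0"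
    and x: "x \<in> hm_closure E {a + b | a b. a \<in> P \<and> b \<in> Q}"
  obtains p q where "p \<in> hm_closure E P" "q \<in> hm_closure E Q" "x = p + q"
proof -
  interpret EE: two_hmodules E E ..
  have "{a + b | a b. a \<in> P \<and> b \<in> Q} \<subseteq> hm_carrier E"
    using P(1) Q(1) by (blast intro: add_closed)
  then obtain s where s: "\<And>n. s n \<in> {a + b | a b. a \<in> P \<and> b \<in> Q}" "hm_lim E s x"
    using x closure_iff_lim by blast
  have "\<forall>n. \<exists>a. a \<in> P \<and> s n - a \<in> Q"
  proof
    fix n
    obtain a b where "a \<in> P" "b \<in> Q" "s n = a + b" using s(1)[of n] by blast
    then show "\<exists>a. a \<in> P \<and> s n - a \<in> Q" by (intro exI[of _ a]) simp
  qed
  then obtain a where "\<forall>n. a n \<in> P \<and> s n - a n \<in> Q" by (rule choice[THEN exE])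
  then have a: "a n \<in> P" "s n - a n \<in> Q" for n by auto
  have ac: "a n \<in> hm_carrier E" for n using a(1) P(1) by blast
  have le: "hm_norm E (a m - a n) \<le> hm_norm E (s m - s n)" for m n
  proof (rule power2_le_imp_le)
    define u where "u = a m - a n"
    define v where "v = (s m - a m) - (s n - a n)"
    have u: "u \<in> P" and v: "v \<in> Q" unfolding u_def v_def by (intro P(2) Q(2) a)+
    then have c: "u \<in> hm_carrier E" "v \<in> hm_carrier E" using P(1) Q(1) by auto
    have "hm_ip E v u = 0" using orth[OF u v] ip_cstar[OF c] by simp
    then have "hm_ip E (u + v) (u + v) = hm_ip E u u + hm_ip E v v"
      using c orth[OF u v] by (simp add: ip_simps)
    then have "(hm_norm E u)\<^sup>2 \<le> (hm_norm E (u + v))\<^sup>2"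
      using EE.norm_sq_le_ip_add[OF c] by (simp add: norm_sq)
    then show "(hm_norm E (a m - a n))\<^sup>2 \<le> (hm_norm E (s m - s n))\<^sup>2"
      by (simp add: u_def v_def)
  qed simp
  obtain p where p: "hm_lim E a p" using EE.lim_transfer[OF s(2) ac le] by blast
  have "p \<in> hm_closure E P" by (rule closure_limI[OF p a(1)])
  moreover have "x - p \<in> hm_closure E Q" by (rule closure_limI[OF hm_lim_diff[OF s(2) p] a(2)])
  ultimately show ?thesis using that[of p "x - p"] by simp
qed

context graph_pair
begin

lemma closure_in_ker:
  assumes S: "S \<subseteq> op_ker t" and x: "x \<in> hm_closure E S"
  shows "x \<in> op_ker t"
proof -
  have S0: "(y, 0) \<in> t" if "y \<in> S" for y using S that by (auto simp: op_ker_def)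
  then have "S \<subseteq> hm_carrier E" using t_carrier by blast
  then obtain r where r: "\<And>n. r n \<in> S" "hm_lim E r x"
    using x E.closure_iff_lim by blast
  have "(x, 0) \<in> t"
    by (rule seq_closedD[OF closed_t r(2) F.hm_lim_const[OF F.zero_closed]]) (rule S0[OF r(1)])
  then show ?thesis by (simp add: op_ker_def)
qed

lemma ker_orthogonal_closure_Range:
  assumes x: "x \<in> op_ker t" and y: "y \<in> hm_closure E (Range s)"
  shows "hm_ip E x y = 0"
proof (rule E.orthogonal_closure[OF Range_s_sub _ _ y])
  have x0: "(x, 0) \<in> t" using x by (simp add: op_ker_def)
  then show "x \<in> hm_carrier E" using t_carrier by blast
  fix z assume "z \<in> Range s"
  then obtain u where u: "(u, z) \<in> s" by blast
  show "hm_ip E x z = 0" using formal[OF x0 u] s_carrier[OF u] by simp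
qed

end

locale Hilbert_complex =
  fixes E :: "int \<Rightarrow> ('a::cstar_algebra, 'e::complex_vector) hilbert_mod"
    and t :: "int \<Rightarrow> ('e \<times> 'e) set"
  assumes hilbert_complex: "hilbert_complex E t"
begin

definition A :: "int \<Rightarrow> ('e \<times> 'e) set" where
  "A k = op_adjoint (E k) (E (k + 1)) (t k)"

lemma hm: "hmodule (E k)"
  using hilbert_complex hilbert_module_imp_hmodule by (auto simp: hilbert_complex_def)

lemma gp: "n = m + 1 \<Longrightarrow> graph_pair (E m) (E n) (t m) (A m)"
  using hilbert_complex graph_pair_of_regular[OF hm hm] by (simp add: hilbert_complex_def A_def)

lemma gp': "m = n + 1 \<Longrightarrow> graph_pair (E m) (E n) (A n) (t n)"
  using graph_pair.graph_pair_swap[OF gp] .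

lemma t_t: "(x, a) \<in> t m \<Longrightarrow> n = m + 1 \<Longrightarrow> (a, 0) \<in> t n"
proof -
  assume xa: "(x, a) \<in> t m" and n: "n = m + 1"
  have "Range (t m) \<subseteq> op_ker (t n)" unfolding n using hilbert_complex by (simp add: hilbert_complex_def)
  with xa show ?thesis by (auto simp: op_ker_def)
qed

lemma t_A_orthogonal:
  assumes xa: "(x, a) \<in> t m" and yb: "(y, b) \<in> A n" and n: "n = m + 1"
  shows "hm_ip (E n) a b = 0"
proof -
  interpret g: graph_pair "E n" "E (n + 1)" "t n" "A n" by (rule gp) simp
  show ?thesis using g.formal[OF t_t[OF xa n] yb] g.s_carrier[OF yb] by simp
qed

lemma A_A:
  assumes yb: "(y, b) \<in> A m" and m: "m = n + 1"
  shows "(b, 0) \<in> A n"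
proof -
  interpret g: graph_pair "E n" "E m" "t n" "A n" by (rule gp) (simp add: m)
  interpret g': graph_pair "E m" "E (m + 1)" "t m" "A m" by (rule gp) simp
  have "(b, 0) \<in> op_adjoint (E n) (E m) (t n)"
    using g'.s_carrier[OF yb] t_A_orthogonal[OF _ yb m] g.t_carrier by (intro g.op_adjointI) auto
  then show ?thesis by (simp add: g.s_eq_adjoint)
qed

definition harmonic :: "int \<Rightarrow> 'e set" where
  "harmonic m = op_ker (t m) \<inter> op_ker (A (m - 1))"

definition coexact :: "int \<Rightarrow> 'e set" where
  "coexact m = hm_closure (E m) (Range (A m))"

definition exact :: "int \<Rightarrow> 'e set" where
  "exact m = hm_closure (E m) (Range (t (m - 1)))"

definition Hodge :: "int \<Rightarrow> bool" where
  "Hodge m \<longleftrightarrow> (\<forall>x\<in>hm_carrier (E m). \<exists>a\<in>harmonic m. \<exists>b\<in>coexact m. \<exists>c\<in>exact m. x = a + b + c)"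

lemma coexact_in_ker: "coexact m \<subseteq> op_ker (A (m - 1))"
proof
  interpret g: graph_pair "E m" "E (m - 1)" "A (m - 1)" "t (m - 1)" by (rule gp') simp
  fix x assume "x \<in> coexact m"
  moreover have "Range (A m) \<subseteq> op_ker (A (m - 1))" using A_A by (auto simp: op_ker_def)
  ultimately show "x \<in> op_ker (A (m - 1))" using g.closure_in_ker by (simp add: coexact_def)
qed

lemma exact_in_ker: "exact m \<subseteq> op_ker (t m)"
proof
  interpret g: graph_pair "E m" "E (m + 1)" "t m" "A m" by (rule gp) simp
  fix x assume "x \<in> exact m"
  moreover have "Range (t (m - 1)) \<subseteq> op_ker (t m)" using t_t by (fastforce simp: op_ker_def)
  ultimately show "x \<in> op_ker (t m)" using g.closure_in_ker by (simp add: exact_def)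
qed

lemma orthogonal_parts:
  "orthogonal_sets (E m) (harmonic m) (coexact m)"
  "orthogonal_sets (E m) (harmonic m) (exact m)"
  "orthogonal_sets (E m) (coexact m) (exact m)"
proof -
  interpret g: graph_pair "E m" "E (m + 1)" "t m" "A m" by (rule gp) simp
  interpret g': graph_pair "E m" "E (m - 1)" "A (m - 1)" "t (m - 1)" by (rule gp') simp
  show "orthogonal_sets (E m) (harmonic m) (coexact m)"
    using g.ker_orthogonal_closure_Range by (auto simp: orthogonal_sets_def harmonic_def coexact_def)
  show "orthogonal_sets (E m) (harmonic m) (exact m)"
    using g'.ker_orthogonal_closure_Range by (auto simp: orthogonal_sets_def harmonic_def exact_def)
  show "orthogonal_sets (E m) (coexact m) (exact m)"
    using g'.ker_orthogonal_closure_Range coexact_in_ker by (auto simp: orthogonal_sets_def exact_def)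
qed

lemma parts_carrier:
  "op_ker (t m) \<subseteq> hm_carrier (E m)" "op_ker (A (m - 1)) \<subseteq> hm_carrier (E m)"
  "harmonic m \<subseteq> hm_carrier (E m)" "coexact m \<subseteq> hm_carrier (E m)" "exact m \<subseteq> hm_carrier (E m)"
proof -
  interpret g: graph_pair "E m" "E (m + 1)" "t m" "A m" by (rule gp) simp
  interpret g': graph_pair "E m" "E (m - 1)" "A (m - 1)" "t (m - 1)" by (rule gp') simp
  show "op_ker (t m) \<subseteq> hm_carrier (E m)" "op_ker (A (m - 1)) \<subseteq> hm_carrier (E m)"
    using g.t_carrier g'.t_carrier by (auto simp: op_ker_def)
  then show "harmonic m \<subseteq> hm_carrier (E m)" by (auto simp: harmonic_def)
  show "coexact m \<subseteq> hm_carrier (E m)" "exact m \<subseteq> hm_carrier (E m)"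
    by (auto simp: coexact_def exact_def hm_closure_def)
qed

lemma weak_Hodge_iff: "weak_Hodge_decomposition E t \<longleftrightarrow> (\<forall>m. Hodge m)"
proof -
  have "orthogonal_sum3 (E m) (harmonic m) (coexact m) (exact m) \<longleftrightarrow> Hodge m" for m
  proof -
    interpret hmodule "E m" by (rule hm)
    have "{x + y + z | x y z. x \<in> harmonic m \<and> y \<in> coexact m \<and> z \<in> exact m} \<subseteq> hm_carrier (E m)"
      using parts_carrier[of m] by (blast intro: add_closed)
    then have "hm_carrier (E m) = {x + y + z | x y z. x \<in> harmonic m \<and> y \<in> coexact m \<and> z \<in> exact m} \<longleftrightarrow>
        hm_carrier (E m) \<subseteq> {x + y + z | x y z. x \<in> harmonic m \<and> y \<in> coexact m \<and> z \<in> exact m}"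
      by blast
    also have "\<dots> \<longleftrightarrow> Hodge m"
      unfolding Hodge_def subset_iff mem_Collect_eq Bex_def Ball_def by meson
    finally show ?thesis
      unfolding orthogonal_sum3_def using orthogonal_parts by simp
  qed
  then show ?thesis
    by (simp add: weak_Hodge_decomposition_def harmonic_def coexact_def exact_def A_def)
qed

text \<open>
  In the first decomposition the kernel of \<open>t\<^sub>m\<close> collects the harmonic and the exact part, in the second
  the kernel of the adjoint collects the harmonic and the coexact part. Conversely, splitting the
  kernel component of the first by means of the second gives the three parts.
\<close>

lemma Hodge_iff_spanned:
  "Hodge m \<longleftrightarrow> spanned (E m) (op_ker (t m)) (coexact m) \<and> spanned (E m) (op_ker (A (m - 1))) (exact m)"
proof -
  interpret g: graph_pair "E m" "E (m + 1)" "t m" "A m" by (rule gp) simp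
  interpret g': graph_pair "E m" "E (m - 1)" "A (m - 1)" "t (m - 1)" by (rule gp') simp
  have add: "a + c \<in> op_ker (t m)" if "a \<in> op_ker (t m)" "c \<in> op_ker (t m)" for a c
    using g.t_rel(2)[of a 0 c 0] that by (simp add: op_ker_def)
  have diff: "a - c \<in> op_ker (t m)" if "a \<in> op_ker (t m)" "c \<in> op_ker (t m)" for a c
    using g.t_rel(4)[of a 0 c 0] that by (simp add: op_ker_def)
  have add': "a + c \<in> op_ker (A (m - 1))" if "a \<in> op_ker (A (m - 1))" "c \<in> op_ker (A (m - 1))" for a c
    using g'.t_rel(2)[of a 0 c 0] that by (simp add: op_ker_def)
  show ?thesis
  proof
    assume H: "Hodge m"
    have "\<exists>a\<in>op_ker (t m). \<exists>b\<in>coexact m. x = a + b" and "\<exists>a\<in>op_ker (A (m - 1)). \<exists>b\<in>exact m. x = a + b"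
      if x: "x \<in> hm_carrier (E m)" for x
    proof -
      obtain a b c where abc: "a \<in> harmonic m" "b \<in> coexact m" "c \<in> exact m" "x = a + b + c"
        using H x by (auto simp: Hodge_def)
      then have "a \<in> op_ker (t m)" "a \<in> op_ker (A (m - 1))" by (auto simp: harmonic_def)
      then have "a + c \<in> op_ker (t m)" "a + b \<in> op_ker (A (m - 1))"
        using add add' exact_in_ker coexact_in_ker abc by blast+
      moreover have "x = (a + c) + b" "x = (a + b) + c" using abc(4) by (simp_all add: algebra_simps)
      ultimately show "\<exists>a\<in>op_ker (t m). \<exists>b\<in>coexact m. x = a + b"
        and "\<exists>a\<in>op_ker (A (m - 1)). \<exists>b\<in>exact m. x = a + b"
        using abc(2,3) by blast+
    qed
    then show "spanned (E m) (op_ker (t m)) (coexact m) \<and> spanned (E m) (op_ker (A (m - 1))) (exact m)"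
      by (simp add: spanned_def)
  next
    assume *: "spanned (E m) (op_ker (t m)) (coexact m) \<and> spanned (E m) (op_ker (A (m - 1))) (exact m)"
    show "Hodge m"
      unfolding Hodge_def
    proof
      fix x assume x: "x \<in> hm_carrier (E m)"
      obtain a b where ab: "a \<in> op_ker (t m)" "b \<in> coexact m" "x = a + b"
        using * x by (auto simp: spanned_def)
      then have "a \<in> hm_carrier (E m)" using parts_carrier by blast
      then obtain c d where cd: "c \<in> op_ker (A (m - 1))" "d \<in> exact m" "a = c + d"
        using * by (auto simp: spanned_def)
      have "c = a - d" using cd(3) by simp
      then have "c \<in> op_ker (t m)" using diff[OF ab(1)] cd(2) exact_in_ker by blast
      then have "c \<in> harmonic m" using cd(1) by (simp add: harmonic_def)
      moreover have "x = c + b + d" using ab(3) cd(3) by (simp add: algebra_simps)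
      ultimately show "\<exists>a\<in>harmonic m. \<exists>b\<in>coexact m. \<exists>c\<in>exact m. x = a + b + c"
        using ab(2) cd(2) by blast
    qed
  qed
qed

text \<open>
  Polar decomposability of \<open>t\<^sub>k\<close> is one of the two decompositions in degree \<open>k\<close> and the other one in degree
  \<open>k + 1\<close>.
\<close>

theorem weak_Hodge_iff_polar:
  "weak_Hodge_decomposition E t \<longleftrightarrow> (\<forall>k. polar_decomposable (E k) (E (k + 1)) (t k))"
proof -
  have polar: "polar_decomposable (E k) (E (k + 1)) (t k) \<longleftrightarrow>
      spanned (E k) (op_ker (t k)) (coexact k) \<and> spanned (E (k + 1)) (op_ker (A k)) (exact (k + 1))" for k
  proof -
    interpret g: graph_pair "E k" "E (k + 1)" "t k" "A k" by (rule gp) simp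
    show ?thesis using g.polar_decomposable_iff by (simp add: coexact_def exact_def)
  qed
  show ?thesis
  proof
    assume "weak_Hodge_decomposition E t"
    then have "Hodge k" "Hodge (k + 1)" for k by (auto simp: weak_Hodge_iff)
    then show "\<forall>k. polar_decomposable (E k) (E (k + 1)) (t k)"
      using Hodge_iff_spanned polar by fastforce
  next
    assume *: "\<forall>k. polar_decomposable (E k) (E (k + 1)) (t k)"
    have "Hodge m" for m
      using *[rule_format, of m] *[rule_format, of "m - 1"] polar[of m] polar[of "m - 1"]
      by (simp add: Hodge_iff_spanned)
    then show "weak_Hodge_decomposition E t" by (simp add: weak_Hodge_iff)
  qed
qed

end


section \<open>Finite direct sums\<close>

text \<open>
  Away from the finite set \<open>J\<close> the summands vanish, so an element is any family of elements and
  convergence is entrywise.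
\<close>

locale direct_sum =
  fixes M :: "int \<Rightarrow> ('a::cstar_algebra, 'e::complex_vector) hilbert_mod" and J :: "int set"
  assumes M: "hmodule (M k)"
    and J: "finite J" and trivial: "k \<notin> J \<Longrightarrow> hm_carrier (M k) = {0}"
begin

abbreviation "S \<equiv> hm_direct_sum M"

lemma outside: "x k \<in> hm_carrier (M k) \<Longrightarrow> k \<notin> J \<Longrightarrow> x k = 0"
  using trivial by blast

lemma carrier_iff: "x \<in> hm_carrier S \<longleftrightarrow> (\<forall>k. x k \<in> hm_carrier (M k))"
proof -
  have "finite {k. x k \<noteq> 0}" if "\<forall>k. x k \<in> hm_carrier (M k)"
    using that outside by (intro finite_subset[OF _ J]) blast
  then show ?thesis by (auto simp: hm_direct_sum_def)
qed

lemma S_act: "hm_act S x a k = hm_act (M k) (x k) a"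
  by (simp add: hm_direct_sum_def)

lemma ip_eq_sum:
  assumes x: "x \<in> hm_carrier S" and y: "y \<in> hm_carrier S"
  shows "hm_ip S x y = (\<Sum>k\<in>J. hm_ip (M k) (x k) (y k))"
proof -
  have "hm_ip S x y = (\<Sum>k | x k \<noteq> 0 \<and> y k \<noteq> 0. hm_ip (M k) (x k) (y k))"
    by (simp add: hm_direct_sum_def)
  also have "\<dots> = (\<Sum>k\<in>J. hm_ip (M k) (x k) (y k))"
  proof (rule sum.mono_neutral_left[OF J])
    show "{k. x k \<noteq> 0 \<and> y k \<noteq> 0} \<subseteq> J" using x outside by (auto simp: carrier_iff)
    show "\<forall>k\<in>J - {k. x k \<noteq> 0 \<and> y k \<noteq> 0}. hm_ip (M k) (x k) (y k) = 0"
    proof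
      fix k assume "k \<in> J - {k. x k \<noteq> 0 \<and> y k \<noteq> 0}"
      then have "x k = 0 \<or> y k = 0" by blast
      moreover interpret hmodule "M k" by (rule M)
      have "x k \<in> hm_carrier (M k)" "y k \<in> hm_carrier (M k)" using x y by (auto simp: carrier_iff)
      ultimately show "hm_ip (M k) (x k) (y k) = 0" by auto
    qed
  qed
  finally show ?thesis .
qed

lemma support_ip:
  assumes "\<And>k. x k \<in> hm_carrier (M k)" "\<And>k. y k \<in> hm_carrier (M k)"
  shows "{k. hm_ip (M k) (x k) (y k) \<noteq> 0} \<subseteq> J"
proof
  fix k assume k: "k \<in> {k. hm_ip (M k) (x k) (y k) \<noteq> 0}"
  interpret hmodule "M k" by (rule M)
  show "k \<in> J" using k outside[of x k] assms[of k] by (cases "k \<in> J") auto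
qed

text \<open>
  This form of the inner product can be reindexed by shifts of the index.
\<close>

lemma ip_eq_Sum_any:
  assumes x: "x \<in> hm_carrier S" and y: "y \<in> hm_carrier S"
  shows "hm_ip S x y = Sum_any (\<lambda>k. hm_ip (M k) (x k) (y k))"
  unfolding ip_eq_sum[OF assms]
  using Sum_any.expand_superset[OF J support_ip, of x y] assms by (simp add: carrier_iff)

lemma apos_sum: "(\<And>k. k \<in> I \<Longrightarrow> apos (f k)) \<Longrightarrow> apos (\<Sum>k\<in>I. f k)"
  by (induction I rule: infinite_finite_induct) (simp_all add: apos_0 apos_add)

lemma comp_ip_apos:
  assumes "x \<in> hm_carrier S"
  shows "apos (hm_ip (M k) (x k) (x k))"
  using assms hmodule.ip_apos[OF M] by (simp add: carrier_iff)

lemma norm_comp_le: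
  assumes x: "x \<in> hm_carrier S"
  shows "hm_norm (M k) (x k) \<le> hm_norm S x"
proof (cases "k \<in> J")
  case True
  have "norm (hm_ip (M k) (x k) (x k)) \<le>
      norm (hm_ip (M k) (x k) (x k) + (\<Sum>k\<in>J - {k}. hm_ip (M k) (x k) (x k)))"
    by (intro apos_norm_le_add apos_sum comp_ip_apos x)
  then show ?thesis
    using sum.remove[OF J True, of "\<lambda>k. hm_ip (M k) (x k) (x k)"]
    by (simp add: hm_norm_def ip_eq_sum[OF x x])
next
  case False
  interpret hmodule "M k" by (rule M)
  have "x k = 0" using False outside x by (simp add: carrier_iff)
  then show ?thesis by (simp add: hm_norm_def[of S])
qed

lemma norm_le_sum:
  assumes x: "x \<in> hm_carrier S"
  shows "hm_norm S x \<le> (\<Sum>k\<in>J. hm_norm (M k) (x k))"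
proof -
  have "norm (hm_ip S x x) \<le> (\<Sum>k\<in>J. (hm_norm (M k) (x k))\<^sup>2)"
    unfolding ip_eq_sum[OF x x] by (rule order_trans[OF norm_sum]) (simp add: hm_norm_def)
  then have "hm_norm S x \<le> L2_set (\<lambda>k. hm_norm (M k) (x k)) J"
    unfolding hm_norm_def[of S] L2_set_def by (rule real_sqrt_le_mono)
  also have "\<dots> \<le> (\<Sum>k\<in>J. hm_norm (M k) (x k))"
    by (rule L2_set_le_sum) (simp add: hm_norm_def)
  finally show ?thesis .
qed

lemma S_pre_module: "pre_module S"
proof
  note Mp = hmodule.axioms(1)[OF M, THEN cs_module.axioms(1)]
  note [simp] = pre_module.zero_closed[OF Mp] pre_module.add_closed[OF Mp]
    pre_module.scaleC_closed[OF Mp] pre_module.act_closed[OF Mp]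
  show zero: "0 \<in> hm_carrier S" by (simp add: carrier_iff zero_fun_def)
  show add: "x + y \<in> hm_carrier S" if "x \<in> hm_carrier S" "y \<in> hm_carrier S" for x y
    using that by (simp add: carrier_iff plus_fun_def)
  show scale: "c *\<^sub>C x \<in> hm_carrier S" if "x \<in> hm_carrier S" for c x
    using that by (simp add: carrier_iff scaleC_fun_def)
  show act: "hm_act S x a \<in> hm_carrier S" if "x \<in> hm_carrier S" for a x
    using that by (simp add: carrier_iff S_act)
  have diff: "x - y \<in> hm_carrier S" if "x \<in> hm_carrier S" "y \<in> hm_carrier S" for x y
    using that pre_module.diff_closed[OF Mp] by (simp add: carrier_iff fun_diff_def)
  show "hm_ip S x (y + z) = hm_ip S x y + hm_ip S x z"
    if "x \<in> hm_carrier S" "y \<in> hm_carrier S" "z \<in> hm_carrier S" for x y z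
    using that add[OF that(2,3)] pre_module.ip_add_right[OF Mp]
    by (simp add: ip_eq_sum) (simp add: carrier_iff plus_fun_def sum.distrib)
  have sum_scaleC: "c *\<^sub>C (\<Sum>k\<in>J. f k) = (\<Sum>k\<in>J. c *\<^sub>C f k)" for c and f :: "int \<Rightarrow> 'a"
    by (rule cv.scale_sum_right)
  show "hm_ip S x (c *\<^sub>C y) = c *\<^sub>C hm_ip S x y"
    if "x \<in> hm_carrier S" "y \<in> hm_carrier S" for x y c
    using that scale[OF that(2)] pre_module.ip_scaleC_right[OF Mp]
    by (simp add: ip_eq_sum sum_scaleC) (simp add: carrier_iff scaleC_fun_def)
  show "hm_ip S x (hm_act S y a) = hm_ip S x y * a"
    if "x \<in> hm_carrier S" "y \<in> hm_carrier S" for x y a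
    using that act[OF that(2)] pre_module.ip_act_right[OF Mp]
    by (simp add: ip_eq_sum sum_distrib_right) (simp add: carrier_iff S_act)
  have cstar_sum: "cstar (\<Sum>k\<in>I. f k) = (\<Sum>k\<in>I. cstar (f k))" for I and f :: "int \<Rightarrow> 'a"
    by (induction I rule: infinite_finite_induct) (simp_all add: cstar_add)
  show "cstar (hm_ip S x y) = hm_ip S y x"
    if "x \<in> hm_carrier S" "y \<in> hm_carrier S" for x y
    using that pre_module.ip_cstar[OF Mp]
    by (simp add: ip_eq_sum cstar_sum) (simp add: carrier_iff)
  show "x = 0" if x: "x \<in> hm_carrier S" and 0: "hm_ip S x x = 0" for x
  proof
    fix k
    have "hm_norm (M k) (x k) \<le> 0" using norm_comp_le[OF x, of k] 0 by (simp add: hm_norm_def)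
    then have "hm_ip (M k) (x k) (x k) = 0" by (simp add: hm_norm_def)
    moreover have "x k \<in> hm_carrier (M k)" using x by (simp add: carrier_iff)
    ultimately have "x k = 0" by (rule pre_module.ip_definite[OF Mp, rotated])
    then show "x k = 0 k" by simp
  qed
  fix s :: "nat \<Rightarrow> int \<Rightarrow> 'e" assume s: "\<And>n. s n \<in> hm_carrier S"
    and Cauchy: "\<And>e. e > 0 \<Longrightarrow> \<exists>N. \<forall>m\<ge>N. \<forall>n\<ge>N. hm_norm S (s m - s n) < e"
  have "\<exists>l\<in>hm_carrier (M k). (\<lambda>n. hm_norm (M k) (s n k - l)) \<longlonglongrightarrow> 0" for k
  proof (rule pre_module.complete[OF Mp])
    show "s n k \<in> hm_carrier (M k)" for n using s by (simp add: carrier_iff)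
    fix e :: real assume "e > 0"
    then obtain N where N: "\<And>m n. m \<ge> N \<Longrightarrow> n \<ge> N \<Longrightarrow> hm_norm S (s m - s n) < e"
      using Cauchy by blast
    have "hm_norm (M k) (s m k - s n k) < e" if "m \<ge> N" "n \<ge> N" for m n
      using norm_comp_le[OF diff[OF s s], of k m n] N[OF that] by (simp add: fun_diff_def)
    then show "\<exists>N. \<forall>m\<ge>N. \<forall>n\<ge>N. hm_norm (M k) (s m k - s n k) < e" by blast
  qed
  then have "\<forall>k. \<exists>l. l \<in> hm_carrier (M k) \<and> (\<lambda>n. hm_norm (M k) (s n k - l)) \<longlonglongrightarrow> 0" by blast
  then obtain l where "\<forall>k. l k \<in> hm_carrier (M k) \<and> (\<lambda>n. hm_norm (M k) (s n k - l k)) \<longlonglongrightarrow> 0"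
    by (rule choice[THEN exE])
  then have l: "\<And>k. l k \<in> hm_carrier (M k)" "\<And>k. (\<lambda>n. hm_norm (M k) (s n k - l k)) \<longlonglongrightarrow> 0"
    by auto
  have lS: "l \<in> hm_carrier S" using l by (simp add: carrier_iff)
  have lim: "(\<lambda>n. \<Sum>k\<in>J. hm_norm (M k) ((s n - l) k)) \<longlonglongrightarrow> 0"
    using l(2) by (intro tendsto_null_sum) (simp add: fun_diff_def)
  have "(\<lambda>n. hm_norm S (s n - l)) \<longlonglongrightarrow> 0"
    by (rule tendsto_sandwich[OF _ _ tendsto_const lim])
      (use norm_le_sum[OF diff[OF s lS]] in \<open>simp_all add: hm_norm_def\<close>)
  with lS show "\<exists>l\<in>hm_carrier S. (\<lambda>n. hm_norm S (s n - l)) \<longlonglongrightarrow> 0" by blast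
qed

lemma S_hmodule: "hmodule S"
  by (rule hmoduleI[OF S_pre_module]) (simp add: ip_eq_sum apos_sum comp_ip_apos)

lemma hm_lim_iff: "hm_lim S s l \<longleftrightarrow> (\<forall>k. hm_lim (M k) (\<lambda>n. s n k) (l k))"
proof -
  interpret S: hmodule S by (rule S_hmodule)
  show ?thesis
  proof
    assume s: "hm_lim S s l"
    have "hm_lim (M k) (\<lambda>n. s n k) (l k)" for k
    proof -
      interpret hmodule "M k" by (rule M)
      show ?thesis
      proof (rule hm_lim_squeeze)
        show "(\<lambda>n. hm_norm S (s n - l)) \<longlonglongrightarrow> 0" using s by (simp add: hm_lim_def)
        show "hm_norm (M k) (s n k - l k) \<le> hm_norm S (s n - l)" for n
          using norm_comp_le[of "s n - l" k] S.hm_limD[OF s] by simp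
      qed (use S.hm_limD[OF s] in \<open>auto simp: carrier_iff\<close>)
    qed
    then show "\<forall>k. hm_lim (M k) (\<lambda>n. s n k) (l k)" by blast
  next
    assume s: "\<forall>k. hm_lim (M k) (\<lambda>n. s n k) (l k)"
    then have c: "s n \<in> hm_carrier S" "l \<in> hm_carrier S" for n
      by (auto simp: carrier_iff hm_lim_def)
    show "hm_lim S s l"
    proof (rule S.hm_lim_squeeze[OF c])
      show "hm_norm S (s n - l) \<le> (\<Sum>k\<in>J. hm_norm (M k) ((s n - l) k))" for n
        by (rule norm_le_sum) (simp add: c)
      show "(\<lambda>n. \<Sum>k\<in>J. hm_norm (M k) ((s n - l) k)) \<longlonglongrightarrow> 0"
        using s by (intro tendsto_null_sum) (simp add: fun_diff_def hm_lim_def)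
    qed
  qed
qed

lemma closure_componentwise:
  assumes T: "\<And>k. T k \<subseteq> hm_carrier (M k)" and x: "\<And>k. x k \<in> hm_closure (M k) (T k)"
  shows "x \<in> hm_closure S {y. \<forall>k. y k \<in> T k}"
proof -
  have "\<exists>s. (\<forall>n. s n \<in> T k) \<and> hm_lim (M k) s (x k)" for k
  proof -
    interpret hmodule "M k" by (rule M)
    show ?thesis using x[of k] closure_iff_lim[OF T] by blast
  qed
  then have "\<forall>k. \<exists>s. (\<forall>n. s n \<in> T k) \<and> hm_lim (M k) s (x k)" by blast
  then obtain s where s: "\<forall>k. (\<forall>n. s k n \<in> T k) \<and> hm_lim (M k) (s k) (x k)"
    by (rule choice[THEN exE])
  interpret S: hmodule S by (rule S_hmodule)
  show ?thesis
    by (rule S.closure_limI[of "\<lambda>n k. s k n"]) (use s in \<open>simp_all add: hm_lim_iff\<close>)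
qed

lemma closure_component:
  assumes T: "T \<subseteq> hm_carrier S" and x: "x \<in> hm_closure S T" and T': "\<And>y. y \<in> T \<Longrightarrow> y k \<in> T'"
  shows "x k \<in> hm_closure (M k) T'"
proof -
  interpret S: hmodule S by (rule S_hmodule)
  interpret hmodule "M k" by (rule M)
  obtain s where s: "\<And>n. s n \<in> T" "hm_lim S s x" using x S.closure_iff_lim[OF T] by blast
  show ?thesis by (rule closure_limI[of "\<lambda>n. s n k"]) (use s T' in \<open>simp_all add: hm_lim_iff\<close>)
qed

end


section \<open>The Dirac operator\<close>

context Hilbert_complex
begin

lemma t_carrier: "(x, a) \<in> t m \<Longrightarrow> x \<in> hm_carrier (E m)"
  "(x, a) \<in> t m \<Longrightarrow> n = m + 1 \<Longrightarrow> a \<in> hm_carrier (E n)"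
  using formal_pair.t_carrier[OF graph_pair.axioms(1)[OF gp]] by blast+

lemma A_carrier: "(y, b) \<in> A m \<Longrightarrow> b \<in> hm_carrier (E m)"
  "(y, b) \<in> A m \<Longrightarrow> n = m + 1 \<Longrightarrow> y \<in> hm_carrier (E n)"
  using formal_pair.s_carrier[OF graph_pair.axioms(1)[OF gp]] by blast+

lemma t_rel: "linear_relation (t m)"
  using formal_pair.t_lin[OF graph_pair.axioms(1)[OF gp]] by blast

lemma A_rel: "linear_relation (A m)"
  using formal_pair.s_lin[OF graph_pair.axioms(1)[OF gp]] by blast

lemmas t_linear = linear_relationD[OF t_rel] and A_linear = linear_relationD[OF A_rel]

text \<open>
  The products of \<open>t\<^sub>m\<^sup>* t\<^sub>m\<close> and \<open>t\<^sub>m\<^sub>-\<^sub>1 t\<^sub>m\<^sub>-\<^sub>1\<^sup>*\<close> vanish, so \<open>1\<close> plus their sum factors into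
  \<open>1 + t\<^sub>m\<^sub>-\<^sub>1 t\<^sub>m\<^sub>-\<^sub>1\<^sup>*\<close> and \<open>1 + t\<^sub>m\<^sup>* t\<^sub>m\<close>, which are both onto.
\<close>

lemma one_plus_Laplacian_surj:
  assumes u: "u \<in> hm_carrier (E m)"
  obtains x a b p q where "(x, a) \<in> t m" "(a, b) \<in> A m" "(x, p) \<in> A (m - 1)" "(p, q) \<in> t (m - 1)"
    "u = x + b + q"
proof -
  interpret g: graph_pair "E m" "E (m + 1)" "t m" "A m" by (rule gp) simp
  interpret g': graph_pair "E m" "E (m - 1)" "A (m - 1)" "t (m - 1)" by (rule gp') simp
  obtain w p where w: "(w, p) \<in> A (m - 1)" "(p, u - w) \<in> t (m - 1)" using g'.surj_E[OF u] by blast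
  obtain x a where x: "(x, a) \<in> t m" "(a, w - x) \<in> A m" using g.surj_E g'.t_carrier(1)[OF w(1)] by blast
  have "(w - x, 0) \<in> A (m - 1)" using A_A[OF x(2)] by simp
  from A_linear(4)[OF w(1) this] have "(x, p) \<in> A (m - 1)" by simp
  with w x show ?thesis by (intro that[of x a "w - x" p "u - w"]) simp_all
qed

text \<open>
  Apply first the resolvent of the adjoint map, then that of \<open>t\<^sub>m\<close>. The second changes a vector only by an
  element of the range of \<open>t\<^sub>m\<^sup>*\<close>, on which the adjoint map vanishes; and both have dense range.
\<close>

lemma dense_common_domain: "hm_dense (E m) (Domain (t m) \<inter> Domain (A (m - 1)))"
proof -
  interpret g: graph_pair "E m" "E (m + 1)" "t m" "A m" by (rule gp) simp
  interpret g': graph_pair "E m" "E (m - 1)" "A (m - 1)" "t (m - 1)" by (rule gp') simp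
  interpret two_hmodules "E m" "E m" ..
  let ?T = "Domain (t m) \<inter> Domain (A (m - 1))"
  have sub: "?T \<subseteq> hm_carrier (E m)" using g.Domain_t_sub by blast
  have sub': "g'.R ` hm_carrier (E m) \<subseteq> hm_carrier (E m)" by auto
  have T: "g.R w \<in> hm_closure (E m) ?T" if w: "w \<in> g'.R ` hm_carrier (E m)" for w
  proof -
    obtain v where v: "v \<in> hm_carrier (E m)" "w = g'.R v" using w by blast
    obtain p where p: "(w, p) \<in> A (m - 1)" using g'.resolvent_rel(1)[OF v(1)] v(2) by blast
    have wc: "w \<in> hm_carrier (E m)" using g'.t_carrier(1)[OF p] .
    have "(w - g.R w, 0) \<in> A (m - 1)" by (rule A_A[OF g.resolvent_rel(2)[OF wc]]) simp
    from A_linear(4)[OF p this] have "(g.R w, p) \<in> A (m - 1)" by simp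
    then have "g.R w \<in> ?T" using g.resolvent_rel(1)[OF wc] by blast
    then show ?thesis using g.E.subset_closure[OF sub] by blast
  qed
  have "g.R u \<in> hm_closure (E m) ?T" if u: "u \<in> hm_carrier (E m)" for u
    by (rule image_closure_subset[OF g.resolvent_adj g.resolvent_bounds(1) sub' sub T])
      (use u g'.dense_range_resolvent in auto)
  then have "g.R ` hm_carrier (E m) \<subseteq> hm_closure (E m) ?T" by blast
  then have "hm_closure (E m) (g.R ` hm_carrier (E m)) \<subseteq> hm_closure (E m) ?T"
    by (rule g.E.closure_mono_closure[OF _ sub])
  then show ?thesis
    using g.dense_range_resolvent g.E.closure_subset_carrier[of ?T] by (auto simp: hm_dense_def)
qed

definition dirac_module :: "int \<Rightarrow> ('a, int \<Rightarrow> 'e) hilbert_mod" where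
  "dirac_module c = hm_direct_sum (\<lambda>k. E (2 * k + c))"

text \<open>
  The part of the full Dirac operator \<open>t + t\<^sup>*\<close> that starts in the degrees congruent to \<open>c\<close> modulo
  \<open>2\<close>. In its source the entry \<open>k\<close> has degree \<open>2 k + c\<close>, in its target \<open>2 k + c + 1 + 2 j\<close>; thus the
  even operator is the case \<open>c = j = 0\<close> and the odd one the case \<open>c = 1\<close>, \<open>j = - 1\<close>.
\<close>

definition dirac :: "int \<Rightarrow> int \<Rightarrow> ((int \<Rightarrow> 'e) \<times> (int \<Rightarrow> 'e)) set" where
  "dirac c j = {(x, w). \<forall>l. \<exists>a b. (x (l + j), a) \<in> t (2 * (l + j) + c) \<and>
     (x (l + j + 1), b) \<in> A (2 * (l + j) + c + 1) \<and> w l = a + b}"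

lemma diracE:
  assumes "(x, w) \<in> dirac c j"
  obtains a b where "(x (l + j), a) \<in> t (2 * (l + j) + c)"
    "(x (l + j + 1), b) \<in> A (2 * (l + j) + c + 1)" "w l = a + b"
  using assms unfolding dirac_def mem_Collect_eq case_prod_conv by blast

lemma diracI:
  "(\<And>l. \<exists>a b. (x (l + j), a) \<in> t (2 * (l + j) + c) \<and>
      (x (l + j + 1), b) \<in> A (2 * (l + j) + c + 1) \<and> w l = a + b) \<Longrightarrow> (x, w) \<in> dirac c j"
  unfolding dirac_def mem_Collect_eq case_prod_conv by blast

abbreviation "dirac_reverse c j \<equiv> dirac (c + 1 + 2 * j) (- j - 1)"

text \<open>
  Here the values are listed by the index \<open>k\<close> of their degree \<open>2 k + c\<close>, which is the indexing of the source
  of \<open>dirac c j\<close>.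
\<close>

lemma dirac_reverse_iff:
  "(y, z) \<in> dirac_reverse c j \<longleftrightarrow>
    (\<forall>k. \<exists>a b. (y (k - j - 1), a) \<in> t (2 * k + c - 1) \<and> (y (k - j), b) \<in> A (2 * k + c) \<and> z k = a + b)"
proof -
  have "k + (- j - 1) = k - j - 1" "k - j - 1 + 1 = k - j"
    "2 * (k - j - 1) + (c + 1 + 2 * j) = 2 * k + c - 1" "2 * k + c - 1 + 1 = 2 * k + c" for k
    by (simp_all add: algebra_simps)
  then show ?thesis by (simp only: dirac_def mem_Collect_eq case_prod_conv)
qed

lemma linear_relation_dirac: "linear_relation (dirac c j)"
  unfolding linear_relation_def
proof (intro conjI allI impI)
  show "(0, 0) \<in> dirac c j"
    unfolding dirac_def using t_linear(1) A_linear(1) by (auto intro!: exI[of _ 0])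
next
  fix x w x' w' assume 1: "(x, w) \<in> dirac c j" and 2: "(x', w') \<in> dirac c j"
  have "\<exists>a b. ((x + x') (l + j), a) \<in> t (2 * (l + j) + c) \<and>
      ((x + x') (l + j + 1), b) \<in> A (2 * (l + j) + c + 1) \<and> (w + w') l = a + b" for l
  proof -
    obtain a b where ab: "(x (l + j), a) \<in> t (2 * (l + j) + c)"
      "(x (l + j + 1), b) \<in> A (2 * (l + j) + c + 1)" "w l = a + b" using 1 by (rule diracE)
    obtain a' b' where ab': "(x' (l + j), a') \<in> t (2 * (l + j) + c)"
      "(x' (l + j + 1), b') \<in> A (2 * (l + j) + c + 1)" "w' l = a' + b'" using 2 by (rule diracE)
    show ?thesis
      using t_linear(2)[OF ab(1) ab'(1)] A_linear(2)[OF ab(2) ab'(2)] ab(3) ab'(3)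
      by (intro exI[of _ "a + a'"] exI[of _ "b + b'"]) (simp add: plus_fun_def)
  qed
  then show "(x + x', w + w') \<in> dirac c j" by (rule diracI)
next
  fix r x w assume 1: "(x, w) \<in> dirac c j"
  have "\<exists>a b. ((r *\<^sub>C x) (l + j), a) \<in> t (2 * (l + j) + c) \<and>
      ((r *\<^sub>C x) (l + j + 1), b) \<in> A (2 * (l + j) + c + 1) \<and> (r *\<^sub>C w) l = a + b" for l
  proof -
    obtain a b where ab: "(x (l + j), a) \<in> t (2 * (l + j) + c)"
      "(x (l + j + 1), b) \<in> A (2 * (l + j) + c + 1)" "w l = a + b" using 1 by (rule diracE)
    show ?thesis
      using t_linear(3)[OF ab(1)] A_linear(3)[OF ab(2)] ab(3)
      by (intro exI[of _ "r *\<^sub>C a"] exI[of _ "r *\<^sub>C b"]) (simp add: scaleC_fun_def scaleC_add_right)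
  qed
  then show "(r *\<^sub>C x, r *\<^sub>C w) \<in> dirac c j" by (rule diracI)
qed

lemma dirac_components:
  assumes "(x, w) \<in> dirac c j"
  shows "x k \<in> hm_carrier (E (2 * k + c))" "w k \<in> hm_carrier (E (2 * k + (c + 1 + 2 * j)))"
proof -
  obtain a b where "(x (k - j + j), a) \<in> t (2 * (k - j + j) + c)"
    using assms by (rule diracE)
  then show "x k \<in> hm_carrier (E (2 * k + c))" using t_carrier(1) by simp
  obtain a b where ab: "(x (k + j), a) \<in> t (2 * (k + j) + c)"
    "(x (k + j + 1), b) \<in> A (2 * (k + j) + c + 1)" "w k = a + b" using assms by (rule diracE)
  have e: "2 * k + (c + 1 + 2 * j) = 2 * (k + j) + c + 1" by (simp add: algebra_simps)
  interpret hmodule "E (2 * (k + j) + c + 1)" by (rule hm)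
  show "w k \<in> hm_carrier (E (2 * k + (c + 1 + 2 * j)))"
    unfolding e ab(3) by (rule add_closed[OF t_carrier(2)[OF ab(1) refl] A_carrier(1)[OF ab(2)]])
qed

end

locale finite_complex = Hilbert_complex +
  fixes N :: int
  assumes trivial: "\<bar>k\<bar> > N \<Longrightarrow> hm_carrier (E k) = {0}"
begin

lemma direct_sum: "direct_sum (\<lambda>k. E (2 * k + c)) {k. \<bar>2 * k + c\<bar> \<le> N}"
proof (rule direct_sum.intro)
  show "hmodule (E (2 * k + c))" for k by (rule hm)
  have "{k. \<bar>2 * k + c\<bar> \<le> N} \<subseteq> {- (\<bar>N\<bar> + \<bar>c\<bar>)..\<bar>N\<bar> + \<bar>c\<bar>}" by auto
  then show "finite {k. \<bar>2 * k + c\<bar> \<le> N}" by (rule finite_subset) simp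
qed (use trivial in auto)

lemma dirac_hmodule: "hmodule (dirac_module c)"
  unfolding dirac_module_def by (rule direct_sum.S_hmodule[OF direct_sum])

lemma dirac_carrier: "x \<in> hm_carrier (dirac_module c) \<longleftrightarrow> (\<forall>k. x k \<in> hm_carrier (E (2 * k + c)))"
  unfolding dirac_module_def by (rule direct_sum.carrier_iff[OF direct_sum])

lemma dirac_subset: "dirac c j \<subseteq> hm_carrier (dirac_module c) \<times> hm_carrier (dirac_module (c + 1 + 2 * j))"
  using dirac_components by (auto simp: dirac_carrier)

lemma Sum_any_shift: "Sum_any (\<lambda>l::int. f (l + i)) = Sum_any (f :: int \<Rightarrow> 'a)"
proof (rule Sum_any.reindex_cong[of "\<lambda>l. l + i", symmetric])
  show "bij (\<lambda>l::int. l + i)" by (rule o_bij[of "\<lambda>l. l - i"]) auto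
qed auto

text \<open>
  Both sides expand into the same terms, with the index shifted by \<open>j\<close> and by \<open>j + 1\<close>.
\<close>

lemma dirac_formal:
  assumes xw: "(x, w) \<in> dirac c j" and yz: "(y, z) \<in> dirac_reverse c j"
  shows "hm_ip (dirac_module (c + 1 + 2 * j)) w y = hm_ip (dirac_module c) x z"
proof -
  let ?M = "\<lambda>c k. E (2 * k + c)"
  have "\<forall>l. \<exists>a b. (x (l + j), a) \<in> t (2 * (l + j) + c) \<and>
      (x (l + j + 1), b) \<in> A (2 * (l + j) + c + 1) \<and> w l = a + b"
    using diracE[OF xw] by blast
  then obtain a b where ab: "\<And>l. (x (l + j), a l) \<in> t (2 * (l + j) + c)"
    "\<And>l. (x (l + j + 1), b l) \<in> A (2 * (l + j) + c + 1)" "\<And>l. w l = a l + b l"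
    unfolding choice_iff by blast
  obtain a' b' where ab': "\<And>k. (y (k - j - 1), a' k) \<in> t (2 * k + c - 1)"
    "\<And>k. (y (k - j), b' k) \<in> A (2 * k + c)" "\<And>k. z k = a' k + b' k"
    using yz unfolding dirac_reverse_iff choice_iff by blast
  define f where "f k = hm_ip (?M c k) (x k) (b' k)" for k
  define g where "g k = hm_ip (?M c k) (x k) (a' k)" for k
  have xc: "x k \<in> hm_carrier (?M c k)" for k using dirac_components[OF xw] by blast
  have yc: "y k \<in> hm_carrier (?M (c + 1 + 2 * j) k)" for k using dirac_components[OF yz] by blast
  have a'c: "a' k \<in> hm_carrier (?M c k)" for k using t_carrier(2)[OF ab'(1)] by simp
  have b'c: "b' k \<in> hm_carrier (?M c k)" for k using A_carrier(1)[OF ab'(2)] .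
  have z: "hm_ip (?M c k) (x k) (z k) = f k + g k" for k
  proof -
    interpret hmodule "?M c k" by (rule hm)
    show ?thesis using xc a'c b'c unfolding ab'(3) f_def g_def
      by (simp only: ip_add_right) (rule add.commute)
  qed
  have w: "hm_ip (?M (c + 1 + 2 * j) l) (w l) (y l) = f (l + j) + g (l + j + 1)" for l
  proof -
    have e: "2 * l + (c + 1 + 2 * j) = 2 * (l + j) + c + 1" by (simp add: algebra_simps)
    interpret G: graph_pair "E (2 * (l + j) + c)" "E (2 * (l + j) + c + 1)" "t (2 * (l + j) + c)" "A (2 * (l + j) + c)"
      by (rule gp) simp
    interpret G': graph_pair "E (2 * (l + j + 1) + c)" "E (2 * (l + j) + c + 1)"
      "A (2 * (l + j) + c + 1)" "t (2 * (l + j) + c + 1)"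
      by (rule gp') simp
    have ya: "(y l, a' (l + j + 1)) \<in> t (2 * (l + j) + c + 1)" and yb: "(y l, b' (l + j)) \<in> A (2 * (l + j) + c)"
      using ab'(1)[of "l + j + 1"] ab'(2)[of "l + j"] by (simp_all add: algebra_simps)
    have "hm_ip (E (2 * (l + j) + c + 1)) (a l) (y l) = f (l + j)"
      using G.formal[OF ab(1) yb] by (simp add: f_def)
    moreover have "hm_ip (E (2 * (l + j) + c + 1)) (b l) (y l) = g (l + j + 1)"
      using G'.formal[OF ab(2) ya] by (simp add: g_def)
    ultimately show ?thesis
      unfolding e ab(3)
        G.F.ip_add_left[OF G'.s_carrier(1)[OF ya] G.t_carrier(2)[OF ab(1)] G'.t_carrier(2)[OF ab(2)]]
      by (simp only:)
  qed
  have fin: "finite {k. f k \<noteq> 0}" "finite {k. g k \<noteq> 0}"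
    unfolding f_def g_def
    using finite_subset[OF direct_sum.support_ip[OF direct_sum] direct_sum.J[OF direct_sum]] xc a'c b'c
    by blast+
  have inj: "inj (\<lambda>l. l + i)" for i :: int by (auto simp: inj_def)
  have fin': "finite {l. f (l + j) \<noteq> 0}" "finite {l. g (l + j + 1) \<noteq> 0}"
    using finite_vimageI[OF fin(1) inj[of j]] finite_vimageI[OF fin(2) inj[of "j + 1"]]
    by (simp_all add: vimage_def add.assoc)
  have shift: "Sum_any (\<lambda>l. g (l + j + 1)) = Sum_any g"
    using Sum_any_shift[of g "j + 1"] by (simp add: add.assoc)
  have wc: "w \<in> hm_carrier (hm_direct_sum (?M (c + 1 + 2 * j)))"
    and yc': "y \<in> hm_carrier (hm_direct_sum (?M (c + 1 + 2 * j)))"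
    and xc': "x \<in> hm_carrier (hm_direct_sum (?M c))" and zc: "z \<in> hm_carrier (hm_direct_sum (?M c))"
    using xw yz dirac_subset[of c j] dirac_subset[of "c + 1 + 2 * j" "- j - 1"]
    by (auto simp: dirac_module_def algebra_simps)
  have "hm_ip (dirac_module (c + 1 + 2 * j)) w y = Sum_any (\<lambda>l. f (l + j) + g (l + j + 1))"
    unfolding dirac_module_def direct_sum.ip_eq_Sum_any[OF direct_sum wc yc'] w ..
  also have "\<dots> = Sum_any f + Sum_any g"
    using Sum_any.distrib[OF fin'] by (simp add: Sum_any_shift shift)
  also have "\<dots> = hm_ip (dirac_module c) x z"
    unfolding dirac_module_def direct_sum.ip_eq_Sum_any[OF direct_sum xc' zc] z
    using Sum_any.distrib[OF fin] by simp
  finally show ?thesis .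
qed

text \<open>
  The square of the Dirac operator is the Laplacian in each degree, the mixed terms being zero.
\<close>

lemma dirac_surj:
  assumes u: "u \<in> hm_carrier (dirac_module c)"
  shows "\<exists>x w. (x, w) \<in> dirac c j \<and> (w, u - x) \<in> dirac_reverse c j"
proof -
  have "\<forall>k. \<exists>x a b p q. (x, a) \<in> t (2 * k + c) \<and> (a, b) \<in> A (2 * k + c) \<and>
      (x, p) \<in> A (2 * k + c - 1) \<and> (p, q) \<in> t (2 * k + c - 1) \<and> u k = x + b + q"
    using one_plus_Laplacian_surj u by (metis dirac_carrier)
  then obtain x a b p q where x: "\<And>k. (x k, a k) \<in> t (2 * k + c)" "\<And>k. (a k, b k) \<in> A (2 * k + c)"
    "\<And>k. (x k, p k) \<in> A (2 * k + c - 1)" "\<And>k. (p k, q k) \<in> t (2 * k + c - 1)"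
    and u_eq: "\<And>k. u k = x k + b k + q k"
    unfolding choice_iff by blast
  define w where "w l = a (l + j) + p (l + j + 1)" for l
  have "(x, w) \<in> dirac c j"
    unfolding dirac_def
  proof (intro CollectI case_prodI allI)
    fix l
    have "(x (l + j + 1), p (l + j + 1)) \<in> A (2 * (l + j) + c + 1)"
      using x(3)[of "l + j + 1"] by (simp add: algebra_simps)
    with x(1)[of "l + j"] show "\<exists>a b. (x (l + j), a) \<in> t (2 * (l + j) + c) \<and>
        (x (l + j + 1), b) \<in> A (2 * (l + j) + c + 1) \<and> w l = a + b"
      by (auto simp: w_def)
  qed
  moreover have "(w, u - x) \<in> dirac_reverse c j"
    unfolding dirac_reverse_iff
  proof
    fix k
    have "(a (k - 1), 0) \<in> t (2 * k + c - 1)"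
      by (rule t_t[OF x(1)]) (simp add: algebra_simps)
    from t_linear(2)[OF this x(4)] have 1: "(w (k - j - 1), q k) \<in> t (2 * k + c - 1)"
      by (simp add: w_def)
    have "(p (k + 1), 0) \<in> A (2 * k + c)"
      by (rule A_A[OF x(3)]) (simp add: algebra_simps)
    from A_linear(2)[OF x(2) this] have 2: "(w (k - j), b k) \<in> A (2 * k + c)"
      by (simp add: w_def)
    show "\<exists>a b. (w (k - j - 1), a) \<in> t (2 * k + c - 1) \<and> (w (k - j), b) \<in> A (2 * k + c) \<and> (u - x) k = a + b"
      using 1 2 by (intro exI[of _ "q k"] exI[of _ "b k"]) (simp add: u_eq)
  qed
  ultimately show ?thesis by blast
qed

lemma dirac_domain:
  assumes "\<And>k. x k \<in> Domain (t (2 * k + c)) \<inter> Domain (A (2 * k + c - 1))"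
  shows "x \<in> Domain (dirac c j)"
proof -
  have "\<exists>v a b. (x (l + j), a) \<in> t (2 * (l + j) + c) \<and> (x (l + j + 1), b) \<in> A (2 * (l + j) + c + 1) \<and> v = a + b" for l
  proof -
    have "2 * (l + j + 1) + c - 1 = 2 * (l + j) + c + 1" by (simp add: algebra_simps)
    then have "x (l + j + 1) \<in> Domain (A (2 * (l + j) + c + 1))" using assms[of "l + j + 1"] by (simp only: Int_iff)
    moreover have "x (l + j) \<in> Domain (t (2 * (l + j) + c))" using assms[of "l + j"] by blast
    ultimately show ?thesis by blast
  qed
  then obtain w where "(x, w) \<in> dirac c j"
    unfolding dirac_def mem_Collect_eq case_prod_conv by metis
  then show ?thesis by blast
qed

lemma dirac_dense: "hm_dense (dirac_module c) (Domain (dirac c j))"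
proof -
  interpret D: hmodule "dirac_module c" by (rule dirac_hmodule)
  let ?T = "\<lambda>k. Domain (t (2 * k + c)) \<inter> Domain (A (2 * k + c - 1))"
  have sub: "Domain (dirac c j) \<subseteq> hm_carrier (dirac_module c)" using dirac_subset by auto
  have T: "?T k \<subseteq> hm_carrier (E (2 * k + c))" for k using t_carrier(1) by auto
  have "x \<in> hm_closure (dirac_module c) (Domain (dirac c j))" if x: "x \<in> hm_carrier (dirac_module c)" for x
  proof -
    have "x k \<in> hm_closure (E (2 * k + c)) (?T k)" for k
      using x dense_common_domain[of "2 * k + c"] by (simp add: dirac_carrier hm_dense_def)
    then have "x \<in> hm_closure (dirac_module c) {y. \<forall>k. y k \<in> ?T k}"
      unfolding dirac_module_def by (rule direct_sum.closure_componentwise[OF direct_sum T])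
    moreover have "{y. \<forall>k. y k \<in> ?T k} \<subseteq> Domain (dirac c j)" using dirac_domain by blast
    ultimately show ?thesis by (fastforce simp: hm_closure_def)
  qed
  then show ?thesis using D.closure_subset_carrier by (auto simp: hm_dense_def)
qed

text \<open>
  The Dirac operator and its reverse enter symmetrically, so this shows at once that both are regular
  and adjoint to each other.
\<close>

theorem dirac_graph_pair:
  "graph_pair (dirac_module c) (dirac_module (c + 1 + 2 * j)) (dirac c j) (dirac_reverse c j)"
proof -
  interpret E: hmodule "dirac_module c" by (rule dirac_hmodule)
  interpret F: hmodule "dirac_module (c + 1 + 2 * j)" by (rule dirac_hmodule)
  have e: "c + 1 + 2 * j + 1 + 2 * (- j - 1) = c" "- (- j - 1) - 1 = j" by (simp_all add: algebra_simps)
  show ?thesis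
  proof
    show "dirac_reverse c j \<subseteq> hm_carrier (dirac_module (c + 1 + 2 * j)) \<times> hm_carrier (dirac_module c)"
      using dirac_subset[of "c + 1 + 2 * j" "- j - 1"] unfolding e .
    show "\<exists>y z. (y, z) \<in> dirac_reverse c j \<and> (z, v - y) \<in> dirac c j"
      if "v \<in> hm_carrier (dirac_module (c + 1 + 2 * j))" for v
      using dirac_surj[OF that, of "- j - 1"] unfolding e .
  qed (use dirac_subset linear_relation_dirac dirac_formal dirac_surj dirac_dense in blast)+
qed

text \<open>
  The two terms of a value of the Dirac operator are orthogonal, hence cancel only if both are zero.
\<close>

lemma ker_dirac_iff:
  "x \<in> op_ker (dirac c j) \<longleftrightarrow> (\<forall>k. x k \<in> harmonic (2 * k + c))"
proof
  assume x: "x \<in> op_ker (dirac c j)"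
  have "(x (l + j), 0) \<in> t (2 * (l + j) + c) \<and> (x (l + j + 1), 0) \<in> A (2 * (l + j) + c + 1)" for l
  proof -
    obtain a b where ab: "(x (l + j), a) \<in> t (2 * (l + j) + c)"
      "(x (l + j + 1), b) \<in> A (2 * (l + j) + c + 1)" "0 = a + b"
      using x diracE[of x 0 c j l] by (auto simp: op_ker_def)
    interpret hmodule "E (2 * (l + j) + c + 1)" by (rule hm)
    have a: "a \<in> hm_carrier (E (2 * (l + j) + c + 1))" using t_carrier(2)[OF ab(1)] by simp
    have b: "b = - a" using ab(3) by (simp add: add_eq_0_iff)
    have "hm_ip (E (2 * (l + j) + c + 1)) a b = 0" by (rule t_A_orthogonal[OF ab(1,2)]) simp
    then have "hm_ip (E (2 * (l + j) + c + 1)) a a = 0" unfolding b ip_minus_right[OF a a] by (simp only: neg_equal_0_iff_equal)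
    then have "a = 0" by (rule ip_definite[OF a])
    with ab b show ?thesis by simp
  qed
  note * = this
  show "\<forall>k. x k \<in> harmonic (2 * k + c)"
  proof
    fix k
    have "(x k, 0) \<in> t (2 * k + c)" using *[of "k - j"] by simp
    moreover have "(x k, 0) \<in> A (2 * k + c - 1)" using *[of "k - j - 1"] by (simp add: algebra_simps)
    ultimately show "x k \<in> harmonic (2 * k + c)" by (simp add: harmonic_def op_ker_def)
  qed
next
  assume x: "\<forall>k. x k \<in> harmonic (2 * k + c)"
  have "(x (l + j), 0) \<in> t (2 * (l + j) + c) \<and> (x (l + j + 1), 0) \<in> A (2 * (l + j) + c + 1)" for l
  proof -
    have "2 * (l + j + 1) + c - 1 = 2 * (l + j) + c + 1" by (simp add: algebra_simps)
    then have "x (l + j + 1) \<in> op_ker (A (2 * (l + j) + c + 1))"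
      using x[rule_format, of "l + j + 1"] by (simp only: harmonic_def Int_iff)
    moreover have "x (l + j) \<in> op_ker (t (2 * (l + j) + c))"
      using x[rule_format, of "l + j"] by (simp only: harmonic_def Int_iff)
    ultimately show ?thesis by (simp only: op_ker_def mem_Collect_eq)
  qed
  then show "x \<in> op_ker (dirac c j)" by (auto simp: op_ker_def dirac_def intro!: exI[of _ 0])
qed

text \<open>
  Decompose a vector of one degree, placed in a single entry, and read off that entry. A limit of sums of
  exact and coexact elements splits into two limits because the summands are orthogonal.
\<close>

lemma spanned_imp_Hodge:
  assumes sp: "spanned (dirac_module c) (op_ker (dirac c j))
      (hm_closure (dirac_module c) (Range (dirac_reverse c j)))"
  shows "Hodge (2 * k + c)"
  unfolding Hodge_def
proof
  fix x assume x: "x \<in> hm_carrier (E (2 * k + c))"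
  let ?P = "Range (t (2 * k + c - 1))" and ?Q = "Range (A (2 * k + c))"
  interpret hmodule "E (2 * k + c)" by (rule hm)
  have zero: "0 \<in> hm_carrier (E m)" for m using pre_module.zero_closed hm hmodule_def cs_module_def by metis
  have "(\<lambda>i. if i = k then x else 0) \<in> hm_carrier (dirac_module c)"
    using x zero by (simp add: dirac_carrier)
  then obtain a r where a: "a \<in> op_ker (dirac c j)"
    and r: "r \<in> hm_closure (dirac_module c) (Range (dirac_reverse c j))"
    and eq: "(\<lambda>i. if i = k then x else 0) = a + r"
    using sp unfolding spanned_def by blast
  have xk: "x = a k + r k" using fun_cong[OF eq, of k] by simp
  have sub: "Range (dirac_reverse c j) \<subseteq> hm_carrier (dirac_module c)"
    using dirac_subset[of "c + 1 + 2 * j" "- j - 1"] by (auto simp: algebra_simps)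
  have rk: "r k \<in> hm_closure (E (2 * k + c)) {p + q | p q. p \<in> ?P \<and> q \<in> ?Q}"
  proof (rule direct_sum.closure_component[OF direct_sum sub[unfolded dirac_module_def] r[unfolded dirac_module_def]])
    fix z assume "z \<in> Range (dirac_reverse c j)"
    then obtain y where "(y, z) \<in> dirac_reverse c j" by blast
    then show "z k \<in> {p + q | p q. p \<in> ?P \<and> q \<in> ?Q}" unfolding dirac_reverse_iff by blast
  qed
  have P: "?P \<subseteq> hm_carrier (E (2 * k + c))" using t_carrier(2) by fastforce
  have Q: "?Q \<subseteq> hm_carrier (E (2 * k + c))" using A_carrier(1) by auto
  have P_diff: "a - b \<in> ?P" if "a \<in> ?P" "b \<in> ?P" for a b using that t_linear(4) by blast
  have Q_diff: "a - b \<in> ?Q" if "a \<in> ?Q" "b \<in> ?Q" for a b using that A_linear(4) by blast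
  have orth: "hm_ip (E (2 * k + c)) a b = 0" if "a \<in> ?P" "b \<in> ?Q" for a b
    using that t_A_orthogonal by fastforce
  obtain p q where pq: "p \<in> hm_closure (E (2 * k + c)) ?P" "q \<in> hm_closure (E (2 * k + c)) ?Q" "r k = p + q"
    using closure_orthogonal_sum[OF P P_diff Q Q_diff orth rk] by blast
  have "a k \<in> harmonic (2 * k + c)" using a by (simp add: ker_dirac_iff)
  moreover have "x = a k + q + p" using xk pq(3) by (simp add: algebra_simps)
  ultimately show "\<exists>a\<in>harmonic (2 * k + c). \<exists>b\<in>coexact (2 * k + c). \<exists>e\<in>exact (2 * k + c). x = a + b + e"
    using pq(1,2) unfolding coexact_def exact_def by blast
qed

text \<open>
  A value of \<open>t\<close> or of \<open>t\<^sup>*\<close> is already taken on the kernel of the other map leaving the same degree: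
  drop the other two components of the argument.
\<close>

lemma Hodge_imp_exact_lift:
  assumes H: "Hodge m" and a: "(x, a) \<in> t m"
  obtains p where "(p, a) \<in> t m" "(p, 0) \<in> A (m - 1)"
proof -
  obtain h b e where *: "h \<in> harmonic m" "b \<in> coexact m" "e \<in> exact m" "x = h + b + e"
    using H t_carrier(1)[OF a] unfolding Hodge_def by blast
  have "(h, 0) \<in> t m" "(e, 0) \<in> t m" "(b, 0) \<in> A (m - 1)"
    using * exact_in_ker[of m] coexact_in_ker[of m] by (auto simp: harmonic_def op_ker_def)
  moreover have "(x - h - e, a - 0 - 0) \<in> t m" using a calculation by (intro t_linear(4))
  moreover have "x - h - e = b" using *(4) by simp
  ultimately show ?thesis using that by simp
qed

lemma Hodge_imp_coexact_lift:
  assumes H: "Hodge n" and b: "(y, b) \<in> A m" and n: "n = m + 1"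
  obtains q where "(q, b) \<in> A m" "(q, 0) \<in> t n"
proof -
  obtain h u e where *: "h \<in> harmonic n" "u \<in> coexact n" "e \<in> exact n" "y = h + u + e"
    using H A_carrier(2)[OF b n] unfolding Hodge_def by blast
  have "(h, 0) \<in> A m" "(e, 0) \<in> t n" "(u, 0) \<in> A m"
    using * exact_in_ker[of n] coexact_in_ker[of n] n by (auto simp: harmonic_def op_ker_def)
  moreover have "(y - h - u, b - 0 - 0) \<in> A m" using b calculation by (intro A_linear(4))
  moreover have "y - h - u = e" using *(4) by simp
  ultimately show ?thesis using that by simp
qed

text \<open>
  Each entry of the preimage has to produce an exact element one degree up and a coexact element one
  degree down. Preimages of these two in the appropriate kernels do not interfere when added.
\<close>

lemma Range_dirac_reverse:
  assumes H: "\<And>m. Hodge m"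
    and z: "\<And>k. z k \<in> {a + b | a b. a \<in> Range (t (2 * k + c - 1)) \<and> b \<in> Range (A (2 * k + c))}"
  shows "z \<in> Range (dirac_reverse c j)"
proof -
  have "\<exists>p a q b. (p, a) \<in> t (2 * k + c - 1) \<and> (p, 0) \<in> A (2 * k + c - 1 - 1) \<and>
      (q, b) \<in> A (2 * k + c) \<and> (q, 0) \<in> t (2 * k + c + 1) \<and> z k = a + b" for k
  proof -
    obtain a b x y where ab: "(x, a) \<in> t (2 * k + c - 1)" "(y, b) \<in> A (2 * k + c)" "z k = a + b"
      using z[of k] by blast
    then show ?thesis using Hodge_imp_exact_lift[OF H ab(1)] Hodge_imp_coexact_lift[OF H ab(2) refl] by metis
  qed
  then have "\<forall>k. \<exists>p a q b. (p, a) \<in> t (2 * k + c - 1) \<and> (p, 0) \<in> A (2 * k + c - 1 - 1) \<and>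
      (q, b) \<in> A (2 * k + c) \<and> (q, 0) \<in> t (2 * k + c + 1) \<and> z k = a + b" by blast
  then obtain p a q b where v: "\<And>k. (p k, a k) \<in> t (2 * k + c - 1)"
    "\<And>k. (p k, 0) \<in> A (2 * k + c - 1 - 1)" "\<And>k. (q k, b k) \<in> A (2 * k + c)"
    "\<And>k. (q k, 0) \<in> t (2 * k + c + 1)" and z_eq: "\<And>k. z k = a k + b k"
    unfolding choice_iff by blast
  define y where "y l = p (l + j + 1) + q (l + j)" for l
  have "(y, z) \<in> dirac_reverse c j"
    unfolding dirac_reverse_iff
  proof
    fix k
    have "(q (k - 1), 0) \<in> t (2 * k + c - 1)" using v(4)[of "k - 1"] by (simp add: algebra_simps)
    from t_linear(2)[OF v(1) this] have 1: "(y (k - j - 1), a k) \<in> t (2 * k + c - 1)"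
      by (simp add: y_def)
    have "(p (k + 1), 0) \<in> A (2 * k + c)" using v(2)[of "k + 1"] by (simp add: algebra_simps)
    from A_linear(2)[OF this v(3)] have 2: "(y (k - j), b k) \<in> A (2 * k + c)"
      by (simp add: y_def)
    show "\<exists>a b. (y (k - j - 1), a) \<in> t (2 * k + c - 1) \<and> (y (k - j), b) \<in> A (2 * k + c) \<and> z k = a + b"
      using 1 2 by (intro exI[of _ "a k"] exI[of _ "b k"]) (simp add: z_eq)
  qed
  then show ?thesis by blast
qed

lemma Hodge_imp_spanned:
  assumes H: "\<And>m. Hodge m"
  shows "spanned (dirac_module c) (op_ker (dirac c j))
      (hm_closure (dirac_module c) (Range (dirac_reverse c j)))"
  unfolding spanned_def
proof
  fix x assume x: "x \<in> hm_carrier (dirac_module c)"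
  let ?T = "\<lambda>k. {a + b | a b. a \<in> Range (t (2 * k + c - 1)) \<and> b \<in> Range (A (2 * k + c))}"
  have "\<forall>k. \<exists>h. h \<in> harmonic (2 * k + c) \<and> x k - h \<in> hm_closure (E (2 * k + c)) (?T k)"
  proof
    fix k
    interpret hmodule "E (2 * k + c)" by (rule hm)
    obtain h b e where *: "h \<in> harmonic (2 * k + c)" "b \<in> coexact (2 * k + c)" "e \<in> exact (2 * k + c)"
      "x k = h + b + e"
      using H[of "2 * k + c"] x unfolding Hodge_def dirac_carrier by blast
    have P: "Range (t (2 * k + c - 1)) \<subseteq> hm_carrier (E (2 * k + c))" using t_carrier(2) by fastforce
    have Q: "Range (A (2 * k + c)) \<subseteq> hm_carrier (E (2 * k + c))" using A_carrier(1) by auto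
    have "e + b \<in> hm_closure (E (2 * k + c)) (?T k)"
      using *(2,3) unfolding exact_def coexact_def by (intro closure_sum_in_closure[OF P Q])
    moreover have "x k - h = e + b" using *(4) by simp
    ultimately have "x k - h \<in> hm_closure (E (2 * k + c)) (?T k)" by (simp only:)
    with *(1) show "\<exists>h. h \<in> harmonic (2 * k + c) \<and> x k - h \<in> hm_closure (E (2 * k + c)) (?T k)"
      by (intro exI[of _ h] conjI)
  qed
  then obtain h where "\<forall>k. h k \<in> harmonic (2 * k + c) \<and> x k - h k \<in> hm_closure (E (2 * k + c)) (?T k)"
    by (rule choice[THEN exE])
  then have h: "h k \<in> harmonic (2 * k + c)" "(x - h) k \<in> hm_closure (E (2 * k + c)) (?T k)" for k
    by simp_all
  have T: "?T k \<subseteq> hm_carrier (E (2 * k + c))" for k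
  proof -
    interpret hmodule "E (2 * k + c)" by (rule hm)
    have "Range (t (2 * k + c - 1)) \<subseteq> hm_carrier (E (2 * k + c))" using t_carrier(2) by fastforce
    moreover have "Range (A (2 * k + c)) \<subseteq> hm_carrier (E (2 * k + c))" using A_carrier(1) by auto
    ultimately show ?thesis by (blast intro: add_closed)
  qed
  have "x - h \<in> hm_closure (dirac_module c) {y. \<forall>k. y k \<in> ?T k}"
    unfolding dirac_module_def by (rule direct_sum.closure_componentwise[OF direct_sum T h(2)])
  moreover have "{y. \<forall>k. y k \<in> ?T k} \<subseteq> Range (dirac_reverse c j)"
    using Range_dirac_reverse[OF H] by blast
  ultimately have "x - h \<in> hm_closure (dirac_module c) (Range (dirac_reverse c j))"
    by (fastforce simp: hm_closure_def)
  moreover have "h \<in> op_ker (dirac c j)" using h(1) by (simp add: ker_dirac_iff)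
  moreover have "x = h + (x - h)" by simp
  ultimately show "\<exists>a\<in>op_ker (dirac c j). \<exists>b\<in>hm_closure (dirac_module c) (Range (dirac_reverse c j)). x = a + b"
    by blast
qed

lemma even_Dirac_eq: "even_Dirac E t = dirac 0 0"
proof -
  have app_t: "op_app (t m) x = a" if "(x, a) \<in> t m" for m x a
    unfolding op_app_def using that graph_pair.t_single[OF gp[OF refl]] by blast
  have app_A: "op_app (A m) x = a" if "(x, a) \<in> A m" for m x a
    unfolding op_app_def using that graph_pair.t_single[OF gp'[OF refl]] by blast
  have A1: "op_adjoint (E (2 * k + 1)) (E (2 * k + 2)) (t (2 * k + 1)) = A (2 * k + 1)" for k
  proof -
    have "2 * k + 1 + 1 = 2 * k + (2 :: int)" by simp
    then show ?thesis by (simp only: A_def)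
  qed
  have A2: "op_adjoint (E (2 * k - 1)) (E (2 * k)) (t (2 * k - 1)) = A (2 * k - 1)" for k
    by (simp add: A_def)
  have "(x, w) \<in> even_Dirac E t \<longleftrightarrow> (x, w) \<in> dirac 0 0" for x w
  proof
    assume "(x, w) \<in> even_Dirac E t"
    then have w: "w = (\<lambda>k. op_app (t (2 * k)) (x k) + op_app (A (2 * k + 1)) (x (k + 1)))"
      and x: "\<And>k. x k \<in> Domain (t (2 * k)) \<inter> Domain (A (2 * k - 1))"
      unfolding even_Dirac_def A1 A2 by auto
    show "(x, w) \<in> dirac 0 0"
      unfolding dirac_def
    proof (intro CollectI case_prodI allI)
      fix l
      obtain a where a: "(x l, a) \<in> t (2 * l)" using x by blast
      obtain b where b: "(x (l + 1), b) \<in> A (2 * l + 1)" using x[of "l + 1"] by (auto simp: algebra_simps)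
      show "\<exists>a b. (x (l + 0), a) \<in> t (2 * (l + 0) + 0) \<and> (x (l + 0 + 1), b) \<in> A (2 * (l + 0) + 0 + 1) \<and> w l = a + b"
        using a b app_t[OF a] app_A[OF b] by (auto simp: w)
    qed
  next
    assume xw: "(x, w) \<in> dirac 0 0"
    have ab: "\<exists>a b. (x l, a) \<in> t (2 * l) \<and> (x (l + 1), b) \<in> A (2 * l + 1) \<and> w l = a + b" for l
      using xw by (auto simp: dirac_def)
    have "w l = op_app (t (2 * l)) (x l) + op_app (A (2 * l + 1)) (x (l + 1))" for l
      using ab[of l] app_t app_A by auto
    moreover have "x k \<in> Domain (t (2 * k)) \<inter> Domain (A (2 * k - 1))" for k
      using ab[of k] ab[of "k - 1"] by (auto simp: algebra_simps)
    moreover have "x \<in> hm_carrier (even_module E)"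
      using subsetD[OF dirac_subset xw] by (simp add: even_module_def dirac_module_def)
    ultimately show "(x, w) \<in> even_Dirac E t"
      unfolding even_Dirac_def A1 A2 by auto
  qed
  then show ?thesis by auto
qed

theorem weak_Hodge_iff_even_Dirac:
  "weak_Hodge_decomposition E t \<longleftrightarrow> polar_decomposable (even_module E) (odd_module E) (even_Dirac E t)"
proof -
  have e: "even_module E = dirac_module 0" "odd_module E = dirac_module 1"
    by (simp_all add: even_module_def odd_module_def dirac_module_def)
  interpret D: graph_pair "dirac_module 0" "dirac_module 1" "dirac 0 0" "dirac 1 (- 1)"
    using dirac_graph_pair[of 0 0] by simp
  have "polar_decomposable (even_module E) (odd_module E) (even_Dirac E t) \<longleftrightarrow>
      spanned (dirac_module 0) (op_ker (dirac 0 0)) (hm_closure (dirac_module 0) (Range (dirac 1 (- 1)))) \<and>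
      spanned (dirac_module 1) (op_ker (dirac 1 (- 1))) (hm_closure (dirac_module 1) (Range (dirac 0 0)))"
    unfolding e even_Dirac_eq by (rule D.polar_decomposable_iff)
  also have "\<dots> \<longleftrightarrow> (\<forall>m. Hodge m)"
  proof
    assume *: "spanned (dirac_module 0) (op_ker (dirac 0 0)) (hm_closure (dirac_module 0) (Range (dirac 1 (- 1)))) \<and>
      spanned (dirac_module 1) (op_ker (dirac 1 (- 1))) (hm_closure (dirac_module 1) (Range (dirac 0 0)))"
    show "\<forall>m. Hodge m"
    proof
      fix m :: int
      have "Hodge (2 * k + 0)" "Hodge (2 * k + 1)" for k
        using spanned_imp_Hodge[of 0 0 k] spanned_imp_Hodge[of 1 "- 1" k] * by simp_all
      from this(1)[of "m div 2"] this(2)[of "m div 2"] show "Hodge m"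
        by (cases "even m") simp_all
    qed
  next
    assume "\<forall>m. Hodge m"
    then show "spanned (dirac_module 0) (op_ker (dirac 0 0)) (hm_closure (dirac_module 0) (Range (dirac 1 (- 1)))) \<and>
      spanned (dirac_module 1) (op_ker (dirac 1 (- 1))) (hm_closure (dirac_module 1) (Range (dirac 0 0)))"
      using Hodge_imp_spanned[of 0 0] Hodge_imp_spanned[of 1 "- 1"] by simp
  qed
  finally show ?thesis by (simp add: weak_Hodge_iff)
qed

end

theorem theorem1p5:
  fixes E :: "int \<Rightarrow> ('a::cstar_algebra, 'e::complex_vector) hilbert_mod"
    and t :: "int \<Rightarrow> ('e \<times> 'e) set"
  assumes "hilbert_complex E t"
  shows "(weak_Hodge_decomposition E t \<longleftrightarrow>
            (\<forall>k. polar_decomposable (E k) (E (k + 1)) (t k))) \<and>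
         (finite_length E \<longrightarrow>
           (weak_Hodge_decomposition E t \<longleftrightarrow>
              polar_decomposable (even_module E) (odd_module E) (even_Dirac E t)))"
proof (intro conjI impI)
  interpret Hilbert_complex E t by unfold_locales (rule assms)
  show "weak_Hodge_decomposition E t \<longleftrightarrow> (\<forall>k. polar_decomposable (E k) (E (k + 1)) (t k))"
    by (rule weak_Hodge_iff_polar)
  assume "finite_length E"
  then obtain N where N: "\<forall>k. \<bar>k\<bar> > N \<longrightarrow> hm_carrier (E k) = {0}" by (auto simp: finite_length_def)
  interpret finite_complex E t N by unfold_locales (use N in blast)
  show "weak_Hodge_decomposition E t \<longleftrightarrow>
      polar_decomposable (even_module E) (odd_module E) (even_Dirac E t)"
    by (rule weak_Hodge_iff_even_Dirac)
qed

end
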